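(* Let $M$ be a $3$-dimensional proper CR submanifold of the nearly Kähler manifold $(\mathbb{S}^3\times\mathbb{S}^3,g,J)$. If $P\mathcal{D}_1\perp\mathcal{D}_1$ (with respect to $g$), then $\mathcal{D}_1$ is not integrable if and only if $P\mathcal{D}_1=\mathcal{D}_3$.
   Context: Identify $\mathbb{S}^3$ with the unit quaternions in $\mathbb{H}=\mathbb{R}^4$. A tangent vector of $\mathbb{S}^3\times\mathbb{S}^3$ at $(p,q)$ is written $Z=(p\alpha,q\beta)$ with $\alpha,\beta\in\mathrm{Im}\,\mathbb{H}$. The almost complex structure is $J(p\alpha,q\beta)=\frac{1}{\sqrt3}\big(p(2\beta-\alpha),q(-2\alpha+\beta)\big)$, and the nearly Kähler metric is $g(Z,Z')=\frac12(\langle Z,Z'\rangle+\langle JZ,JZ'\rangle)$, where $\langle\cdot,\cdot\rangle$ is the standard product metric induced from $\mathbb{R}^4\times\mathbb{R}^4$. Let $\widetilde\nabla$ be the Levi-Civita connection of $g$ and $G(X,Y)=(\widetilde\nabla_XJ)Y$, a skew-symmetric tensor. The almost product structure $P$ is $P(p\alpha,q\beta)=(p\beta,q\alpha)$. A submanifold $M$ is a CR submanifold if there is a smooth distribution $\mathcal{D}_1\subseteq TM$ with $J\mathcal{D}_1=\mathcal{D}_1$ whose $g$-orthogonal complement $\mathcal{D}_1^\perp$ in $TM$ is totally real, i.e. $J\mathcal{D}_1^\perp\subseteq T^\perp M$, where $T^\perp M$ is the normal bundle. It is proper if it is neither almost complex nor totally real. For a $3$-dimensional proper CR submanifold, $\mathcal{D}_1=JTM\cap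 TM$ has rank $2$ and $\mathcal{D}_1^\perp$ has rank $1$. Along such $M$ put $\mathcal{D}_2=\mathcal{D}_1^\perp\oplus J\mathcal{D}_1^\perp$ and $\mathcal{D}_3=G(\mathcal{D}_1,\mathcal{D}_2)$. These are $J$-invariant rank-$2$ bundles over $M$, and $T(\mathbb{S}^3\times\mathbb{S}^3)|_M=\mathcal{D}_1\oplus\mathcal{D}_2\oplus\mathcal{D}_3$ is a $g$-orthogonal decomposition. $\mathcal{D}_1$ is integrable if it is closed under the Lie bracket of vector fields on $M$.
   Formalization: M is assumed connected: for a disconnected M, such as a disjoint union of an integrable and a non-integrable example, D1 is not integrable although PD1 = D3 fails on one component. *)

theory Defs
  imports "HOL-Analysis.Analysis"
begin

section \<open>Quaternions\<close>

text \<open>The quaternion \<open>a + u\<^sub>1 i + u\<^sub>2 j + u\<^sub>3 k\<close> is the pair \<open>(a, u)\<close>. The Euclidean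
  structure of the product type is the standard one of the four-dimensional real space.\<close>

type_synonym quat = "real \<times> (real^3)"

definition qmult :: "quat \<Rightarrow> quat \<Rightarrow> quat" (infixl \<open>\<cdot>\<close> 70) where
  "x \<cdot> y = (fst x * fst y - snd x \<bullet> snd y,
            fst x *\<^sub>R snd y + fst y *\<^sub>R snd x + cross3 (snd x) (snd y))"

definition qcnj :: "quat \<Rightarrow> quat" where
  "qcnj x = (fst x, - snd x)"

definition ImH :: "quat set" where
  "ImH = {x. fst x = 0}"


section \<open>Smoothness\<close>

fun Ck_on :: "nat \<Rightarrow> 'a::real_normed_vector set \<Rightarrow> ('a \<Rightarrow> 'b::real_normed_vector) \<Rightarrow> bool" where
  "Ck_on 0 S f = continuous_on S f"
| "Ck_on (Suc k) S f =
     ((\<forall>x\<in>S. f differentiable (at x)) \<and> (\<forall>v. Ck_on k S (\<lambda>x. frechet_derivative f (at x) v)))"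

text \<open>For functions on an open subset of a finite-dimensional space.\<close>

definition smooth_on :: "'a::real_normed_vector set \<Rightarrow> ('a \<Rightarrow> 'b::real_normed_vector) \<Rightarrow> bool" where
  "smooth_on S f \<longleftrightarrow> (\<forall>k. Ck_on k S f)"

text \<open>For functions on an embedded submanifold \<open>S\<close>: existence of a smooth extension to a neighbourhood.\<close>

definition smooth_along :: "'a::real_normed_vector set \<Rightarrow> ('a \<Rightarrow> 'b::real_normed_vector) \<Rightarrow> bool" where
  "smooth_along S f \<longleftrightarrow> (\<exists>U F. open U \<and> S \<subseteq> U \<and> smooth_on U F \<and> (\<forall>x\<in>S. F x = f x))"


section \<open>The nearly Kaehler manifold\<close>

text \<open>Points and tangent vectors both live in the ambient space \<open>quat \<times> quat\<close>; the tensors take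
  the base point as their first argument. At a point \<open>p\<close> of \<open>S3S3\<close> the components of \<open>p\<close> are unit
  quaternions, so a tangent vector \<open>Z\<close> at \<open>p\<close> has \<open>\<alpha> = qcnj (fst p) \<cdot> fst Z\<close> and
  \<open>\<beta> = qcnj (snd p) \<cdot> snd Z\<close>.\<close>

type_synonym quat2 = "quat \<times> quat"

definition S3S3 :: "quat2 set" where
  "S3S3 = sphere 0 1 \<times> sphere 0 1"

definition tanS :: "quat2 \<Rightarrow> quat2 set" where
  "tanS p = {(fst p \<cdot> \<alpha>, snd p \<cdot> \<beta>) | \<alpha> \<beta>. \<alpha> \<in> ImH \<and> \<beta> \<in> ImH}"

definition JS :: "quat2 \<Rightarrow> quat2 \<Rightarrow> quat2" where
  "JS p Z = (let \<alpha> = qcnj (fst p) \<cdot> fst Z; \<beta> = qcnj (snd p) \<cdot> snd Z in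
     (1 / sqrt 3) *\<^sub>R (fst p \<cdot> (2 *\<^sub>R \<beta> - \<alpha>), snd p \<cdot> (- 2 *\<^sub>R \<alpha> + \<beta>)))"

definition PS :: "quat2 \<Rightarrow> quat2 \<Rightarrow> quat2" where
  "PS p Z = (let \<alpha> = qcnj (fst p) \<cdot> fst Z; \<beta> = qcnj (snd p) \<cdot> snd Z in
     (fst p \<cdot> \<beta>, snd p \<cdot> \<alpha>))"

definition gS :: "quat2 \<Rightarrow> quat2 \<Rightarrow> quat2 \<Rightarrow> real" where
  "gS p Z Z' = 1/2 * (Z \<bullet> Z' + JS p Z \<bullet> JS p Z')"

definition vector_fieldS :: "(quat2 \<Rightarrow> quat2) \<Rightarrow> bool" where
  "vector_fieldS X \<longleftrightarrow> smooth_along S3S3 X \<and> (\<forall>p\<in>S3S3. X p \<in> tanS p)"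

text \<open>The derivative of a function on \<open>S3S3\<close> at \<open>p\<close>. A derivative within \<open>S3S3\<close> is determined by the
  function only on \<open>tanS p\<close>, and it is only applied to such vectors.\<close>

definition derivS :: "(quat2 \<Rightarrow> 'b::real_normed_vector) \<Rightarrow> quat2 \<Rightarrow> quat2 \<Rightarrow> 'b" where
  "derivS h p = frechet_derivative h (at p within S3S3)"

text \<open>The Lie bracket of vector fields regarded as functions with values in the ambient vector space;
  the commutator of the directional derivatives is again tangent.\<close>

definition bracketS :: "(quat2 \<Rightarrow> quat2) \<Rightarrow> (quat2 \<Rightarrow> quat2) \<Rightarrow> quat2 \<Rightarrow> quat2" where
  "bracketS X Y p = derivS Y p (X p) - derivS X p (Y p)"

text \<open>Vector fields matter only through their values on \<open>S3S3\<close>, so all equations are required there.\<close>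

definition Levi_Civita :: "((quat2 \<Rightarrow> quat2) \<Rightarrow> (quat2 \<Rightarrow> quat2) \<Rightarrow> quat2 \<Rightarrow> quat2) \<Rightarrow> bool" where
  "Levi_Civita nabla \<longleftrightarrow>
    (\<forall>X Y. vector_fieldS X \<longrightarrow> vector_fieldS Y \<longrightarrow> vector_fieldS (nabla X Y)) \<and>
    (\<forall>X X' Y. vector_fieldS X \<longrightarrow> vector_fieldS X' \<longrightarrow> vector_fieldS Y \<longrightarrow>
      (\<forall>p\<in>S3S3. nabla (\<lambda>q. X q + X' q) Y p = nabla X Y p + nabla X' Y p)) \<and>
    (\<forall>X Y (h :: quat2 \<Rightarrow> real). vector_fieldS X \<longrightarrow> vector_fieldS Y \<longrightarrow> smooth_along S3S3 h \<longrightarrow>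
      (\<forall>p\<in>S3S3. nabla (\<lambda>q. h q *\<^sub>R X q) Y p = h p *\<^sub>R nabla X Y p)) \<and>
    (\<forall>X Y Y'. vector_fieldS X \<longrightarrow> vector_fieldS Y \<longrightarrow> vector_fieldS Y' \<longrightarrow>
      (\<forall>p\<in>S3S3. nabla X (\<lambda>q. Y q + Y' q) p = nabla X Y p + nabla X Y' p)) \<and>
    (\<forall>X Y (h :: quat2 \<Rightarrow> real). vector_fieldS X \<longrightarrow> vector_fieldS Y \<longrightarrow> smooth_along S3S3 h \<longrightarrow>
      (\<forall>p\<in>S3S3. nabla X (\<lambda>q. h q *\<^sub>R Y q) p = derivS h p (X p) *\<^sub>R Y p + h p *\<^sub>R nabla X Y p)) \<and>
    (\<forall>X Y. vector_fieldS X \<longrightarrow> vector_fieldS Y \<longrightarrow>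
      (\<forall>p\<in>S3S3. nabla X Y p - nabla Y X p = bracketS X Y p)) \<and>
    (\<forall>X Y Z. vector_fieldS X \<longrightarrow> vector_fieldS Y \<longrightarrow> vector_fieldS Z \<longrightarrow>
      (\<forall>p\<in>S3S3. derivS (\<lambda>q. gS q (Y q) (Z q)) p (X p) = gS p (nabla X Y p) (Z p) + gS p (Y p) (nabla X Z p)))"

text \<open>\<open>(\<nabla>\<^sub>X JS) Y\<close>\<close>

definition GS :: "((quat2 \<Rightarrow> quat2) \<Rightarrow> (quat2 \<Rightarrow> quat2) \<Rightarrow> quat2 \<Rightarrow> quat2) \<Rightarrow>
    (quat2 \<Rightarrow> quat2) \<Rightarrow> (quat2 \<Rightarrow> quat2) \<Rightarrow> quat2 \<Rightarrow> quat2" where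
  "GS nabla X Y p = nabla X (\<lambda>q. JS q (Y q)) p - JS p (nabla X Y p)"


section \<open>Immersed submanifolds\<close>

text \<open>An atlas consists of local parametrizations \<open>\<phi>\<close> with open domain \<open>V\<close> in the model space \<open>'a\<close>,
  whose dimension is the dimension of the manifold.\<close>

record ('a, 'm) manifold =
  topology_of :: "'m topology"
  atlas :: "('a set \<times> ('a \<Rightarrow> 'm)) set"

abbreviation points :: "('a, 'm) manifold \<Rightarrow> 'm set" where
  "points M \<equiv> topspace (topology_of M)"

definition smooth_manifold :: "('a::euclidean_space, 'm) manifold \<Rightarrow> bool" where
  "smooth_manifold M \<longleftrightarrow>
    Hausdorff_space (topology_of M) \<and> second_countable (topology_of M) \<and>
    (\<forall>(V, \<phi>) \<in> atlas M. open V \<and> openin (topology_of M) (\<phi> ` V) \<and>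
       homeomorphic_map (top_of_set V) (subtopology (topology_of M) (\<phi> ` V)) \<phi>) \<and>
    (\<Union>(V, \<phi>) \<in> atlas M. \<phi> ` V) = points M \<and>
    (\<forall>(V, \<phi>) \<in> atlas M. \<forall>(W, \<psi>) \<in> atlas M.
       smooth_on {u \<in> V. \<phi> u \<in> \<psi> ` W} (inv_into W \<psi> \<circ> \<phi>))"

definition smooth_map :: "('a::euclidean_space, 'm) manifold \<Rightarrow> ('m \<Rightarrow> 'b::real_normed_vector) \<Rightarrow> bool" where
  "smooth_map M h \<longleftrightarrow> (\<forall>(V, \<phi>) \<in> atlas M. smooth_on V (h \<circ> \<phi>))"

definition immersed_submanifold :: "('a::euclidean_space, 'm) manifold \<Rightarrow> ('m \<Rightarrow> quat2) \<Rightarrow> bool" where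
  "immersed_submanifold M f \<longleftrightarrow>
    smooth_manifold M \<and> f ` points M \<subseteq> S3S3 \<and> smooth_map M f \<and>
    (\<forall>(V, \<phi>) \<in> atlas M. \<forall>u\<in>V. inj (frechet_derivative (f \<circ> \<phi>) (at u)))"

text \<open>Tangent vectors of \<open>M\<close> at \<open>x\<close> are identified with their images under the differential of \<open>f\<close>.\<close>

definition tanM :: "('a::euclidean_space, 'm) manifold \<Rightarrow> ('m \<Rightarrow> quat2) \<Rightarrow> 'm \<Rightarrow> quat2 set" where
  "tanM M f x = {v. \<exists>(V, \<phi>) \<in> atlas M. \<exists>u\<in>V. \<phi> u = x \<and> v \<in> range (frechet_derivative (f \<circ> \<phi>) (at u))}"

definition norM :: "('a::euclidean_space, 'm) manifold \<Rightarrow> ('m \<Rightarrow> quat2) \<Rightarrow> 'm \<Rightarrow> quat2 set" where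
  "norM M f x = {w \<in> tanS (f x). \<forall>v \<in> tanM M f x. gS (f x) w v = 0}"

text \<open>The derivative of \<open>h\<close> at \<open>x\<close> in the direction of \<open>v \<in> tanM M f x\<close>: if \<open>v\<close> is represented by the
  vector \<open>\<xi>\<close> in a chart, then the coordinate expression of \<open>h\<close> is differentiated in the direction \<open>\<xi>\<close>.
  By the chain rule the result does not depend on the chart.\<close>

definition derivM :: "('a::euclidean_space, 'm) manifold \<Rightarrow> ('m \<Rightarrow> quat2) \<Rightarrow>
    ('m \<Rightarrow> 'b::real_normed_vector) \<Rightarrow> 'm \<Rightarrow> quat2 \<Rightarrow> 'b" where
  "derivM M f h x v = (THE d. \<exists>(V, \<phi>) \<in> atlas M. \<exists>u\<in>V. \<exists>\<xi>. \<phi> u = x \<and>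
     frechet_derivative (f \<circ> \<phi>) (at u) \<xi> = v \<and> frechet_derivative (h \<circ> \<phi>) (at u) \<xi> = d)"

text \<open>As for \<open>S3S3\<close>: vector fields on \<open>M\<close> are functions with values in the ambient vector space.\<close>

definition bracketM :: "('a::euclidean_space, 'm) manifold \<Rightarrow> ('m \<Rightarrow> quat2) \<Rightarrow>
    ('m \<Rightarrow> quat2) \<Rightarrow> ('m \<Rightarrow> quat2) \<Rightarrow> 'm \<Rightarrow> quat2" where
  "bracketM M f X Y x = derivM M f Y x (X x) - derivM M f X x (Y x)"

text \<open>Subbundles of the tangent bundle of \<open>M\<close>: constant rank and smooth local frames.\<close>

definition smooth_distribution :: "('a::euclidean_space, 'm) manifold \<Rightarrow> ('m \<Rightarrow> quat2) \<Rightarrow>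
    ('m \<Rightarrow> quat2 set) \<Rightarrow> bool" where
  "smooth_distribution M f D \<longleftrightarrow> (\<forall>x\<in>points M. subspace (D x) \<and> D x \<subseteq> tanM M f x) \<and>
    (\<exists>r. \<forall>x\<in>points M. dim (D x) = r \<and>
      (\<exists>(V, \<phi>) \<in> atlas M. \<exists>W E. open W \<and> W \<subseteq> V \<and> x \<in> \<phi> ` W \<and>
        (\<forall>i<r. smooth_on W (E i)) \<and>
        (\<forall>u\<in>W. span ((\<lambda>i::nat. E i u) ` {..<r}) = D (\<phi> u))))"

definition integrable_distribution :: "('a::euclidean_space, 'm) manifold \<Rightarrow> ('m \<Rightarrow> quat2) \<Rightarrow>
    ('m \<Rightarrow> quat2 set) \<Rightarrow> bool" where
  "integrable_distribution M f D \<longleftrightarrow>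
    (\<forall>X Y. smooth_map M X \<longrightarrow> smooth_map M Y \<longrightarrow>
       (\<forall>x\<in>points M. X x \<in> D x) \<longrightarrow> (\<forall>x\<in>points M. Y x \<in> D x) \<longrightarrow>
       (\<forall>x\<in>points M. bracketM M f X Y x \<in> D x))"


section \<open>CR submanifolds\<close>

definition almost_complex :: "('a::euclidean_space, 'm) manifold \<Rightarrow> ('m \<Rightarrow> quat2) \<Rightarrow> bool" where
  "almost_complex M f \<longleftrightarrow> (\<forall>x\<in>points M. JS (f x) ` tanM M f x = tanM M f x)"

definition totally_real :: "('a::euclidean_space, 'm) manifold \<Rightarrow> ('m \<Rightarrow> quat2) \<Rightarrow> bool" where
  "totally_real M f \<longleftrightarrow> (\<forall>x\<in>points M. JS (f x) ` tanM M f x \<subseteq> norM M f x)"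

definition complement_in_tan :: "('a::euclidean_space, 'm) manifold \<Rightarrow> ('m \<Rightarrow> quat2) \<Rightarrow>
    ('m \<Rightarrow> quat2 set) \<Rightarrow> 'm \<Rightarrow> quat2 set" where
  "complement_in_tan M f D x = {v \<in> tanM M f x. \<forall>w \<in> D x. gS (f x) v w = 0}"

text \<open>The distribution \<open>D1\<close> exhibiting \<open>M\<close> as a CR submanifold is unique: it is the intersection of the
  tangent bundle of \<open>M\<close> with its image under \<open>JS\<close>.\<close>

definition proper_CR_submanifold :: "('a::euclidean_space, 'm) manifold \<Rightarrow> ('m \<Rightarrow> quat2) \<Rightarrow>
    ('m \<Rightarrow> quat2 set) \<Rightarrow> bool" where
  "proper_CR_submanifold M f D1 \<longleftrightarrow>
    immersed_submanifold M f \<and> smooth_distribution M f D1 \<and>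
    (\<forall>x\<in>points M. JS (f x) ` D1 x = D1 x) \<and>
    (\<forall>x\<in>points M. JS (f x) ` complement_in_tan M f D1 x \<subseteq> norM M f x) \<and>
    \<not> almost_complex M f \<and> \<not> totally_real M f"

definition D2 :: "('a::euclidean_space, 'm) manifold \<Rightarrow> ('m \<Rightarrow> quat2) \<Rightarrow>
    ('m \<Rightarrow> quat2 set) \<Rightarrow> 'm \<Rightarrow> quat2 set" where
  "D2 M f D1 x = {v + JS (f x) w | v w.
     v \<in> complement_in_tan M f D1 x \<and> w \<in> complement_in_tan M f D1 x}"

text \<open>\<open>GS nabla X Y\<close> at a point depends only on the values of \<open>X\<close> and \<open>Y\<close> there, so arbitrary vector fields
  on \<open>S3S3\<close> with values in \<open>D1\<close> and \<open>D2\<close> at that point may be used.\<close>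

definition D3 :: "((quat2 \<Rightarrow> quat2) \<Rightarrow> (quat2 \<Rightarrow> quat2) \<Rightarrow> quat2 \<Rightarrow> quat2) \<Rightarrow>
    ('a::euclidean_space, 'm) manifold \<Rightarrow> ('m \<Rightarrow> quat2) \<Rightarrow> ('m \<Rightarrow> quat2 set) \<Rightarrow> 'm \<Rightarrow> quat2 set" where
  "D3 nabla M f D1 x = span {GS nabla X Y (f x) | X Y.
     vector_fieldS X \<and> vector_fieldS Y \<and> X (f x) \<in> D1 x \<and> Y (f x) \<in> D2 M f D1 x}"

end

theory Submission
  imports Defs
begin

text \<open>Left translation turns every tangent space into \<open>complex^3\<close> so that \<open>JS\<close> becomes multiplication by
  \<open>\<i>\<close>, \<open>PS\<close> becomes conjugation, the metric becomes \<open>4/3 Re \<langle>x, y\<rangle>\<close>, and \<open>GS\<close> becomes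
  \<open>(2/3) \<i> cnj (x \<times> y)\<close>. Write \<open>\<cdot>\<close> for the complex bilinear dot product. Locally
  \<open>D1 = \<complex> e\<close> and \<open>TM = \<complex> e + \<real> v\<close>; the hypothesis on \<open>PS\<close> says that \<open>e \<cdot> e = 0\<close>, and
  \<open>PS D1 = D3\<close> says that \<open>cnj e\<close> is parallel to \<open>cnj (e \<times> v)\<close>, that is, \<open>e \<cdot> v = 0\<close>.

  Let \<open>R = [e, \<i> e] = c e + \<rho> v\<close>. Differentiating \<open>e \<cdot> e = 0\<close> gives \<open>e \<cdot> R = 0\<close>, so \<open>e \<cdot> v = 0\<close> wherever
  \<open>\<rho> \<noteq> 0\<close>. Differentiating \<open>e \<cdot> v = 0\<close> on an open set gives
  \<open>R \<cdot> v = - (4/3) \<i> e \<cdot> cnj (e \<times> v)\<close>, which is nonzero, so \<open>\<rho> \<noteq> 0\<close> there. As both equations are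
  closed conditions, the set where \<open>\<rho> \<noteq> 0\<close> is open and closed, hence empty or all of \<open>M\<close>.\<close>

section \<open>Calculus of smooth functions\<close>

text \<open>The value of \<open>R \<cdot> v\<close> comes from the canonical Hermitian connection.
  It keeps \<open>JS\<close> and \<open>PS\<close> parallel, so it commutes with \<i> and obeys the
  product rule for the bilinear dot product; its torsion
  \<open>T x y = (2/3) cnj (x \<times> y)\<close> is conjugate linear in each argument. As
  \<open>[e, v]\<close> and \<open>[\<i> e, v]\<close> are tangent, the derivatives of
  \<open>v\<close> along \<open>e\<close> and \<open>\<i> e\<close>, paired with \<open>e\<close>,
  give \<open>e \<cdot> T e v\<close> and \<open>- \<i> e \<cdot> T e v\<close>, while
  \<open>T e (\<i> e) = 0\<close>. The two contributions to \<open>R \<cdot> v\<close> add up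
  instead of cancelling, so 4/3 is twice 2/3. The value is nonzero because \<open>e \<times> (e
  \<times> v) = (e \<cdot> v) e - (e \<cdot> e) v = 0\<close>: hence
  \<open>e \<times> v = a e\<close> with a nonzero \<open>a\<close>, and
  \<open>e \<cdot> cnj (a e)\<close> is \<open>cnj a\<close> times the squared norm of
  \<open>e\<close>. It forces \<open>\<rho> \<noteq> 0\<close>, since \<open>R = c e\<close> would
  give \<open>R \<cdot> v = 0\<close>.\<close>

lemma frechet_derivative_eq:
  "(f has_derivative f') (at x) \<Longrightarrow> frechet_derivative f (at x) = f'"
  by (metis frechet_derivative_at)

lemma Ck_on_cong:
  assumes "open S" "\<And>x. x \<in> S \<Longrightarrow> f x = g x" "Ck_on k S f"
  shows "Ck_on k S g"
  using assms(2,3)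
proof (induction k arbitrary: f g)
  case 0
  then show ?case by (metis Ck_on.simps(1) continuous_on_cong)
next
  case (Suc k)
  have eq: "frechet_derivative f (at x) = frechet_derivative g (at x)" if "x \<in> S" for x
    using that Suc.prems assms(1) frechet_derivative_transform_within_open by fastforce
  have "Ck_on k S (\<lambda>x. frechet_derivative g (at x) v)" for v
    using Suc.IH[of "\<lambda>x. frechet_derivative f (at x) v"] Suc.prems eq by simp
  moreover have "g differentiable at x" if "x \<in> S" for x
    using that Suc.prems assms(1) has_derivative_transform_within_open
    unfolding differentiable_def by (metis Ck_on.simps(2) differentiable_def)
  ultimately show ?case by simp
qed

lemma Ck_on_subset: "Ck_on k S f \<Longrightarrow> T \<subseteq> S \<Longrightarrow> Ck_on k T f"
  by (induction k arbitrary: f) (auto intro: continuous_on_subset)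

lemma Ck_on_continuous: "Ck_on k S f \<Longrightarrow> continuous_on S f"
  by (cases k)
    (auto intro!: continuous_at_imp_continuous_on differentiable_imp_continuous_within)

lemma Ck_on_SucD: "Ck_on (Suc k) S f \<Longrightarrow> Ck_on k S f"
proof (induction k arbitrary: f)
  case 0
  then show ?case using Ck_on_continuous by (metis Ck_on.simps(1))
next
  case (Suc k)
  then show ?case by (metis Ck_on.simps(2))
qed

lemma Ck_on_local:
  assumes "\<And>x. x \<in> S \<Longrightarrow> \<exists>U. open U \<and> x \<in> U \<and> Ck_on k U f"
  shows "Ck_on k S f"
  using assms
proof (induction k arbitrary: f)
  case 0
  have "isCont f x" if "x \<in> S" for x
    using 0[OF that] by (auto simp: continuous_on_eq_continuous_at)
  then show ?case by (simp add: continuous_at_imp_continuous_on)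
next
  case (Suc k)
  have "Ck_on k S (\<lambda>x. frechet_derivative f (at x) v)" for v
    using Suc by (metis Ck_on.simps(2))
  then show ?case using Suc.prems by fastforce
qed

lemma Ck_on_const [simp]: "Ck_on k S (\<lambda>x. c)"
  by (induction k arbitrary: c) auto

lemma Ck_on_ident: "Ck_on k S (\<lambda>x. x)"
  by (cases k) (auto simp: continuous_on_id)

lemma Ck_on_bounded_linear:
  assumes "open S" "bounded_linear h" "Ck_on k S f"
  shows "Ck_on k S (\<lambda>x. h (f x))"
  using assms(3)
proof (induction k arbitrary: f)
  case 0
  then show ?case
    using assms(2) by (simp add: bounded_linear.continuous_on)
next
  case (Suc k)
  have D: "((\<lambda>x. h (f x)) has_derivative (\<lambda>v. h (frechet_derivative f (at x) v))) (at x)"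
    if "x \<in> S" for x
    using Suc.prems that by (auto intro!: bounded_linear.has_derivative[OF assms(2)]
        simp: frechet_derivative_works[symmetric])
  have "Ck_on k S (\<lambda>x. frechet_derivative (\<lambda>x. h (f x)) (at x) v)" for v
    by (rule Ck_on_cong[OF assms(1) _ Suc.IH[of "\<lambda>x. frechet_derivative f (at x) v"]])
      (use Suc.prems in \<open>auto simp add: frechet_derivative_eq[OF D]\<close>)
  with D show ?case by (auto simp: differentiable_def)
qed

lemma Ck_on_add:
  assumes "open S" "Ck_on k S f" "Ck_on k S g"
  shows "Ck_on k S (\<lambda>x. f x + g x)"
  using assms(2,3)
proof (induction k arbitrary: f g)
  case 0
  then show ?case by (simp add: continuous_on_add)
next
  case (Suc k)
  have D: "((\<lambda>x. f x + g x) has_derivative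
      (\<lambda>v. frechet_derivative f (at x) v + frechet_derivative g (at x) v)) (at x)"
    if "x \<in> S" for x
    using Suc.prems that by (auto intro!: has_derivative_add simp: frechet_derivative_works[symmetric])
  have "Ck_on k S (\<lambda>x. frechet_derivative (\<lambda>x. f x + g x) (at x) v)" for v
    by (rule Ck_on_cong[OF assms(1) _ Suc.IH[of "\<lambda>x. frechet_derivative f (at x) v"
            "\<lambda>x. frechet_derivative g (at x) v"]])
      (use Suc.prems in \<open>auto simp add: frechet_derivative_eq[OF D]\<close>)
  with D show ?case by (auto simp: differentiable_def)
qed

lemma Ck_on_sum:
  assumes "open S" "\<And>i. i \<in> I \<Longrightarrow> Ck_on k S (f i)"
  shows "Ck_on k S (\<lambda>x. \<Sum>i\<in>I. f i x)"
  using assms(2) by (induction I rule: infinite_finite_induct) (auto intro: Ck_on_add[OF assms(1)])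

lemma Ck_on_bilinear:
  assumes "open S" "bounded_bilinear b" "Ck_on k S f" "Ck_on k S g"
  shows "Ck_on k S (\<lambda>x. b (f x) (g x))"
  using assms(3,4)
proof (induction k arbitrary: f g)
  case 0
  then show ?case by (simp add: bounded_bilinear.continuous_on[OF assms(2)])
next
  case (Suc k)
  have D: "((\<lambda>x. b (f x) (g x)) has_derivative
      (\<lambda>v. b (f x) (frechet_derivative g (at x) v) + b (frechet_derivative f (at x) v) (g x))) (at x)"
    if "x \<in> S" for x
    using Suc.prems that by (auto intro!: bounded_bilinear.FDERIV[OF assms(2)]
        simp: frechet_derivative_works[symmetric])
  have "Ck_on k S (\<lambda>x. frechet_derivative (\<lambda>x. b (f x) (g x)) (at x) v)" for v
  proof (rule Ck_on_cong[OF assms(1)])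
    show "Ck_on k S (\<lambda>x. b (f x) (frechet_derivative g (at x) v) + b (frechet_derivative f (at x) v) (g x))"
      using Suc.prems Ck_on_SucD
      by (intro Ck_on_add[OF assms(1)] Suc.IH) (auto intro: Ck_on_SucD)
  qed (use assms in \<open>auto simp add: frechet_derivative_eq[OF D]\<close>)
  with D show ?case by (auto simp: differentiable_def)
qed

lemma Ck_on_inverse:
  fixes f :: "'a::real_normed_vector \<Rightarrow> 'b::real_normed_field"
  assumes "open S" "Ck_on k S f" "\<And>x. x \<in> S \<Longrightarrow> f x \<noteq> 0"
  shows "Ck_on k S (\<lambda>x. inverse (f x))"
  using assms(2)
proof (induction k)
  case 0
  then show ?case using assms(3) by (simp add: continuous_on_inverse)
next
  case (Suc k)
  have D: "((\<lambda>x. inverse (f x)) has_derivative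
      (\<lambda>v. - (inverse (f x) * frechet_derivative f (at x) v * inverse (f x)))) (at x)"
    if "x \<in> S" for x
    using Suc.prems that assms(3)
    by (auto intro!: has_derivative_inverse simp: frechet_derivative_works[symmetric])
  have inv: "Ck_on k S (\<lambda>x. inverse (f x))"
    using Suc.IH Suc.prems Ck_on_SucD by blast
  have "Ck_on k S (\<lambda>x. frechet_derivative (\<lambda>x. inverse (f x)) (at x) v)" for v
  proof (rule Ck_on_cong[OF assms(1)])
    show "Ck_on k S (\<lambda>x. - (inverse (f x) * frechet_derivative f (at x) v * inverse (f x)))"
      using Suc.prems inv
      by (intro Ck_on_bounded_linear[OF assms(1) bounded_linear_minus[OF bounded_linear_ident]]
          Ck_on_bilinear[OF assms(1) bounded_bilinear_mult]) auto
  qed (use assms in \<open>auto simp add: frechet_derivative_eq[OF D]\<close>)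
  with D show ?case by (auto simp: differentiable_def)
qed

text \<open>The chain rule differentiates \<open>g\<close> in the direction \<open>?f' x v\<close>,
  which varies with \<open>x\<close>, whereas \<open>Ck_on\<close> controls only fixed directions.
  Expanding in \<open>Basis\<close> reduces to finitely many fixed ones; this is why the
  intermediate space is Euclidean.\<close>

lemma Ck_on_compose:
  fixes f :: "'a::real_normed_vector \<Rightarrow> 'b::euclidean_space"
  assumes "open S" "open T" "f ` S \<subseteq> T" "Ck_on k S f" "Ck_on k T g"
  shows "Ck_on k S (\<lambda>x. g (f x))"
  using assms(4,5)
proof (induction k arbitrary: g)
  case 0
  then show ?case using assms(3) continuous_on_compose2 by (metis Ck_on.simps(1))
next
  case (Suc k)
  let ?f' = "\<lambda>x. frechet_derivative f (at x)" and ?g' = "\<lambda>y. frechet_derivative g (at y)"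
  have g': "(g has_derivative ?g' (f x)) (at (f x))" if "x \<in> S" for x
    using Suc.prems that assms(3) by (auto simp: frechet_derivative_works[symmetric])
  have D: "((\<lambda>x. g (f x)) has_derivative (\<lambda>v. ?g' (f x) (?f' x v))) (at x)" if "x \<in> S" for x
    using has_derivative_compose[of f "?f' x" x UNIV, OF _ g'[OF that]] Suc.prems that
    by (auto simp: frechet_derivative_works[symmetric])
  have exp: "?g' (f x) w = (\<Sum>b\<in>Basis. (w \<bullet> b) *\<^sub>R ?g' (f x) b)" if "x \<in> S" for x w
  proof -
    interpret bounded_linear "?g' (f x)" using g'[OF that] has_derivative_bounded_linear by blast
    show ?thesis by (subst (1) euclidean_representation[of w, symmetric]) (simp add: sum scaleR)
  qed
  have "Ck_on k S (\<lambda>x. frechet_derivative (\<lambda>x. g (f x)) (at x) v)" for v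
  proof (rule Ck_on_cong[OF assms(1)])
    show "Ck_on k S (\<lambda>x. \<Sum>b\<in>Basis. (?f' x v \<bullet> b) *\<^sub>R ?g' (f x) b)"
      using Suc.prems
      by (intro Ck_on_sum[OF assms(1)] Ck_on_bilinear[OF assms(1) bounded_bilinear_scaleR]
          Ck_on_bounded_linear[OF assms(1) bounded_linear_inner_left] Suc.IH)
        (auto intro: Ck_on_SucD)
  qed (use exp in \<open>auto simp add: frechet_derivative_eq[OF D]\<close>)
  with D show ?case by (auto simp: differentiable_def)
qed

lemma smooth_on_cong:
  assumes "open S" "\<And>x. x \<in> S \<Longrightarrow> f x = g x" "smooth_on S f"
  shows "smooth_on S g"
  using assms unfolding smooth_on_def by (blast intro: Ck_on_cong)

lemma smooth_on_subset: "smooth_on S f \<Longrightarrow> T \<subseteq> S \<Longrightarrow> smooth_on T f"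
  unfolding smooth_on_def by (blast intro: Ck_on_subset)

lemma smooth_on_local:
  assumes "\<And>x. x \<in> S \<Longrightarrow> \<exists>U. open U \<and> x \<in> U \<and> smooth_on U f"
  shows "smooth_on S f"
  unfolding smooth_on_def
proof
  fix k show "Ck_on k S f"
    by (rule Ck_on_local) (metis assms smooth_on_def)
qed

lemma smooth_on_const [simp]: "smooth_on S (\<lambda>x. c)"
  unfolding smooth_on_def by simp

lemma smooth_on_ident: "smooth_on S (\<lambda>x. x)"
  unfolding smooth_on_def by (simp add: Ck_on_ident)

lemma smooth_on_bounded_linear:
  "open S \<Longrightarrow> bounded_linear h \<Longrightarrow> smooth_on S f \<Longrightarrow> smooth_on S (\<lambda>x. h (f x))"
  unfolding smooth_on_def by (blast intro: Ck_on_bounded_linear)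

lemma smooth_on_bilinear:
  "open S \<Longrightarrow> bounded_bilinear b \<Longrightarrow> smooth_on S f \<Longrightarrow> smooth_on S g \<Longrightarrow> smooth_on S (\<lambda>x. b (f x) (g x))"
  unfolding smooth_on_def by (blast intro: Ck_on_bilinear)

lemma smooth_on_inverse:
  fixes f :: "'a::real_normed_vector \<Rightarrow> 'b::real_normed_field"
  shows "open S \<Longrightarrow> smooth_on S f \<Longrightarrow> (\<And>x. x \<in> S \<Longrightarrow> f x \<noteq> 0) \<Longrightarrow> smooth_on S (\<lambda>x. inverse (f x))"
  unfolding smooth_on_def by (blast intro: Ck_on_inverse)

lemma smooth_on_compose:
  fixes f :: "'a::real_normed_vector \<Rightarrow> 'b::euclidean_space"
  shows "open S \<Longrightarrow> open T \<Longrightarrow> f ` S \<subseteq> T \<Longrightarrow> smooth_on S f \<Longrightarrow> smooth_on T g \<Longrightarrow>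
    smooth_on S (\<lambda>x. g (f x))"
  unfolding smooth_on_def by (blast intro: Ck_on_compose)

lemma smooth_on_continuous: "smooth_on S f \<Longrightarrow> continuous_on S f"
  unfolding smooth_on_def using Ck_on_continuous by blast

lemma smooth_on_has_derivative:
  assumes "smooth_on S f" "x \<in> S"
  shows "(f has_derivative frechet_derivative f (at x)) (at x)"
proof -
  have "Ck_on (Suc 0) S f" using assms(1) smooth_on_def by blast
  then show ?thesis using assms(2) by (simp add: frechet_derivative_works[symmetric])
qed

lemma smooth_on_frechet_derivative:
  assumes "smooth_on S f"
  shows "smooth_on S (\<lambda>x. frechet_derivative f (at x) v)"
  unfolding smooth_on_def
proof
  fix k have "Ck_on (Suc k) S f" using assms smooth_on_def by blast
  then show "Ck_on k S (\<lambda>x. frechet_derivative f (at x) v)" by simp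
qed

section \<open>Symmetry of second derivatives\<close>

text \<open>The second difference is unchanged when \<open>v\<close> and \<open>w\<close> are
  swapped, while the mean value theorem, applied along \<open>v\<close> to the increment in the
  direction \<open>w\<close> and then along \<open>w\<close> to the derivative in the direction
  \<open>v\<close>, singles out one order of differentiation.\<close>

lemma second_difference_mean_value:
  fixes g :: "'a::real_normed_vector \<Rightarrow> real"
  assumes "smooth_on (ball u d) g" "s > 0" "s * (norm v + norm w) < d"
  obtains t1 t2 where "0 \<le> t1" "t1 \<le> s" "0 \<le> t2" "t2 \<le> s"
    "g (u + s *\<^sub>R v + s *\<^sub>R w) - g (u + s *\<^sub>R v) - g (u + s *\<^sub>R w) + g u
      = s * s * frechet_derivative (\<lambda>x. frechet_derivative g (at x) v) (at (u + t1 *\<^sub>R v + t2 *\<^sub>R w)) w"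
proof -
  let ?gv = "\<lambda>x. frechet_derivative g (at x) v"
  let ?gvw = "\<lambda>x. frechet_derivative ?gv (at x) w"
  have inb: "u + t1 *\<^sub>R v + t2 *\<^sub>R w \<in> ball u d" if "0 \<le> t1" "t1 \<le> s" "0 \<le> t2" "t2 \<le> s" for t1 t2
  proof -
    have "norm (t1 *\<^sub>R v + t2 *\<^sub>R w) \<le> norm (t1 *\<^sub>R v) + norm (t2 *\<^sub>R w)"
      by (rule norm_triangle_ineq)
    also have "\<dots> \<le> s * norm v + s * norm w"
      using that by (intro add_mono) (auto intro: mult_right_mono)
    finally show ?thesis using assms(3) by (simp add: mem_ball dist_norm algebra_simps norm_minus_commute)
  qed
  have D: "((\<lambda>t. g (a + t *\<^sub>R v)) has_real_derivative ?gv (a + t *\<^sub>R v)) (at t)"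
    if "a + t *\<^sub>R v \<in> ball u d" for a t
  proof -
    have "((\<lambda>t. g (a + t *\<^sub>R v)) has_derivative (\<lambda>h. frechet_derivative g (at (a + t *\<^sub>R v)) (h *\<^sub>R v))) (at t)"
      by (rule has_derivative_compose[of "\<lambda>t. a + t *\<^sub>R v" "\<lambda>h. h *\<^sub>R v" t UNIV g, OF _ smooth_on_has_derivative[OF assms(1) that]])
        (auto intro!: derivative_eq_intros)
    moreover have "linear (frechet_derivative g (at (a + t *\<^sub>R v)))"
      using smooth_on_has_derivative[OF assms(1) that] has_derivative_linear by blast
    ultimately show ?thesis
      by (simp add: has_field_derivative_def linear_cmul mult.commute[of _ "?gv _"])
  qed
  have Dv: "((\<lambda>t. ?gv (a + t *\<^sub>R w)) has_real_derivative ?gvw (a + t *\<^sub>R w)) (at t)"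
    if "a + t *\<^sub>R w \<in> ball u d" for a t
  proof -
    note sm = smooth_on_has_derivative[OF smooth_on_frechet_derivative[OF assms(1)] that]
    have "((\<lambda>t. ?gv (a + t *\<^sub>R w)) has_derivative (\<lambda>h. frechet_derivative ?gv (at (a + t *\<^sub>R w)) (h *\<^sub>R w))) (at t)"
      by (rule has_derivative_compose[of "\<lambda>t. a + t *\<^sub>R w" "\<lambda>h. h *\<^sub>R w" t UNIV ?gv, OF _ sm]) (auto intro!: derivative_eq_intros)
    moreover have "linear (frechet_derivative ?gv (at (a + t *\<^sub>R w)))"
      using sm has_derivative_linear by blast
    ultimately show ?thesis
      by (simp add: has_field_derivative_def linear_cmul mult.commute[of _ "?gvw _"])
  qed
  let ?h = "\<lambda>t. g (u + s *\<^sub>R w + t *\<^sub>R v) - g (u + t *\<^sub>R v)"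
  have inb': "u + s *\<^sub>R w + t *\<^sub>R v \<in> ball u d" "u + t *\<^sub>R v \<in> ball u d" if "0 \<le> t" "t \<le> s" for t
    using inb[of t s] inb[of t 0] that assms(2) by (simp_all add: ac_simps)
  have "\<exists>t1. 0 < t1 \<and> t1 < s \<and> ?h s - ?h 0 = (s - 0) * (?gv (u + s *\<^sub>R w + t1 *\<^sub>R v) - ?gv (u + t1 *\<^sub>R v))"
    by (rule MVT2[OF assms(2)]) (intro DERIV_diff D inb'; simp)
  then obtain t1 where t1: "0 < t1" "t1 < s"
    "?h s - ?h 0 = s * (?gv (u + s *\<^sub>R w + t1 *\<^sub>R v) - ?gv (u + t1 *\<^sub>R v))" by auto
  have "\<exists>t2. 0 < t2 \<and> t2 < s \<and> ?gv (u + t1 *\<^sub>R v + s *\<^sub>R w) - ?gv (u + t1 *\<^sub>R v + 0 *\<^sub>R w)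
      = (s - 0) * ?gvw (u + t1 *\<^sub>R v + t2 *\<^sub>R w)"
    by (rule MVT2[OF assms(2)]) (intro Dv inb; use t1 in simp)
  then obtain t2 where t2: "0 < t2" "t2 < s"
    "?gv (u + t1 *\<^sub>R v + s *\<^sub>R w) - ?gv (u + t1 *\<^sub>R v) = s * ?gvw (u + t1 *\<^sub>R v + t2 *\<^sub>R w)" by auto
  show ?thesis
    by (rule that[of t1 t2]) (use t1 t2 in \<open>auto simp: algebra_simps\<close>)
qed

text \<open>Both mixed derivatives, taken at suitable points arbitrarily close to \<open>u\<close>,
  equal the same second difference divided by \<open>s * s\<close>; continuity carries the equality
  to \<open>u\<close>.\<close>

lemma second_derivative_symmetric_real:
  fixes g :: "'a::real_normed_vector \<Rightarrow> real"
  assumes "open S" "smooth_on S g" "u \<in> S"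
  shows "frechet_derivative (\<lambda>x. frechet_derivative g (at x) v) (at u) w
       = frechet_derivative (\<lambda>x. frechet_derivative g (at x) w) (at u) v" (is "?A u = ?B u")
proof (rule ccontr)
  assume ne: "?A u \<noteq> ?B u"
  define e where "e = \<bar>?A u - ?B u\<bar> / 2"
  have e: "e > 0" using ne by (simp add: e_def)
  have "continuous_on S ?A" "continuous_on S ?B"
    by (intro smooth_on_continuous smooth_on_frechet_derivative assms(2))+
  then have cAB: "isCont ?A u" "isCont ?B u"
    using assms by (auto simp: continuous_on_eq_continuous_at)
  have ev: "\<forall>\<^sub>F x in nhds u. dist (?A x) (?A u) < e" "\<forall>\<^sub>F x in nhds u. dist (?B x) (?B u) < e"
    by (rule tendstoD[OF iffD1[OF tendsto_at_iff_tendsto_nhds cAB(1)[unfolded isCont_def]] e],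
        rule tendstoD[OF iffD1[OF tendsto_at_iff_tendsto_nhds cAB(2)[unfolded isCont_def]] e])
  obtain d1 where "d1 > 0" "\<And>x. dist x u < d1 \<Longrightarrow> dist (?A x) (?A u) < e"
    using ev(1) unfolding eventually_nhds_metric by blast
  moreover obtain d2 where "d2 > 0" "\<And>x. dist x u < d2 \<Longrightarrow> dist (?B x) (?B u) < e"
    using ev(2) unfolding eventually_nhds_metric by blast
  ultimately have d12: "d1 > 0" "d2 > 0" "\<And>x. dist x u < d1 \<Longrightarrow> \<bar>?A x - ?A u\<bar> < e"
    "\<And>x. dist x u < d2 \<Longrightarrow> \<bar>?B x - ?B u\<bar> < e"
    by (simp_all add: dist_real_def)
  obtain d3 where d3: "d3 > 0" "ball u d3 \<subseteq> S" using assms by (meson openE)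
  define d where "d = min d1 (min d2 d3)"
  have d: "d > 0" "d \<le> d1" "d \<le> d2" "d \<le> d3" using d12 d3 by (auto simp: d_def)
  have sm: "smooth_on (ball u d) g"
    using assms(2) d3 d by (meson smooth_on_subset subset_ball subset_trans)
  \<comment> \<open>The summand 1 keeps the denominator positive when both directions vanish and
    makes the bound on \<open>s\<close> strict.\<close>
  define s where "s = d / (norm v + norm w + 1)"
  have n1: "norm v + norm w + 1 > 0" by (smt (verit) norm_ge_zero)
  have s: "s > 0" "s * (norm v + norm w) < d"
    using d n1 by (auto simp: s_def field_simps)
  have inb: "dist (u + t1 *\<^sub>R v + t2 *\<^sub>R w) u < d" if "0 \<le> t1" "t1 \<le> s" "0 \<le> t2" "t2 \<le> s" for t1 t2
  proof -
    have "norm (t1 *\<^sub>R v + t2 *\<^sub>R w) \<le> norm (t1 *\<^sub>R v) + norm (t2 *\<^sub>R w)"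
      by (rule norm_triangle_ineq)
    also have "\<dots> \<le> s * norm v + s * norm w"
      using that by (intro add_mono) (auto intro: mult_right_mono)
    finally show ?thesis using s(2) by (simp add: dist_norm algebra_simps)
  qed
  obtain t1 t2 where t: "0 \<le> t1" "t1 \<le> s" "0 \<le> t2" "t2 \<le> s"
    "g (u + s *\<^sub>R v + s *\<^sub>R w) - g (u + s *\<^sub>R v) - g (u + s *\<^sub>R w) + g u
      = s * s * ?A (u + t1 *\<^sub>R v + t2 *\<^sub>R w)"
    using second_difference_mean_value[OF sm s] by metis
  obtain r1 r2 where r: "0 \<le> r1" "r1 \<le> s" "0 \<le> r2" "r2 \<le> s"
    "g (u + s *\<^sub>R w + s *\<^sub>R v) - g (u + s *\<^sub>R w) - g (u + s *\<^sub>R v) + g u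
      = s * s * ?B (u + r1 *\<^sub>R w + r2 *\<^sub>R v)"
    using second_difference_mean_value[OF sm s(1), of w v] s(2) by (metis add.commute)
  have "s * s * ?A (u + t1 *\<^sub>R v + t2 *\<^sub>R w) = s * s * ?B (u + r1 *\<^sub>R w + r2 *\<^sub>R v)"
    using t(5) r(5) by (simp add: algebra_simps)
  then have eq: "?A (u + t1 *\<^sub>R v + t2 *\<^sub>R w) = ?B (u + r1 *\<^sub>R w + r2 *\<^sub>R v)"
    using s(1) by simp
  have "\<bar>?A (u + t1 *\<^sub>R v + t2 *\<^sub>R w) - ?A u\<bar> < e"
    using d12(3) inb[OF t(1-4)] d by auto
  moreover have "\<bar>?B (u + r1 *\<^sub>R w + r2 *\<^sub>R v) - ?B u\<bar> < e"
    using d12(4) inb[of r2 r1] r d by (auto simp: ac_simps)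
  moreover have "\<bar>?A u - ?B u\<bar> = 2 * e" by (simp add: e_def)
  ultimately show False using eq by (smt (verit, best))
qed

lemma second_derivative_symmetric:
  fixes g :: "'a::real_normed_vector \<Rightarrow> 'b::euclidean_space"
  assumes "open S" "smooth_on S g" "u \<in> S"
  shows "frechet_derivative (\<lambda>x. frechet_derivative g (at x) v) (at u) w
       = frechet_derivative (\<lambda>x. frechet_derivative g (at x) w) (at u) v"
proof (rule euclidean_eqI)
  fix b :: 'b assume "b \<in> Basis"
  have sm: "smooth_on S (\<lambda>x. g x \<bullet> b)"
    by (intro smooth_on_bounded_linear[OF assms(1) bounded_linear_inner_left] assms(2))
  have 1: "frechet_derivative (\<lambda>x. h x \<bullet> b) (at x) v = frechet_derivative h (at x) v \<bullet> b"
    if "smooth_on S h" "x \<in> S" for h :: "'a \<Rightarrow> 'b" and x v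
    using frechet_derivative_eq[OF bounded_linear.has_derivative[OF bounded_linear_inner_left
          smooth_on_has_derivative[OF that]], of b] by simp
  have 2: "frechet_derivative (\<lambda>x. frechet_derivative (\<lambda>x. g x \<bullet> b) (at x) v) (at u) w
      = frechet_derivative (\<lambda>x. frechet_derivative g (at x) v) (at u) w \<bullet> b" for v w
  proof -
    have "frechet_derivative (\<lambda>x. frechet_derivative (\<lambda>x. g x \<bullet> b) (at x) v) (at u)
      = frechet_derivative (\<lambda>x. frechet_derivative g (at x) v \<bullet> b) (at u)"
      by (rule frechet_derivative_transform_within_open[OF _ assms(1,3)])
        (use smooth_on_has_derivative[OF smooth_on_frechet_derivative[OF sm] assms(3)]
          1[OF assms(2)] in \<open>auto simp: differentiable_def\<close>)
    then show ?thesis by (simp add: 1[OF smooth_on_frechet_derivative[OF assms(2)] assms(3)])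
  qed
  show "frechet_derivative (\<lambda>x. frechet_derivative g (at x) v) (at u) w \<bullet> b
       = frechet_derivative (\<lambda>x. frechet_derivative g (at x) w) (at u) v \<bullet> b"
    using second_derivative_symmetric_real[OF assms(1) sm assms(3)] by (simp add: 2)
qed

section \<open>Tangency of brackets along an immersion\<close>

text \<open>Linear maps close to an injective one are uniformly injective: a left inverse
  \<open>L\<close> of \<open>A0\<close> recovers \<open>\<zeta> i\<close> up to an error controlled
  by the distance of \<open>A i\<close> from \<open>A0\<close> on \<open>Basis\<close>, times the
  norm of \<open>\<zeta> i\<close>.\<close>

lemma tendsto_preimage:
  fixes A :: "'i \<Rightarrow> 'c::euclidean_space \<Rightarrow> 'b::euclidean_space"
  assumes "F \<noteq> bot" "\<forall>\<^sub>F i in F. linear (A i)" "linear A0" "inj A0"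
    and lim: "\<And>\<xi>. ((\<lambda>i. A i \<xi>) \<longlongrightarrow> A0 \<xi>) F"
    and \<zeta>: "\<forall>\<^sub>F i in F. w i = A i (\<zeta> i)" and w: "(w \<longlongrightarrow> w0) F"
  obtains \<zeta>0 where "A0 \<zeta>0 = w0" "(\<zeta> \<longlongrightarrow> \<zeta>0) F"
proof -
  obtain L where L: "linear L" "L \<circ> A0 = id"
    using linear_injective_left_inverse[OF assms(3,4)] by blast
  have LA: "L (A0 \<zeta>) = \<zeta>" for \<zeta> using L(2) by (metis comp_apply id_apply)
  interpret L: bounded_linear L using L(1) linear_conv_bounded_linear by blast
  interpret A0: bounded_linear A0 using assms(3) linear_conv_bounded_linear by blast
  define K where "K = onorm L"
  have K: "norm (L x) \<le> K * norm x" "0 \<le> K" for x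
    unfolding K_def by (auto simp: onorm L.bounded_linear_axioms onorm_pos_le)
  define \<epsilon> where "\<epsilon> i = (\<Sum>b\<in>Basis. norm (A i b - A0 b))" for i
  have "(\<epsilon> \<longlongrightarrow> (\<Sum>b\<in>(Basis::'c set). norm (A0 b - A0 b))) F"
    unfolding \<epsilon>_def by (intro tendsto_intros lim)
  then have eps0: "(\<epsilon> \<longlongrightarrow> 0) F" by simp
  have eps_pos: "\<epsilon> i \<ge> 0" for i by (simp add: \<epsilon>_def sum_nonneg)
  have bd: "norm (A i z - A0 z) \<le> norm z * \<epsilon> i" if "linear (A i)" for i z
  proof -
    interpret Ai: linear "A i" by fact
    have "A i z - A0 z = (\<Sum>b\<in>Basis. (z \<bullet> b) *\<^sub>R (A i b - A0 b))"
      by (subst (1 2) euclidean_representation[of z, symmetric])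
        (simp add: Ai.sum Ai.scaleR A0.sum A0.scaleR sum_subtractf scaleR_diff_right)
    also have "norm \<dots> \<le> (\<Sum>b\<in>Basis. norm z * norm (A i b - A0 b))"
      by (rule sum_norm_le) (auto intro!: mult_right_mono Basis_le_norm)
    finally show ?thesis by (simp add: \<epsilon>_def sum_distrib_left)
  qed
  have "\<forall>\<^sub>F i in F. K * \<epsilon> i < 1/2"
  proof -
    have "((\<lambda>i. K * \<epsilon> i) \<longlongrightarrow> K * 0) F" by (intro tendsto_intros eps0)
    then show ?thesis by (rule order_tendstoD) simp
  qed
  then have small: "\<forall>\<^sub>F i in F. norm (\<zeta> i - L (w i)) \<le> K * (2 * norm (L (w i)) * \<epsilon> i)"
    using \<zeta> assms(2)
  proof eventually_elim
    case (elim i)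
    have d: "norm (w i - A0 (\<zeta> i)) \<le> norm (\<zeta> i) * \<epsilon> i" using bd elim by simp
    have "norm (\<zeta> i - L (w i)) = norm (L (w i - A0 (\<zeta> i)))"
      by (simp add: L.diff LA norm_minus_commute)
    also have le: "\<dots> \<le> K * (norm (\<zeta> i) * \<epsilon> i)"
      using K d by (meson mult_left_mono order_trans)
    also have "\<dots> = (K * \<epsilon> i) * norm (\<zeta> i)" by (simp add: ac_simps)
    \<comment> \<open>Half the norm of \<open>\<zeta> i\<close> can be absorbed into the left side,
      which bounds \<open>\<zeta> i\<close> by the convergent \<open>L (w i)\<close>.\<close>
    also have "\<dots> \<le> 1/2 * norm (\<zeta> i)" using elim by (intro mult_right_mono) auto
    finally have "norm (\<zeta> i) \<le> 2 * norm (L (w i))"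
      using norm_triangle_sub[of "\<zeta> i" "L (w i)"] by simp
    then have "K * (norm (\<zeta> i) * \<epsilon> i) \<le> K * (2 * norm (L (w i)) * \<epsilon> i)"
      using eps_pos[of i] K(2) by (intro mult_left_mono mult_right_mono)
    then show ?case using le by (simp add: L.diff LA norm_minus_commute)
  qed
  have "((\<lambda>i. K * (2 * norm (L (w i)) * \<epsilon> i)) \<longlongrightarrow> K * (2 * norm (L w0) * 0)) F"
    by (intro tendsto_intros eps0 L.tendsto w)
  then have "((\<lambda>i. \<zeta> i - L (w i)) \<longlongrightarrow> 0) F"
    using Lim_null_comparison[OF small] by simp
  then have "((\<lambda>i. (\<zeta> i - L (w i)) + L (w i)) \<longlongrightarrow> 0 + L w0) F"
    by (intro tendsto_intros L.tendsto w)
  then have \<zeta>lim: "(\<zeta> \<longlongrightarrow> L w0) F" by simp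
  have "((\<lambda>i. norm (\<zeta> i) * \<epsilon> i) \<longlongrightarrow> norm (L w0) * 0) F"
    by (intro tendsto_intros eps0 \<zeta>lim)
  moreover have "\<forall>\<^sub>F i in F. norm (w i - A0 (\<zeta> i)) \<le> norm (\<zeta> i) * \<epsilon> i"
    using \<zeta> assms(2) by eventually_elim (simp add: bd)
  ultimately have "((\<lambda>i. w i - A0 (\<zeta> i)) \<longlongrightarrow> 0) F"
    using Lim_null_comparison[of "\<lambda>i. w i - A0 (\<zeta> i)" "\<lambda>i. norm (\<zeta> i) * \<epsilon> i" F] by simp
  moreover have "((\<lambda>i. w i - A0 (\<zeta> i)) \<longlongrightarrow> w0 - A0 (L w0)) F"
    by (intro tendsto_intros w A0.tendsto \<zeta>lim)
  ultimately have "w0 - A0 (L w0) = 0" using assms(1) tendsto_unique by blast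
  then show ?thesis using that[of "L w0"] \<zeta>lim by simp
qed

lemma limit_in_range:
  fixes A :: "'i \<Rightarrow> 'c::euclidean_space \<Rightarrow> 'b::euclidean_space"
  assumes "F \<noteq> bot" "\<forall>\<^sub>F i in F. linear (A i)" "linear A0" "inj A0"
    and "\<And>\<xi>. ((\<lambda>i. A i \<xi>) \<longlongrightarrow> A0 \<xi>) F"
    and "\<forall>\<^sub>F i in F. w i \<in> range (A i)" "(w \<longlongrightarrow> w0) F"
  shows "w0 \<in> range A0"
proof -
  have "\<forall>\<^sub>F i in F. w i = A i (SOME z. w i = A i z)"
    using assms(6) by eventually_elim (auto intro: someI)
  from tendsto_preimage[OF assms(1-5) this assms(7)] show ?thesis by (metis rangeI)
qed

text \<open>Formally \<open>X\<close> is the differential of \<open>F\<close> applied to a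
  coefficient function with value \<open>\<xi>\<close> at \<open>u\<close>, and the difference is
  that differential applied to the derivative of the coefficients. Differentiability of the
  coefficients is bypassed: difference quotients lie in the ranges at nearby points, and
  \<open>limit_in_range\<close> passes to the limit.\<close>

lemma derivative_along_range:
  fixes F :: "'a::euclidean_space \<Rightarrow> 'b::euclidean_space"
  assumes S: "open S" "u \<in> S" and F: "smooth_on S F" "inj (frechet_derivative F (at u))"
    and X: "smooth_on S X" "\<And>x. x \<in> S \<Longrightarrow> X x \<in> range (frechet_derivative F (at x))"
    and Xu: "X u = frechet_derivative F (at u) \<xi>"
  shows "frechet_derivative X (at u) \<eta>
      - frechet_derivative (\<lambda>x. frechet_derivative F (at x) \<xi>) (at u) \<eta> \<in> range (frechet_derivative F (at u))"
proof -
  let ?F' = "\<lambda>x. frechet_derivative F (at x)"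
  have lin: "linear (?F' x)" if "x \<in> S" for x
    using smooth_on_has_derivative[OF F(1) that] has_derivative_linear by blast
  have lim0: "((\<lambda>t. u + t *\<^sub>R \<eta>) \<longlongrightarrow> u + 0 *\<^sub>R \<eta>) (at (0::real))"
    by (intro tendsto_intros)
  then have inS: "\<forall>\<^sub>F t in at 0. u + t *\<^sub>R \<eta> \<in> S"
    using S by (simp add: topological_tendstoD)
  have dq: "((\<lambda>t. (h (u + t *\<^sub>R \<eta>) - h u) /\<^sub>R t) \<longlongrightarrow> frechet_derivative h (at u) \<eta>) (at 0)"
    if "smooth_on S h" for h :: "'a \<Rightarrow> 'b"
  proof -
    note hd = smooth_on_has_derivative[OF that S(2)]
    have "((\<lambda>t. h (u + t *\<^sub>R \<eta>)) has_derivative (\<lambda>t. frechet_derivative h (at u) (t *\<^sub>R \<eta>))) (at 0)"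
      by (rule has_derivative_compose[of "\<lambda>t. u + t *\<^sub>R \<eta>" "\<lambda>t. t *\<^sub>R \<eta>" 0 UNIV h])
        (use hd in \<open>auto intro!: derivative_eq_intros\<close>)
    then have "((\<lambda>t. h (u + t *\<^sub>R \<eta>)) has_vector_derivative frechet_derivative h (at u) \<eta>) (at 0)"
      using has_derivative_linear[OF hd] by (simp add: has_vector_derivative_def linear_cmul)
    then have "((\<lambda>t. norm (h (u + t *\<^sub>R \<eta>) - h u - t *\<^sub>R frechet_derivative h (at u) \<eta>) / norm t) \<longlongrightarrow> 0) (at 0)"
      by (simp add: has_vector_derivative_def has_derivative_at)
    moreover have "norm (h (u + t *\<^sub>R \<eta>) - h u - t *\<^sub>R frechet_derivative h (at u) \<eta>) / norm t
      = norm ((h (u + t *\<^sub>R \<eta>) - h u) /\<^sub>R t - frechet_derivative h (at u) \<eta>)" if "t \<noteq> 0" for t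
    proof -
      have "(h (u + t *\<^sub>R \<eta>) - h u) /\<^sub>R t - frechet_derivative h (at u) \<eta>
        = (h (u + t *\<^sub>R \<eta>) - h u - t *\<^sub>R frechet_derivative h (at u) \<eta>) /\<^sub>R t"
        using that by (simp add: algebra_simps)
      then show ?thesis by (simp add: divide_inverse_commute)
    qed
    ultimately have "((\<lambda>t. norm ((h (u + t *\<^sub>R \<eta>) - h u) /\<^sub>R t - frechet_derivative h (at u) \<eta>)) \<longlongrightarrow> 0) (at 0)"
      by (subst Lim_cong_within[OF refl refl refl, symmetric]) auto
    then show ?thesis by (simp add: tendsto_norm_zero_iff LIM_zero_iff)
  qed
  show ?thesis
  proof (rule limit_in_range[where F="at (0::real)" and A="\<lambda>t. ?F' (u + t *\<^sub>R \<eta>)"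
        and w="\<lambda>t. (X (u + t *\<^sub>R \<eta>) - X u) /\<^sub>R t - (?F' (u + t *\<^sub>R \<eta>) \<xi> - ?F' u \<xi>) /\<^sub>R t"])
    show "\<forall>\<^sub>F t in at 0. linear (?F' (u + t *\<^sub>R \<eta>))"
      using inS by eventually_elim (rule lin)
    show "linear (?F' u)" using lin S by blast
    show "((\<lambda>t. ?F' (u + t *\<^sub>R \<eta>) \<xi>) \<longlongrightarrow> ?F' u \<xi>) (at 0)" for \<xi>
    proof (rule isCont_tendsto_compose[where g="\<lambda>x. ?F' x \<xi>"])
      show "isCont (\<lambda>x. ?F' x \<xi>) u"
        using smooth_on_continuous[OF smooth_on_frechet_derivative[OF F(1)]] S
        by (simp add: continuous_on_eq_continuous_at)
    qed (use lim0 in simp)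
    show "\<forall>\<^sub>F t in at 0. (X (u + t *\<^sub>R \<eta>) - X u) /\<^sub>R t - (?F' (u + t *\<^sub>R \<eta>) \<xi> - ?F' u \<xi>) /\<^sub>R t
        \<in> range (?F' (u + t *\<^sub>R \<eta>))"
      using inS
    proof eventually_elim
      case (elim t)
      have sub: "subspace (range (?F' (u + t *\<^sub>R \<eta>)))"
        using lin[OF elim] linear_subspace_image subspace_UNIV by blast
      have "(X (u + t *\<^sub>R \<eta>) - X u) /\<^sub>R t - (?F' (u + t *\<^sub>R \<eta>) \<xi> - ?F' u \<xi>) /\<^sub>R t
        = inverse t *\<^sub>R (X (u + t *\<^sub>R \<eta>) - ?F' (u + t *\<^sub>R \<eta>) \<xi>)"
        by (simp add: Xu algebra_simps)
      then show ?case using X(2)[OF elim] sub by (metis subspace_diff subspace_scale rangeI)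
    qed
  qed (use F(2) in \<open>auto intro!: tendsto_diff dq X smooth_on_frechet_derivative F\<close>)
qed

text \<open>Modulo the range, each term is a second derivative of \<open>F\<close> in the directions
  \<open>\<xi>\<close> and \<open>\<eta>\<close>; by symmetry the two cancel.\<close>

lemma bracket_in_range:
  fixes F :: "'a::euclidean_space \<Rightarrow> 'b::euclidean_space"
  assumes S: "open S" "u \<in> S" and F: "smooth_on S F" "inj (frechet_derivative F (at u))"
    and X: "smooth_on S X" "\<And>x. x \<in> S \<Longrightarrow> X x \<in> range (frechet_derivative F (at x))"
    and Y: "smooth_on S Y" "\<And>x. x \<in> S \<Longrightarrow> Y x \<in> range (frechet_derivative F (at x))"
    and "X u = frechet_derivative F (at u) \<xi>" "Y u = frechet_derivative F (at u) \<eta>"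
  shows "frechet_derivative Y (at u) \<xi> - frechet_derivative X (at u) \<eta> \<in> range (frechet_derivative F (at u))"
proof -
  have "linear (frechet_derivative F (at u))"
    using smooth_on_has_derivative[OF F(1) S(2)] has_derivative_linear by blast
  then have sub: "subspace (range (frechet_derivative F (at u)))"
    using linear_subspace_image subspace_UNIV by blast
  from subspace_diff[OF sub derivative_along_range[OF S F Y assms(10), of \<xi>]
      derivative_along_range[OF S F X assms(9), of \<eta>]]
  show ?thesis by (simp add: second_derivative_symmetric[OF S(1) F(1) S(2), of \<xi> \<eta>])
qed

section \<open>Three-dimensional complex vectors\<close>

definition cdot :: "complex^3 \<Rightarrow> complex^3 \<Rightarrow> complex" where
  "cdot x y = x$1 * y$1 + x$2 * y$2 + x$3 * y$3"

definition ccross :: "complex^3 \<Rightarrow> complex^3 \<Rightarrow> complex^3" where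
  "ccross x y = vector [x$2 * y$3 - x$3 * y$2, x$3 * y$1 - x$1 * y$3, x$1 * y$2 - x$2 * y$1]"

definition vcnj :: "complex^3 \<Rightarrow> complex^3" where
  "vcnj x = (\<chi> i. cnj (x$i))"

text \<open>The bracket of the left-invariant fields with constant components \<open>x\<close> and
  \<open>y\<close>: it is the bracket
  \<open>(2 \<alpha> \<times> \<alpha>', 2 \<beta> \<times> \<beta>')\<close> of two copies of the
  imaginary quaternions in complex coordinates. It is only real bilinear.\<close>

definition lie :: "complex^3 \<Rightarrow> complex^3 \<Rightarrow> complex^3" where
  "lie x y = (2/3) *s (2 *s ccross x y + ccross (vcnj x) y + ccross x (vcnj y) - ccross (vcnj x) (vcnj y))"

lemma ccross_nth [simp]:
  "ccross x y $ 1 = x$2 * y$3 - x$3 * y$2"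
  "ccross x y $ 2 = x$3 * y$1 - x$1 * y$3"
  "ccross x y $ 3 = x$1 * y$2 - x$2 * y$1"
  by (simp_all add: ccross_def)

lemma vcnj_nth [simp]: "vcnj x $ i = cnj (x$i)"
  by (simp add: vcnj_def)

lemmas c3_simps = vec_eq_iff forall_3 cdot_def lie_def vector_scalar_mult_def

lemma norm_c3: "(norm x)\<^sup>2 = (norm (x$1))\<^sup>2 + (norm (x$2))\<^sup>2 + (norm (x$3))\<^sup>2" for x :: "complex^3"
  by (simp add: norm_vec_def L2_set_def sum_3)

lemma cdot_vcnj_self: "cdot x (vcnj x) = of_real ((norm x)\<^sup>2)"
  by (simp add: cdot_def norm_c3 complex_norm_square[symmetric])

lemma cdot_vcnj_self_eq_0_iff [simp]: "cdot x (vcnj x) = 0 \<longleftrightarrow> x = 0"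
  unfolding cdot_vcnj_self by simp

lemma inner_c3: "x \<bullet> y = Re (cdot x (vcnj y))" for x y :: "complex^3"
  by (simp add: inner_vec_def sum_3 cdot_def inner_complex_def)

lemma scaleR_c3: "r *\<^sub>R x = of_real r *s (x :: complex^3)"
  by (simp add: vec_eq_iff complex_eq_iff)

lemma cdot_commute: "cdot x y = cdot y x"
  by (simp add: cdot_def)

lemma cdot_linear:
  "cdot (x + y) z = cdot x z + cdot y z" "cdot z (x + y) = cdot z x + cdot z y"
  "cdot (x - y) z = cdot x z - cdot y z" "cdot z (x - y) = cdot z x - cdot z y"
  "cdot (c *s x) z = c * cdot x z" "cdot z (c *s x) = c * cdot z x"
  "cdot 0 z = 0" "cdot z 0 = 0"
  by (simp_all add: c3_simps algebra_simps)

lemma vcnj_linear [simp]: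
  "vcnj (x + y) = vcnj x + vcnj y" "vcnj (x - y) = vcnj x - vcnj y"
  "vcnj (c *s x) = cnj c *s vcnj x" "vcnj (vcnj x) = x" "vcnj 0 = 0"
  by (simp_all add: c3_simps)

lemma cdot_vcnj: "cdot (vcnj x) (vcnj y) = cnj (cdot x y)"
  by (simp add: cdot_def)

lemma ccross_linear:
  "ccross (x + y) z = ccross x z + ccross y z" "ccross z (x + y) = ccross z x + ccross z y"
  "ccross (c *s x) z = c *s ccross x z" "ccross z (c *s x) = c *s ccross z x"
  by (simp_all add: c3_simps algebra_simps)

lemma bounded_bilinear_cdot: "bounded_bilinear cdot"
  unfolding bilinear_conv_bounded_bilinear[symmetric]
  by (auto simp: bilinear_def linear_iff cdot_linear scaleR_c3) (simp_all add: scaleR_conv_of_real)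

lemma bounded_bilinear_ccross: "bounded_bilinear ccross"
  unfolding bilinear_conv_bounded_bilinear[symmetric]
  by (auto simp: bilinear_def linear_iff ccross_linear scaleR_c3)

lemma bounded_linear_vcnj: "bounded_linear vcnj"
  unfolding linear_conv_bounded_linear[symmetric] by (auto simp: linear_iff scaleR_c3)

lemma bounded_bilinear_smult: "bounded_bilinear ((*s) :: complex \<Rightarrow> complex^3 \<Rightarrow> complex^3)"
  unfolding bilinear_conv_bounded_bilinear[symmetric]
  by (auto simp: bilinear_def linear_iff vec_eq_iff algebra_simps)

section \<open>The left trivialization of the tangent bundle\<close>

lemma qmult_simps [simp]:
  "x \<cdot> (y + z) = x \<cdot> y + x \<cdot> z" "(y + z) \<cdot> x = y \<cdot> x + z \<cdot> x"
  "x \<cdot> (y - z) = x \<cdot> y - x \<cdot> z" "(y - z) \<cdot> x = y \<cdot> x - z \<cdot> x"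
  "x \<cdot> (r *\<^sub>R y) = r *\<^sub>R (x \<cdot> y)" "(r *\<^sub>R y) \<cdot> x = r *\<^sub>R (y \<cdot> x)"
  by (auto simp: qmult_def prod_eq_iff algebra_simps inner_simps vec_eq_iff forall_3 cross3_def)

lemma qmult_assoc: "(x \<cdot> y) \<cdot> z = x \<cdot> (y \<cdot> z)"
  by (simp add: qmult_def prod_eq_iff vec_eq_iff forall_3 cross3_def inner_vec_def sum_3 algebra_simps)

lemma qcnj_mult_cancel: "qcnj p \<cdot> (p \<cdot> x) = (norm p)\<^sup>2 *\<^sub>R x"
  by (simp add: qcnj_def qmult_def prod_eq_iff vec_eq_iff forall_3 cross3_def inner_vec_def sum_3
      power2_norm_eq_inner inner_prod_def algebra_simps)

lemma qmult_qcnj_cancel: "p \<cdot> (qcnj p \<cdot> x) = (norm p)\<^sup>2 *\<^sub>R x"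
  by (simp add: qcnj_def qmult_def prod_eq_iff vec_eq_iff forall_3 cross3_def inner_vec_def sum_3
      power2_norm_eq_inner inner_prod_def algebra_simps)

lemma inner_qmult: "(p \<cdot> x) \<bullet> (p \<cdot> y) = (norm p)\<^sup>2 * (x \<bullet> y)"
  by (simp add: qmult_def cross3_def inner_vec_def sum_3 power2_norm_eq_inner inner_prod_def algebra_simps)

lemma fst_qcnj_mult: "fst (qcnj p \<cdot> x) = p \<bullet> x"
  by (simp add: qcnj_def qmult_def inner_prod_def)

definition im_quat :: "real^3 \<Rightarrow> quat" where
  "im_quat a = (0, a)"

text \<open>The factor \<open>1 / sqrt 3\<close> is forced: \<open>JS\<close> sends the fixed vector
  \<open>(r, r)\<close> of \<open>PS\<close> to \<open>(r, - r)\<close> divided by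
  \<open>sqrt 3\<close>, which therefore must be the vector with components
  \<open>\<i> r\<close>.\<close>

definition alpha :: "complex^3 \<Rightarrow> real^3" where
  "alpha x = (\<chi> i. Re (x$i) + Im (x$i) / sqrt 3)"

definition beta :: "complex^3 \<Rightarrow> real^3" where
  "beta x = (\<chi> i. Re (x$i) - Im (x$i) / sqrt 3)"

definition untriv :: "quat2 \<Rightarrow> complex^3 \<Rightarrow> quat2" where
  "untriv p x = (fst p \<cdot> im_quat (alpha x), snd p \<cdot> im_quat (beta x))"

text \<open>The real vectors of \<open>complex^3\<close> correspond to the fixed vectors of \<open>PS\<close>, and multiplication by
  \<open>\<i>\<close> to \<open>JS\<close>: the tangent vector given by \<open>(\<alpha>, \<beta>)\<close> has the components
  \<open>(\<alpha> + \<beta>) / 2 + \<i> sqrt 3 (\<alpha> - \<beta>) / 2\<close>.\<close>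

definition triv :: "quat2 \<Rightarrow> quat2 \<Rightarrow> complex^3" where
  "triv p Z = (let a = snd (qcnj (fst p) \<cdot> fst Z); b = snd (qcnj (snd p) \<cdot> snd Z) in
     (\<chi> i. Complex ((a$i + b$i) / 2) (sqrt 3 * (a$i - b$i) / 2)))"

lemma S3S3_norm: "p \<in> S3S3 \<Longrightarrow> norm (fst p) = 1" "p \<in> S3S3 \<Longrightarrow> norm (snd p) = 1"
  by (auto simp: S3S3_def)

lemma triv_untriv [simp]:
  assumes "p \<in> S3S3"
  shows "triv p (untriv p x) = x"
  using S3S3_norm[OF assms]
  by (simp add: triv_def untriv_def qcnj_mult_cancel im_quat_def alpha_def beta_def
      vec_eq_iff complex_eq_iff field_simps)

lemma untriv_in_tanS [simp]: "untriv p x \<in> tanS p"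
  by (auto simp: untriv_def tanS_def ImH_def im_quat_def)

lemma tanS_iff:
  assumes "p \<in> S3S3"
  shows "Z \<in> tanS p \<longleftrightarrow> fst p \<bullet> fst Z = 0 \<and> snd p \<bullet> snd Z = 0"
proof
  assume "Z \<in> tanS p"
  then obtain a b where Z: "Z = (fst p \<cdot> a, snd p \<cdot> b)" "fst a = 0" "fst b = 0"
    by (auto simp: tanS_def ImH_def)
  have "p1 \<bullet> (p1 \<cdot> c) = (norm p1)\<^sup>2 * fst c" for p1 c :: quat
    by (simp add: fst_qcnj_mult[symmetric] qcnj_mult_cancel)
  then show "fst p \<bullet> fst Z = 0 \<and> snd p \<bullet> snd Z = 0" using Z by simp
next
  assume "fst p \<bullet> fst Z = 0 \<and> snd p \<bullet> snd Z = 0"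
  then have "qcnj (fst p) \<cdot> fst Z \<in> ImH" "qcnj (snd p) \<cdot> snd Z \<in> ImH"
    by (auto simp: ImH_def fst_qcnj_mult)
  moreover have "Z = (fst p \<cdot> (qcnj (fst p) \<cdot> fst Z), snd p \<cdot> (qcnj (snd p) \<cdot> snd Z))"
    using S3S3_norm[OF assms] by (simp add: qmult_qcnj_cancel)
  ultimately show "Z \<in> tanS p" unfolding tanS_def by blast
qed

lemma untriv_triv [simp]:
  assumes "p \<in> S3S3" "Z \<in> tanS p"
  shows "untriv p (triv p Z) = Z"
proof -
  obtain a b where Z: "Z = (fst p \<cdot> im_quat a, snd p \<cdot> im_quat b)"
    using assms(2) by (auto simp: tanS_def ImH_def im_quat_def)
  have "alpha (triv p Z) = a" "beta (triv p Z) = b"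
    using S3S3_norm[OF assms(1)]
    by (simp_all add: Z alpha_def beta_def triv_def qcnj_mult_cancel im_quat_def vec_eq_iff field_simps)
  then show ?thesis by (simp add: untriv_def Z)
qed

lemma im_quat_linear: "im_quat (x + y) = im_quat x + im_quat y" "im_quat (x - y) = im_quat x - im_quat y"
  "im_quat (r *\<^sub>R x) = r *\<^sub>R im_quat x"
  by (simp_all add: im_quat_def)

lemma alpha_beta_linear:
  "alpha (x + y) = alpha x + alpha y" "alpha (r *\<^sub>R x) = r *\<^sub>R alpha x"
  "beta (x + y) = beta x + beta y" "beta (r *\<^sub>R x) = r *\<^sub>R beta x"
  by (simp_all add: alpha_def beta_def vec_eq_iff field_simps)

text \<open>The base point enters linearly too, as a vector of the ambient space. Thus the product
  rule for bilinear maps differentiates fields in the trivialization, and the formula itself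
  provides smooth extensions off \<open>S3S3\<close>.\<close>

lemma bounded_bilinear_untriv: "bounded_bilinear untriv"
  unfolding bilinear_conv_bounded_bilinear[symmetric]
  by (auto simp: bilinear_def linear_iff untriv_def im_quat_linear alpha_beta_linear)

lemma bounded_bilinear_triv: "bounded_bilinear triv"
proof -
  define C :: "real^3 \<Rightarrow> real^3 \<Rightarrow> complex^3"
    where "C a b = (\<chi> i. Complex ((a$i + b$i) / 2) (sqrt 3 * (a$i - b$i) / 2))" for a b
  have C: "C (a + a') (b + b') = C a b + C a' b'" "C (r *\<^sub>R a) (r *\<^sub>R b) = r *\<^sub>R C a b" for a b a' b' r
    by (simp_all add: C_def vec_eq_iff complex_eq_iff field_simps)
  have q: "qcnj (x + y) = qcnj x + qcnj y" "qcnj (r *\<^sub>R x) = r *\<^sub>R qcnj x" for x y r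
    by (simp_all add: qcnj_def)
  have "triv p Z = C (snd (qcnj (fst p) \<cdot> fst Z)) (snd (qcnj (snd p) \<cdot> snd Z))" for p Z
    by (simp add: triv_def C_def Let_def)
  then show ?thesis
    unfolding bilinear_conv_bounded_bilinear[symmetric] by (simp add: bilinear_def linear_iff q C)
qed

interpretation untriv: bounded_bilinear untriv by (rule bounded_bilinear_untriv)
interpretation triv: bounded_bilinear triv by (rule bounded_bilinear_triv)

lemma JS_untriv [simp]:
  assumes "p \<in> S3S3"
  shows "JS p (untriv p x) = untriv p (\<i> *s x)"
proof -
  have "alpha (\<i> *s x) = (1 / sqrt 3) *\<^sub>R (2 *\<^sub>R beta x - alpha x)"
    "beta (\<i> *s x) = (1 / sqrt 3) *\<^sub>R (- 2 *\<^sub>R alpha x + beta x)"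
    by (simp_all add: alpha_def beta_def vec_eq_iff field_simps)
  then show ?thesis
    using S3S3_norm[OF assms]
    by (simp add: JS_def Let_def untriv_def qcnj_mult_cancel im_quat_linear)
qed

lemma PS_untriv [simp]:
  assumes "p \<in> S3S3"
  shows "PS p (untriv p x) = untriv p (vcnj x)"
proof -
  have "alpha (vcnj x) = beta x" "beta (vcnj x) = alpha x"
    by (simp_all add: alpha_def beta_def vec_eq_iff)
  then show ?thesis
    using S3S3_norm[OF assms] by (simp add: PS_def Let_def untriv_def qcnj_mult_cancel)
qed

text \<open>The ambient metric weights real parts by 2 and imaginary parts by 2/3. Multiplication by
  \<i> exchanges the two weights, and averaging over \<open>JS\<close> yields 4/3 for both.\<close>

lemma gS_untriv [simp]:
  assumes "p \<in> S3S3"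
  shows "gS p (untriv p x) (untriv p y) = 4/3 * (x \<bullet> y)"
proof -
  have u: "untriv p x \<bullet> untriv p y = alpha x \<bullet> alpha y + beta x \<bullet> beta y" for x y
    using S3S3_norm[OF assms] by (simp add: untriv_def inner_qmult im_quat_def)
  have ab: "alpha x \<bullet> alpha y + beta x \<bullet> beta y
      = (\<Sum>i\<in>UNIV. 2 * (Re (x$i) * Re (y$i)) + 2/3 * (Im (x$i) * Im (y$i)))" for x y
    unfolding inner_vec_def sum.distrib[symmetric]
    by (rule sum.cong) (simp_all add: alpha_def beta_def field_simps)
  show ?thesis
    by (simp only: gS_def JS_untriv[OF assms] u ab) (simp add: inner_vec_def sum_3 inner_complex_def field_simps)
qed

text \<open>Iterated left translation becomes a product of imaginary quaternions, whose commutator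
  is twice the cross product. This is the part of a Lie bracket that comes from the moving base
  point, without derivatives of components.\<close>

lemma untriv_untriv: "untriv (untriv p x) y - untriv (untriv p y) x = untriv p (lie x y)"
proof -
  \<comment> \<open>With \<open>s\<close> in place of the root, both identities are polynomial
    modulo the single relation \<open>3 * (s * s) = 1\<close>.\<close>
  define s where "s = inverse (sqrt 3)"
  have s: "3 * (s * s) = 1" by (simp add: s_def field_simps)
  have nth: "alpha x $ i = Re (x$i) + s * Im (x$i)" "beta x $ i = Re (x$i) - s * Im (x$i)" for x i
    by (simp_all add: alpha_def beta_def s_def divide_inverse)
  have comm: "im_quat a \<cdot> im_quat b - im_quat b \<cdot> im_quat a = im_quat (2 *\<^sub>R cross3 a b)" for a b
    by (simp add: im_quat_def qmult_def inner_commute cross3_def vec_eq_iff forall_3)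
  have "2 *\<^sub>R cross3 (alpha x) (alpha y) = alpha (lie x y)"
    unfolding vec_eq_iff forall_3 nth by (intro conjI; simp add: cross3_def nth lie_def; use s in algebra)
  then have a: "im_quat (alpha x) \<cdot> im_quat (alpha y) - im_quat (alpha y) \<cdot> im_quat (alpha x) = im_quat (alpha (lie x y))"
    by (simp only: comm)
  have "2 *\<^sub>R cross3 (beta x) (beta y) = beta (lie x y)"
    unfolding vec_eq_iff forall_3 nth by (intro conjI; simp add: cross3_def nth lie_def; use s in algebra)
  then have b: "im_quat (beta x) \<cdot> im_quat (beta y) - im_quat (beta y) \<cdot> im_quat (beta x) = im_quat (beta (lie x y))"
    by (simp only: comm)
  show ?thesis
    by (simp add: untriv_def qmult_assoc a[symmetric] b[symmetric])
qed

section \<open>The Levi-Civita connection and the tensor \<open>GS\<close>\<close>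

text \<open>The curve is the tangent line pushed radially back to the sphere; the scaling factor is
  even in \<open>t\<close>, so it does not affect the velocity at 0.\<close>

lemma sphere_curve:
  fixes p v :: "'a::real_inner"
  assumes "norm p = 1" "p \<bullet> v = 0"
  defines "\<gamma> \<equiv> \<lambda>t::real. (1 / sqrt (1 + t * t * (v \<bullet> v))) *\<^sub>R (p + t *\<^sub>R v)"
  shows "norm (\<gamma> t) = 1" "\<gamma> 0 = p" "(\<gamma> has_derivative (\<lambda>t. t *\<^sub>R v)) (at 0)"
proof -
  have pos: "0 < 1 + t * t * (v \<bullet> v)" for t by (smt (verit) inner_ge_zero zero_le_square zero_le_mult_iff)
  have "(p + t *\<^sub>R v) \<bullet> (p + t *\<^sub>R v) = 1 + t * t * (v \<bullet> v)"
    using assms by (simp add: inner_simps norm_eq_1 inner_commute)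
  then have "norm (p + t *\<^sub>R v) = sqrt (1 + t * t * (v \<bullet> v))"
    by (simp add: norm_eq_sqrt_inner)
  then show "norm (\<gamma> t) = 1" using pos[of t] by (simp add: \<gamma>_def)
  show "\<gamma> 0 = p" by (simp add: \<gamma>_def)
  have "((\<lambda>t. 1 / sqrt (1 + t * t * (v \<bullet> v))) has_real_derivative 0) (at 0)"
    by (auto intro!: derivative_eq_intros)
  then have 1: "((\<lambda>t. 1 / sqrt (1 + t * t * (v \<bullet> v))) has_derivative (\<lambda>t. 0)) (at 0)"
    by (simp only: has_field_derivative_def lambda_zero)
  have 2: "((\<lambda>t. p + t *\<^sub>R v) has_derivative (\<lambda>t. t *\<^sub>R v)) (at 0)"
    by (auto intro!: derivative_eq_intros)
  show "(\<gamma> has_derivative (\<lambda>t. t *\<^sub>R v)) (at 0)"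
    using has_derivative_scaleR[OF 1 2] by (simp add: \<gamma>_def)
qed

text \<open>The derivative within \<open>S3S3\<close> is tested along a curve, since the choice in
  \<^const>\<open>frechet_derivative\<close> is only unique on tangent vectors.\<close>

lemma derivS_eq:
  assumes p: "p \<in> S3S3" and v: "v \<in> tanS p"
    and h: "(h has_derivative h') (at p within S3S3)"
  shows "derivS h p v = h' v"
proof -
  define \<gamma> where "\<gamma> t = ((1 / sqrt (1 + t * t * (fst v \<bullet> fst v))) *\<^sub>R (fst p + t *\<^sub>R fst v),
    (1 / sqrt (1 + t * t * (snd v \<bullet> snd v))) *\<^sub>R (snd p + t *\<^sub>R snd v))" for t :: real
  have *: "norm (fst p) = 1" "norm (snd p) = 1" "fst p \<bullet> fst v = 0" "snd p \<bullet> snd v = 0"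
    using p v tanS_iff S3S3_norm by blast+
  note c = sphere_curve[OF *(1,3)] sphere_curve[OF *(2,4)]
  have "norm (fst (\<gamma> t)) = 1" "norm (snd (\<gamma> t)) = 1" for t
    by (simp_all only: \<gamma>_def fst_conv snd_conv c(1,4))
  then have "\<gamma> t \<in> S3S3" for t
    by (simp add: S3S3_def mem_Times_iff del: split_paired_All)
  moreover have "\<gamma> 0 = p" by (simp add: \<gamma>_def)
  ultimately have \<gamma>: "range \<gamma> \<subseteq> S3S3" "\<gamma> 0 = p" by blast+
  have "(\<gamma> has_derivative (\<lambda>t. (t *\<^sub>R fst v, t *\<^sub>R snd v))) (at 0)"
    unfolding \<gamma>_def by (rule has_derivative_Pair[OF c(3,6)])
  then have \<gamma>': "(\<gamma> has_derivative (\<lambda>t. t *\<^sub>R v)) (at 0)"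
    by (simp add: scaleR_prod_def)
  have uni: "((\<lambda>t. h (\<gamma> t)) has_derivative (\<lambda>t. D (t *\<^sub>R v))) (at 0)"
    if "(h has_derivative D) (at p within S3S3)" for D
    using has_derivative_in_compose[OF \<gamma>', of h D] has_derivative_subset[OF that \<gamma>(1)] \<gamma>(2) by simp
  have "h differentiable (at p within S3S3)" using h differentiableI by blast
  then have "(h has_derivative derivS h p) (at p within S3S3)"
    unfolding derivS_def frechet_derivative_works .
  from has_derivative_unique[OF uni[OF this] uni[OF h]]
  show ?thesis by (metis scaleR_one)
qed

lemma vector_fieldS_in_tanS: "vector_fieldS X \<Longrightarrow> p \<in> S3S3 \<Longrightarrow> X p \<in> tanS p"
  by (simp add: vector_fieldS_def)

definition coords :: "(quat2 \<Rightarrow> quat2) \<Rightarrow> quat2 \<Rightarrow> complex^3" where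
  "coords X p = triv p (X p)"

lemma untriv_coords: "vector_fieldS X \<Longrightarrow> p \<in> S3S3 \<Longrightarrow> untriv p (coords X p) = X p"
  by (simp add: coords_def vector_fieldS_in_tanS)

lemma coords_differentiable:
  assumes "vector_fieldS X" "p \<in> S3S3"
  obtains x' where "(coords X has_derivative x') (at p within S3S3)"
proof -
  obtain U F where F: "open U" "S3S3 \<subseteq> U" "smooth_on U F" "\<And>q. q \<in> S3S3 \<Longrightarrow> F q = X q"
    using assms(1) unfolding vector_fieldS_def smooth_along_def by blast
  have "(F has_derivative frechet_derivative F (at p)) (at p within S3S3)"
    using smooth_on_has_derivative[OF F(3)] F(2) assms(2) has_derivative_at_withinI by blast
  then have "(X has_derivative frechet_derivative F (at p)) (at p within S3S3)"
    by (rule has_derivative_transform[OF assms(2), rotated]) (simp add: F(4))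
  from triv.FDERIV[OF has_derivative_ident this]
  have "(coords X has_derivative (\<lambda>h. triv p (frechet_derivative F (at p) h) + triv h (X p))) (at p within S3S3)"
    by (simp add: coords_def[abs_def])
  then show ?thesis by (rule that)
qed

lemma coords_has_derivative:
  assumes "vector_fieldS X" "p \<in> S3S3"
  obtains x' where "(coords X has_derivative x') (at p within S3S3)"
    "\<And>v. v \<in> tanS p \<Longrightarrow> derivS (coords X) p v = x' v"
  using coords_differentiable[OF assms] derivS_eq[OF assms(2)] by metis

lemma derivS_vector_field:
  assumes "vector_fieldS X" "p \<in> S3S3" "v \<in> tanS p"
  shows "derivS X p v = untriv p (derivS (coords X) p v) + untriv v (coords X p)"
proof -
  obtain x' where x': "(coords X has_derivative x') (at p within S3S3)" "derivS (coords X) p v = x' v"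
    using coords_has_derivative[OF assms(1,2)] assms(3) by metis
  have "((\<lambda>q. untriv q (coords X q)) has_derivative
      (\<lambda>h. untriv p (x' h) + untriv h (coords X p))) (at p within S3S3)"
    using untriv.FDERIV[OF has_derivative_ident x'(1)] .
  then have "(X has_derivative (\<lambda>h. untriv p (x' h) + untriv h (coords X p))) (at p within S3S3)"
    by (rule has_derivative_transform[OF assms(2), rotated]) (simp add: untriv_coords[OF assms(1)])
  from derivS_eq[OF assms(2,3) this] show ?thesis by (simp add: x'(2))
qed

lemma bracketS_coords:
  assumes "vector_fieldS X" "vector_fieldS Y" "p \<in> S3S3"
  shows "bracketS X Y p = untriv p (derivS (coords Y) p (X p) - derivS (coords X) p (Y p)
    + lie (coords X p) (coords Y p))"
proof -
  have "untriv (X p) (coords Y p) - untriv (Y p) (coords X p) = untriv p (lie (coords X p) (coords Y p))"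
    using untriv_untriv[of p "coords X p" "coords Y p"] assms by (simp add: untriv_coords)
  then show ?thesis
    using assms
    by (simp add: bracketS_def derivS_vector_field vector_fieldS_in_tanS untriv.add_right
        untriv.diff_right algebra_simps)
qed

lemma derivS_gS:
  assumes "vector_fieldS Y" "vector_fieldS Z" "p \<in> S3S3" "v \<in> tanS p"
  shows "derivS (\<lambda>q. gS q (Y q) (Z q)) p v
    = 4/3 * (derivS (coords Y) p v \<bullet> coords Z p + coords Y p \<bullet> derivS (coords Z) p v)"
proof -
  obtain y' where y': "(coords Y has_derivative y') (at p within S3S3)" "derivS (coords Y) p v = y' v"
    using coords_has_derivative[OF assms(1,3)] assms(4) by metis
  obtain z' where z': "(coords Z has_derivative z') (at p within S3S3)" "derivS (coords Z) p v = z' v"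
    using coords_has_derivative[OF assms(2,3)] assms(4) by metis
  have "((\<lambda>q. 4/3 * (coords Y q \<bullet> coords Z q)) has_derivative
      (\<lambda>h. 4/3 * (coords Y p \<bullet> z' h + y' h \<bullet> coords Z p))) (at p within S3S3)"
    by (intro has_derivative_mult_right has_derivative_inner y' z')
  moreover have "gS q (Y q) (Z q) = 4/3 * (coords Y q \<bullet> coords Z q)" if "q \<in> S3S3" for q
    using gS_untriv[OF that, of "coords Y q" "coords Z q"] by (simp only: untriv_coords assms that)
  ultimately have "((\<lambda>q. gS q (Y q) (Z q)) has_derivative
      (\<lambda>h. 4/3 * (coords Y p \<bullet> z' h + y' h \<bullet> coords Z p))) (at p within S3S3)"
    using has_derivative_transform[OF assms(3), of "\<lambda>q. gS q (Y q) (Z q)" "\<lambda>q. 4/3 * (coords Y q \<bullet> coords Z q)"]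
    by blast
  from derivS_eq[OF assms(3,4) this] show ?thesis by (simp add: y' z')
qed

lemma smooth_on_untriv: "open U \<Longrightarrow> smooth_on U F \<Longrightarrow> smooth_on U x \<Longrightarrow> smooth_on U (\<lambda>q. untriv (F q) (x q))"
  by (rule smooth_on_bilinear[OF _ bounded_bilinear_untriv])

lemma smooth_on_triv: "open U \<Longrightarrow> smooth_on U F \<Longrightarrow> smooth_on U X \<Longrightarrow> smooth_on U (\<lambda>q. triv (F q) (X q))"
  by (rule smooth_on_bilinear[OF _ bounded_bilinear_triv])

lemma smooth_on_smult:
  "open U \<Longrightarrow> smooth_on U c \<Longrightarrow> smooth_on U x \<Longrightarrow> smooth_on U (\<lambda>q. (c q :: complex) *s (x q :: complex^3))"
  by (rule smooth_on_bilinear[OF _ bounded_bilinear_smult])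

text \<open>Parallelizability in use: every tangent vector extends to a global smooth field with
  constant components, which serves below both as a test field and as an argument of
  \<open>GS\<close>.\<close>

lemma vector_fieldS_left_invariant: "vector_fieldS (\<lambda>q. untriv q c)"
  unfolding vector_fieldS_def smooth_along_def
  by (auto intro!: exI[of _ UNIV] exI[of _ "\<lambda>q. untriv q c"] smooth_on_untriv smooth_on_ident)

lemma vector_fieldS_JS:
  assumes "vector_fieldS Y"
  shows "vector_fieldS (\<lambda>q. JS q (Y q))"
proof -
  obtain U F where F: "open U" "S3S3 \<subseteq> U" "smooth_on U F" "\<And>q. q \<in> S3S3 \<Longrightarrow> F q = Y q"
    using assms unfolding vector_fieldS_def smooth_along_def by blast
  have eq: "JS q (Y q) = untriv q (\<i> *s triv q (Y q))" if "q \<in> S3S3" for q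
    using JS_untriv[OF that, of "triv q (Y q)"] that vector_fieldS_in_tanS[OF assms that] by simp
  have "smooth_on U (\<lambda>q. untriv q (\<i> *s triv q (F q)))"
    by (intro smooth_on_untriv smooth_on_smult smooth_on_triv smooth_on_ident smooth_on_const F)
  then show ?thesis
    unfolding vector_fieldS_def smooth_along_def using F eq
    by (auto intro!: exI[of _ U] exI[of _ "\<lambda>q. untriv q (\<i> *s triv q (F q))"])
qed

lemma coords_JS:
  assumes "vector_fieldS Y" "p \<in> S3S3"
  shows "coords (\<lambda>q. JS q (Y q)) p = \<i> *s coords Y p"
  using JS_untriv[OF assms(2), of "coords Y p"] assms by (simp add: coords_def vector_fieldS_in_tanS)

lemma derivS_coords_JS:
  assumes "vector_fieldS Y" "p \<in> S3S3" "v \<in> tanS p"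
  shows "derivS (coords (\<lambda>q. JS q (Y q))) p v = \<i> *s derivS (coords Y) p v"
proof -
  obtain y' where y': "(coords Y has_derivative y') (at p within S3S3)" "derivS (coords Y) p v = y' v"
    using coords_has_derivative[OF assms(1,2)] assms(3) by metis
  have "((\<lambda>q. \<i> *s coords Y q) has_derivative (\<lambda>h. \<i> *s y' h)) (at p within S3S3)"
    using bounded_linear.has_derivative[OF bounded_bilinear.bounded_linear_right[OF bounded_bilinear_smult] y'(1)] .
  then have "(coords (\<lambda>q. JS q (Y q)) has_derivative (\<lambda>h. \<i> *s y' h)) (at p within S3S3)"
    by (rule has_derivative_transform[OF assms(2), rotated]) (simp add: coords_JS[OF assms(1)])
  from derivS_eq[OF assms(2,3) this] show ?thesis by (simp add: y')
qed

text \<open>The first term is the canonical Hermitian connection, for which \<open>JS\<close> and \<open>PS\<close> are parallel;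
  the subtracted one is half of its torsion.\<close>

definition christoffel :: "complex^3 \<Rightarrow> complex^3 \<Rightarrow> complex^3" where
  "christoffel x y = (2/3) *s ccross (x + vcnj x) y - (1/3) *s vcnj (ccross x y)"

lemma christoffel_torsion: "christoffel x y - christoffel y x = lie x y"
  by (simp add: christoffel_def c3_simps) (simp add: field_simps)

text \<open>\<open>x + vcnj x\<close> is a real vector, so its cross product is skew for the real
  inner product; the other summand pairs with \<open>z\<close> to the real part of a determinant,
  which alternates.\<close>

lemma christoffel_skew: "christoffel x y \<bullet> z + y \<bullet> christoffel x z = 0"
  unfolding inner_c3
  by (simp add: christoffel_def cdot_def) (simp add: field_simps)

definition Gtens :: "complex^3 \<Rightarrow> complex^3 \<Rightarrow> complex^3" where
  "Gtens x y = (2/3 * \<i>) *s vcnj (ccross x y)"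

text \<open>The canonical part is complex linear in \<open>y\<close> and drops out. The conjugate
  part anticommutes with \<i>, so it contributes twice, whence 2/3 from 1/3.\<close>

lemma christoffel_i: "christoffel x (\<i> *s y) - \<i> *s christoffel x y = Gtens x y"
  by (simp add: christoffel_def Gtens_def c3_simps) (simp add: field_simps)

section \<open>Uniqueness of the Levi-Civita connection\<close>

text \<open>Three cyclic shifts, each with a change of sign, turn \<open>T x y z\<close> into its
  negative. The index set is abstract because the arguments will be vector fields rather than
  vectors.\<close>

lemma skew_sym_trilinear_0:
  fixes T :: "'a \<Rightarrow> 'a \<Rightarrow> 'a \<Rightarrow> real"
  assumes "\<And>x y z. x \<in> A \<Longrightarrow> y \<in> A \<Longrightarrow> z \<in> A \<Longrightarrow> T x y z = T y x z"
    and "\<And>x y z. x \<in> A \<Longrightarrow> y \<in> A \<Longrightarrow> z \<in> A \<Longrightarrow> T x y z = - T x z y"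
    and "x \<in> A" "y \<in> A" "z \<in> A"
  shows "T x y z = 0"
proof -
  have rot: "T a b c = - T b c a" if "a \<in> A" "b \<in> A" "c \<in> A" for a b c
    using assms(1)[OF that] assms(2)[OF that(2,1,3)] by simp
  show ?thesis
    using rot[OF assms(3,4,5)] rot[OF assms(4,5,3)] rot[OF assms(5,3,4)] by linarith
qed

lemma Levi_CivitaD:
  assumes "Levi_Civita nabla"
  shows "vector_fieldS X \<Longrightarrow> vector_fieldS Y \<Longrightarrow> vector_fieldS (nabla X Y)"
    and "vector_fieldS X \<Longrightarrow> vector_fieldS Y \<Longrightarrow> p \<in> S3S3 \<Longrightarrow>
      nabla X Y p - nabla Y X p = bracketS X Y p"
    and "vector_fieldS X \<Longrightarrow> vector_fieldS Y \<Longrightarrow> vector_fieldS Z \<Longrightarrow> p \<in> S3S3 \<Longrightarrow>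
      derivS (\<lambda>q. gS q (Y q) (Z q)) p (X p) = gS p (nabla X Y p) (Z p) + gS p (Y p) (nabla X Z p)"
proof -
  note c = assms[unfolded Levi_Civita_def]
  note c6 = c[THEN conjunct2, THEN conjunct2, THEN conjunct2, THEN conjunct2, THEN conjunct2]
  show "vector_fieldS X \<Longrightarrow> vector_fieldS Y \<Longrightarrow> vector_fieldS (nabla X Y)"
    using c[THEN conjunct1] by blast
  show "vector_fieldS X \<Longrightarrow> vector_fieldS Y \<Longrightarrow> p \<in> S3S3 \<Longrightarrow>
      nabla X Y p - nabla Y X p = bracketS X Y p"
    using c6[THEN conjunct1] by blast
  show "vector_fieldS X \<Longrightarrow> vector_fieldS Y \<Longrightarrow> vector_fieldS Z \<Longrightarrow> p \<in> S3S3 \<Longrightarrow>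
      derivS (\<lambda>q. gS q (Y q) (Z q)) p (X p) = gS p (nabla X Y p) (Z p) + gS p (Y p) (nabla X Z p)"
    using c6[THEN conjunct2] by blast
qed

text \<open>The defect of \<open>nabla\<close> against the candidate formula is symmetric in
  \<open>X\<close> and \<open>Y\<close> since both have vanishing torsion, and skew in
  \<open>Y\<close> and \<open>Z\<close> since both are metric; such a form vanishes.\<close>

lemma Levi_Civita_coords:
  assumes LC: "Levi_Civita nabla" and "vector_fieldS X" "vector_fieldS Y" "p \<in> S3S3"
  shows "nabla X Y p = untriv p (derivS (coords Y) p (X p) + christoffel (coords X p) (coords Y p))"
proof -
  define D where "D X Y = derivS (coords Y) p (X p) + christoffel (coords X p) (coords Y p)" for X Y
  define T where "T X Y Z = (triv p (nabla X Y p) - D X Y) \<bullet> coords Z p" for X Y Z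
  have nab: "vector_fieldS (nabla X Y)" if "vector_fieldS X" "vector_fieldS Y" for X Y
    by (rule Levi_CivitaD(1)[OF LC that])
  have nab_p: "untriv p (triv p (nabla X Y p)) = nabla X Y p"
    if "vector_fieldS X" "vector_fieldS Y" for X Y
    using nab[OF that] assms(4) by (simp add: vector_fieldS_in_tanS)
  have "T X Y Z = 0" if Z: "vector_fieldS Z" for Z
  proof (rule skew_sym_trilinear_0[where A="Collect vector_fieldS" and T=T])
    fix X Y Z assume "X \<in> Collect vector_fieldS" "Y \<in> Collect vector_fieldS" "Z \<in> Collect vector_fieldS"
    then have v: "vector_fieldS X" "vector_fieldS Y" "vector_fieldS Z" by auto
    have "nabla X Y p - nabla Y X p = bracketS X Y p"
      by (rule Levi_CivitaD(2)[OF LC v(1,2) assms(4)])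
    then have "untriv p (triv p (nabla X Y p) - triv p (nabla Y X p)) = untriv p (D X Y - D Y X)"
      using v assms(4)
      by (simp add: untriv.diff_right nab_p bracketS_coords D_def christoffel_torsion[symmetric] algebra_simps)
    then have "triv p (nabla X Y p) - triv p (nabla Y X p) = D X Y - D Y X"
      by (metis triv_untriv assms(4))
    then have "triv p (nabla X Y p) - D X Y = triv p (nabla Y X p) - D Y X"
      by (simp add: algebra_simps)
    then show "T X Y Z = T Y X Z" by (simp only: T_def)
    have "derivS (\<lambda>q. gS q (Y q) (Z q)) p (X p) = gS p (nabla X Y p) (Z p) + gS p (Y p) (nabla X Z p)"
      by (rule Levi_CivitaD(3)[OF LC v assms(4)])
    also have "\<dots> = 4/3 * (triv p (nabla X Y p) \<bullet> coords Z p + coords Y p \<bullet> triv p (nabla X Z p))"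
      using gS_untriv[OF assms(4), of "triv p (nabla X Y p)" "coords Z p"]
        gS_untriv[OF assms(4), of "coords Y p" "triv p (nabla X Z p)"] v assms(4)
      by (simp add: nab_p untriv_coords)
    finally have "derivS (coords Y) p (X p) \<bullet> coords Z p + coords Y p \<bullet> derivS (coords Z) p (X p)
        = triv p (nabla X Y p) \<bullet> coords Z p + coords Y p \<bullet> triv p (nabla X Z p)"
      using v assms(4) by (simp add: derivS_gS vector_fieldS_in_tanS)
    then show "T X Y Z = - T X Z Y"
      using christoffel_skew[of "coords X p" "coords Y p" "coords Z p"]
      by (simp add: T_def D_def inner_simps inner_commute)
  qed (use assms Z in auto)
  \<comment> \<open>Testing against the left-invariant extension of the defect itself gives the
    square of its norm.\<close>
  from this[OF vector_fieldS_left_invariant[of "triv p (nabla X Y p) - D X Y"]]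
  have "triv p (nabla X Y p) = D X Y"
    using assms(4) by (simp add: T_def coords_def)
  then show ?thesis using nab_p[OF assms(2,3)] by (simp add: D_def)
qed

text \<open>Derivatives of components commute with \<i>, so only zeroth-order terms survive; this
  exhibits \<open>GS\<close> as a tensor.\<close>

lemma GS_eq:
  assumes "Levi_Civita nabla" "vector_fieldS X" "vector_fieldS Y" "p \<in> S3S3"
  shows "GS nabla X Y p = untriv p (Gtens (coords X p) (coords Y p))"
proof -
  have "JS p (nabla X Y p) = untriv p (\<i> *s (derivS (coords Y) p (X p) + christoffel (coords X p) (coords Y p)))"
    by (simp add: Levi_Civita_coords[OF assms] assms(4))
  then show ?thesis
    using assms
    by (simp add: GS_def Levi_Civita_coords vector_fieldS_JS coords_JS derivS_coords_JS
        vector_fieldS_in_tanS christoffel_i[symmetric] untriv.diff_right untriv.add_right vector_add_ldistrib)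
qed

section \<open>Charts\<close>

lemma smooth_manifold_chart:
  assumes "smooth_manifold M" "(V, \<phi>) \<in> atlas M"
  shows "open V" "openin (topology_of M) (\<phi> ` V)" "inj_on \<phi> V"
    "continuous_map (top_of_set V) (topology_of M) \<phi>"
    "\<And>W. open W \<Longrightarrow> W \<subseteq> V \<Longrightarrow> openin (topology_of M) (\<phi> ` W)"
    "\<And>u. u \<in> V \<Longrightarrow> \<phi> u \<in> points M"
proof -
  have c: "open V" "openin (topology_of M) (\<phi> ` V)"
    "homeomorphic_map (top_of_set V) (subtopology (topology_of M) (\<phi> ` V)) \<phi>"
    using assms unfolding smooth_manifold_def by blast+
  show "open V" "openin (topology_of M) (\<phi> ` V)" by (rule c)+
  show "inj_on \<phi> V" using homeomorphic_imp_injective_map[OF c(3)] by simp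
  show "continuous_map (top_of_set V) (topology_of M) \<phi>"
    using homeomorphic_imp_continuous_map[OF c(3)] continuous_map_in_subtopology by blast
  show "openin (topology_of M) (\<phi> ` W)" if "open W" "W \<subseteq> V" for W
  proof -
    have "openin (top_of_set V) W" using that c(1) by (simp add: openin_open_eq)
    then have "openin (subtopology (topology_of M) (\<phi> ` V)) (\<phi> ` W)"
      using homeomorphic_imp_open_map[OF c(3)] unfolding open_map_def by blast
    then show ?thesis using c(2) openin_open_subtopology by blast
  qed
  show "\<phi> u \<in> points M" if "u \<in> V" for u
    using c(2) openin_subset that by blast
qed

lemma smooth_manifold_cover:
  assumes "smooth_manifold M" "x \<in> points M"
  obtains V \<phi> u where "(V, \<phi>) \<in> atlas M" "u \<in> V" "\<phi> u = x"
proof -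
  have "(\<Union>(V, \<phi>) \<in> atlas M. \<phi> ` V) = points M"
    using assms(1) unfolding smooth_manifold_def by blast
  then have "x \<in> (\<Union>(V, \<phi>) \<in> atlas M. \<phi> ` V)" using assms(2) by simp
  then show ?thesis using that by auto
qed

lemma chart_transition:
  assumes M: "smooth_manifold M" and V: "(V, \<phi>) \<in> atlas M" and W: "(W, \<psi>) \<in> atlas M"
  defines "\<tau> \<equiv> inv_into W \<psi> \<circ> \<phi>" and "O' \<equiv> {u \<in> V. \<phi> u \<in> \<psi> ` W}"
  shows "open O'" "smooth_on O' \<tau>" "\<And>u. u \<in> O' \<Longrightarrow> \<tau> u \<in> W" "\<And>u. u \<in> O' \<Longrightarrow> \<psi> (\<tau> u) = \<phi> u"
proof -
  have "openin (top_of_set V) {u \<in> topspace (top_of_set V). \<phi> u \<in> \<psi> ` W}"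
    using smooth_manifold_chart(4)[OF M V] smooth_manifold_chart(2)[OF M W]
    by (rule openin_continuous_map_preimage)
  then show "open O'"
    using smooth_manifold_chart(1)[OF M V] by (simp add: O'_def openin_open_eq)
  have "\<forall>(V, \<phi>) \<in> atlas M. \<forall>(W, \<psi>) \<in> atlas M.
       smooth_on {u \<in> V. \<phi> u \<in> \<psi> ` W} (inv_into W \<psi> \<circ> \<phi>)"
    using M unfolding smooth_manifold_def by (elim conjE)
  then show "smooth_on O' \<tau>" using V W unfolding O'_def \<tau>_def by blast
  show "\<tau> u \<in> W" "\<psi> (\<tau> u) = \<phi> u" if "u \<in> O'" for u
    using that by (auto simp: \<tau>_def O'_def inv_into_into f_inv_into_f)
qed

lemma smooth_map_smooth_on: "smooth_map M h \<Longrightarrow> (V, \<phi>) \<in> atlas M \<Longrightarrow> smooth_on V (h \<circ> \<phi>)"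
  unfolding smooth_map_def by blast

lemma smooth_map_local:
  fixes M :: "('a::euclidean_space, 'm) manifold"
  assumes M: "smooth_manifold M"
    and h: "\<And>x. x \<in> points M \<Longrightarrow> \<exists>V \<phi> W. (V, \<phi>) \<in> atlas M \<and> open W \<and> W \<subseteq> V \<and> x \<in> \<phi> ` W \<and> smooth_on W (h \<circ> \<phi>)"
  shows "smooth_map M h"
  unfolding smooth_map_def
proof (clarify)
  fix V \<phi> assume V: "(V, \<phi>) \<in> atlas M"
  show "smooth_on V (h \<circ> \<phi>)"
  proof (rule smooth_on_local)
    fix u assume u: "u \<in> V"
    obtain V' \<psi> W where W: "(V', \<psi>) \<in> atlas M" "open W" "W \<subseteq> V'" "\<phi> u \<in> \<psi> ` W" "smooth_on W (h \<circ> \<psi>)"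
      using h[OF smooth_manifold_chart(6)[OF M V u]] by blast
    define \<tau> where "\<tau> = inv_into V' \<psi> \<circ> \<phi>"
    define O' where "O' = {u \<in> V. \<phi> u \<in> \<psi> ` V'}"
    note t = chart_transition[OF M V W(1), folded \<tau>_def O'_def]
    have uO: "u \<in> O'" using u W by (auto simp: O'_def)
    define U where "U = O' \<inter> \<tau> -` W"
    have "open U"
      unfolding U_def by (rule continuous_open_preimage[OF smooth_on_continuous[OF t(2)] t(1) W(2)])
    moreover have "u \<in> U"
    proof -
      obtain w where w: "w \<in> W" "\<phi> u = \<psi> w" using W(4) by blast
      then have "\<tau> u = w"
        using smooth_manifold_chart(3)[OF M W(1)] W(3) by (auto simp: \<tau>_def)
      then show ?thesis using uO w by (simp add: U_def)
    qed
    moreover have "smooth_on U (h \<circ> \<phi>)"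
    proof (rule smooth_on_cong[OF \<open>open U\<close>])
      show "smooth_on U (\<lambda>x. (h \<circ> \<psi>) (\<tau> x))"
        by (rule smooth_on_compose[OF \<open>open U\<close> W(2) _ _ W(5)])
          (use t(2) in \<open>auto simp: U_def intro: smooth_on_subset\<close>)
    qed (use t(4) in \<open>auto simp: U_def\<close>)
    ultimately show "\<exists>U. open U \<and> u \<in> U \<and> smooth_on U (h \<circ> \<phi>)" by blast
  qed
qed

section \<open>Independence of the chart\<close>

text \<open>The transition differential \<open>T\<close> is the same for every \<open>h\<close>.
  Using one \<open>T\<close> both for \<open>f\<close> and for an arbitrary function is what makes
  \<open>derivM\<close> independent of the chart.\<close>

lemma chart_change:
  fixes M :: "('a::euclidean_space, 'm) manifold"
  assumes M: "smooth_manifold M" and V: "(V, \<phi>) \<in> atlas M" and W: "(W, \<psi>) \<in> atlas M"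
    and u: "u \<in> V" "w \<in> W" "\<phi> u = \<psi> w"
  defines "T \<equiv> frechet_derivative (inv_into W \<psi> \<circ> \<phi>) (at u)"
  assumes h: "smooth_map M (h :: 'm \<Rightarrow> 'b::real_normed_vector)"
  shows "frechet_derivative (h \<circ> \<phi>) (at u) \<xi> = frechet_derivative (h \<circ> \<psi>) (at w) (T \<xi>)"
proof -
  define \<tau> where "\<tau> = inv_into W \<psi> \<circ> \<phi>"
  define O' where "O' = {u \<in> V. \<phi> u \<in> \<psi> ` W}"
  note t = chart_transition[OF M V W, folded \<tau>_def O'_def]
  have uO: "u \<in> O'" using u by (auto simp: O'_def)
  have \<tau>u: "\<tau> u = w"
    using u smooth_manifold_chart(3)[OF M W] by (simp add: \<tau>_def)
  have T: "(\<tau> has_derivative T) (at u)"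
    unfolding T_def \<tau>_def[symmetric] by (rule smooth_on_has_derivative[OF t(2) uO])
  have "((h \<circ> \<psi>) has_derivative frechet_derivative (h \<circ> \<psi>) (at w)) (at (\<tau> u))"
    unfolding \<tau>u by (rule smooth_on_has_derivative[OF smooth_map_smooth_on[OF h W] u(2)])
  from diff_chain_at[OF T this]
  have "((h \<circ> \<phi>) has_derivative frechet_derivative (h \<circ> \<psi>) (at w) \<circ> T) (at u)"
    by (rule has_derivative_transform_within_open[OF _ t(1) uO]) (simp add: t(4))
  from frechet_derivative_eq[OF this] show ?thesis by simp
qed

lemma immersed_submanifoldD:
  assumes "immersed_submanifold M f"
  shows "smooth_manifold M" "smooth_map M f" "x \<in> points M \<Longrightarrow> f x \<in> S3S3"
    "(V, \<phi>) \<in> atlas M \<Longrightarrow> u \<in> V \<Longrightarrow> inj (frechet_derivative (f \<circ> \<phi>) (at u))"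
  using assms unfolding immersed_submanifold_def by blast+

lemma tanM_chart:
  fixes M :: "('a::euclidean_space, 'm) manifold"
  assumes I: "immersed_submanifold M f" and V: "(V, \<phi>) \<in> atlas M" and u: "u \<in> V"
  shows "tanM M f (\<phi> u) = range (frechet_derivative (f \<circ> \<phi>) (at u))"
proof
  show "range (frechet_derivative (f \<circ> \<phi>) (at u)) \<subseteq> tanM M f (\<phi> u)"
    unfolding tanM_def using V u by blast
  show "tanM M f (\<phi> u) \<subseteq> range (frechet_derivative (f \<circ> \<phi>) (at u))"
  proof
    fix v assume "v \<in> tanM M f (\<phi> u)"
    then obtain W \<psi> w \<xi> where W: "(W, \<psi>) \<in> atlas M" "w \<in> W" "\<psi> w = \<phi> u"
      "v = frechet_derivative (f \<circ> \<psi>) (at w) \<xi>"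
      unfolding tanM_def by blast
    show "v \<in> range (frechet_derivative (f \<circ> \<phi>) (at u))"
      using chart_change[OF immersed_submanifoldD(1)[OF I] W(1) V W(2) u W(3) immersed_submanifoldD(2)[OF I]]
      by (simp add: W(4))
  qed
qed

text \<open>Injectivity of the differential of \<open>f\<close> pins down the coordinate vector in
  one chart, and a change of charts translates every other representation of the tangent vector into
  it, so the description has exactly one solution.\<close>

lemma derivM_chart:
  fixes M :: "('a::euclidean_space, 'm) manifold"
  assumes I: "immersed_submanifold M f" and V: "(V, \<phi>) \<in> atlas M" and u: "u \<in> V"
    and h: "smooth_map M h"
  shows "derivM M f h (\<phi> u) (frechet_derivative (f \<circ> \<phi>) (at u) \<xi>) = frechet_derivative (h \<circ> \<phi>) (at u) \<xi>"
  unfolding derivM_def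
proof (rule the_equality)
  show "\<exists>(V, \<phi>')\<in>atlas M. \<exists>u'\<in>V. \<exists>\<xi>'. \<phi>' u' = \<phi> u \<and>
      frechet_derivative (f \<circ> \<phi>') (at u') \<xi>' = frechet_derivative (f \<circ> \<phi>) (at u) \<xi> \<and>
      frechet_derivative (h \<circ> \<phi>') (at u') \<xi>' = frechet_derivative (h \<circ> \<phi>) (at u) \<xi>"
    using V u by blast
next
  fix d assume "\<exists>(V, \<phi>')\<in>atlas M. \<exists>u'\<in>V. \<exists>\<xi>'. \<phi>' u' = \<phi> u \<and>
      frechet_derivative (f \<circ> \<phi>') (at u') \<xi>' = frechet_derivative (f \<circ> \<phi>) (at u) \<xi> \<and>
      frechet_derivative (h \<circ> \<phi>') (at u') \<xi>' = d"
  then obtain W \<psi> w \<eta> where W: "(W, \<psi>) \<in> atlas M" "w \<in> W" "\<psi> w = \<phi> u"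
    "frechet_derivative (f \<circ> \<psi>) (at w) \<eta> = frechet_derivative (f \<circ> \<phi>) (at u) \<xi>"
    "frechet_derivative (h \<circ> \<psi>) (at w) \<eta> = d" by blast
  note cc = chart_change[OF immersed_submanifoldD(1)[OF I] W(1) V W(2) u W(3)]
  have "frechet_derivative (inv_into V \<phi> \<circ> \<psi>) (at w) \<eta> = \<xi>"
    using cc[OF immersed_submanifoldD(2)[OF I], of \<eta>] W(4) immersed_submanifoldD(4)[OF I V u]
    by (simp add: inj_eq)
  then show "d = frechet_derivative (h \<circ> \<phi>) (at u) \<xi>"
    using cc[OF h, of \<eta>] W(5) by simp
qed

lemma bracketM_chart:
  fixes M :: "('a::euclidean_space, 'm) manifold"
  assumes "immersed_submanifold M f" "(V, \<phi>) \<in> atlas M" "u \<in> V" "smooth_map M X" "smooth_map M Y"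
    and "X (\<phi> u) = frechet_derivative (f \<circ> \<phi>) (at u) \<xi>" "Y (\<phi> u) = frechet_derivative (f \<circ> \<phi>) (at u) \<eta>"
  shows "bracketM M f X Y (\<phi> u) = frechet_derivative (Y \<circ> \<phi>) (at u) \<xi> - frechet_derivative (X \<circ> \<phi>) (at u) \<eta>"
  unfolding bracketM_def assms(6,7) by (simp only: derivM_chart[OF assms(1-3)] assms(4,5))

section \<open>Isotropic complex lines in the tangent spaces of a chart\<close>

lemma ccross_self [simp]: "ccross x x = 0" "ccross x (c *s x) = 0"
  by (simp_all add: c3_simps)

lemma ccross_eq_0D:
  assumes "ccross e x = 0" "e \<noteq> 0"
  shows "\<exists>c. x = c *s e"
proof -
  have *: "e$2 * x$3 = e$3 * x$2" "e$3 * x$1 = e$1 * x$3" "e$1 * x$2 = e$2 * x$1"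
    using assms(1) by (simp_all add: c3_simps)
  obtain i where i: "e$i \<noteq> 0" using assms(2) by (auto simp: vec_eq_iff)
  have "x$j * e$i = x$i * e$j" for j
    using * exhaust_3[of i] exhaust_3[of j] by (auto simp: algebra_simps)
  then have "x = (x$i / e$i) *s e"
    using i by (simp add: vec_eq_iff field_simps)
  then show ?thesis by blast
qed

lemma ccross_ccross: "ccross e (ccross e x) = cdot e x *s e - cdot e e *s x"
  by (simp add: c3_simps) (simp add: algebra_simps)

lemma cdot_ccross [simp]: "cdot x (ccross x y) = 0" "cdot y (ccross x y) = 0"
  by (simp_all add: cdot_def algebra_simps)

lemma ccross_isotropic:
  assumes "e \<noteq> 0" "cdot e e = 0" "cdot e v = 0"
  shows "\<exists>c. ccross e v = c *s e"
proof -
  have "ccross e (ccross e v) = 0" using assms by (simp add: ccross_ccross)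
  then show ?thesis using ccross_eq_0D assms(1) by blast
qed

lemma cdot_vcnj_ccross_nonzero:
  assumes "cdot e e = 0" "cdot e v = 0" "ccross e v \<noteq> 0"
  shows "cdot e (vcnj (ccross e v)) \<noteq> 0"
proof -
  have e: "e \<noteq> 0" using assms(3) by (auto simp: c3_simps)
  obtain c where "ccross e v = c *s e" using ccross_isotropic[OF e assms(1,2)] by blast
  then show ?thesis using assms(3) e by (auto simp: cdot_linear)
qed

lemma cdot_lie_i: "cdot e (lie e (\<i> *s e)) = 0"
  by (simp add: cdot_def lie_def algebra_simps)

text \<open>Terms with a repeated \<open>e\<close> vanish. Those containing \<open>vcnj e\<close>
  and the unconjugated \<open>v\<close> cancel against \<open>cdot (lie e (\<i> *s e)) v\<close>.
  The remaining terms of the first two summands agree, because \<open>vcnj\<close> turns \<i> into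
  its negative; this doubles 2/3 to 4/3.\<close>

lemma cdot_lie_identity:
  "\<i> * cdot e (lie e v) - cdot e (lie (\<i> *s e) v) + cdot (lie e (\<i> *s e)) v
    = - (4/3) * \<i> * cdot e (vcnj (ccross e v))"
  by (simp add: cdot_def lie_def) (simp add: field_simps)

lemma span_complex_line: "span {e, \<i> *s e} = range (\<lambda>c. c *s e)" for e :: "complex^3"
proof -
  have "z \<in> span {e, \<i> *s e} \<longleftrightarrow> (\<exists>a b. z = Complex a b *s e)" for z
  proof -
    have "z \<in> span {e, \<i> *s e} \<longleftrightarrow> (\<exists>a b. z - a *\<^sub>R e = b *\<^sub>R (\<i> *s e))"
      by (auto simp: span_breakdown_eq)
    also have "\<dots> \<longleftrightarrow> (\<exists>a b. z = Complex a b *s e)"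
    proof -
      have "z - a *\<^sub>R e = b *\<^sub>R (\<i> *s e) \<longleftrightarrow> z = Complex a b *s e" for a b
        by (simp add: vec_eq_iff complex_eq_iff algebra_simps)
      then show ?thesis by simp
    qed
    finally show ?thesis .
  qed
  then show ?thesis by (auto simp: image_iff) (metis complex.exhaust)
qed

lemma dim_complex_line: "e \<noteq> 0 \<Longrightarrow> dim (range (\<lambda>c. c *s e)) = 2" for e :: "complex^3"
proof -
  assume e: "e \<noteq> 0"
  then obtain j where j: "e$j \<noteq> 0" by (auto simp: vec_eq_iff)
  have ne: "a *\<^sub>R e \<noteq> \<i> *s e" for a
  proof
    assume "a *\<^sub>R e = \<i> *s e"
    then have "of_real a * e$j = \<i> * e$j" by (metis scaleR_c3 vector_smult_component)
    then have "of_real a = \<i>" using j by simp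
    then show False by (metis Re_complex_of_real Im_complex_of_real imaginary_unit.sel(2) zero_neq_one)
  qed
  then have "\<i> *s e \<notin> span {e}" unfolding span_singleton by (metis imageE ne)
  then have "independent {\<i> *s e, e}" using e by (simp add: independent_insert)
  moreover have "\<i> *s e \<noteq> e" using \<open>\<i> *s e \<notin> span {e}\<close> by (metis span_base singletonI)
  ultimately have "dim (span {e, \<i> *s e}) = 2"
    by (simp add: dim_span insert_commute dim_eq_card_independent)
  then show ?thesis by (simp only: span_complex_line)
qed

lemma tangent_to_S3S3:
  assumes "open W" "u \<in> W" "smooth_on W F" "\<And>w. w \<in> W \<Longrightarrow> F w \<in> S3S3"
  shows "frechet_derivative F (at u) \<xi> \<in> tanS (F u)"
proof -
  let ?D = "frechet_derivative F (at u)"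
  have D: "(F has_derivative ?D) (at u)" by (rule smooth_on_has_derivative[OF assms(3,2)])
  have 1: "2 * (g (F u) \<bullet> g (?D \<xi>)) = 0"
    if g: "bounded_linear g" "\<And>w. w \<in> W \<Longrightarrow> norm (g (F w)) = 1" for g :: "quat2 \<Rightarrow> quat"
  proof -
    have "((\<lambda>w. g (F w) \<bullet> g (F w)) has_derivative
        (\<lambda>h. g (F u) \<bullet> g (?D h) + g (?D h) \<bullet> g (F u))) (at u)"
      by (intro has_derivative_inner bounded_linear.has_derivative[OF g(1)] D)
    then have "((\<lambda>w. 1 :: real) has_derivative
        (\<lambda>h. g (F u) \<bullet> g (?D h) + g (?D h) \<bullet> g (F u))) (at u)"
      by (rule has_derivative_transform_within_open[OF _ assms(1,2)]) (simp add: norm_eq_1[symmetric] g(2))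
    from fun_cong[OF has_derivative_unique[OF this has_derivative_const], of \<xi>]
    show ?thesis by (simp add: inner_commute)
  qed
  show ?thesis
    unfolding tanS_iff[OF assms(4)[OF assms(2)]]
    using 1[OF bounded_linear_fst] 1[OF bounded_linear_snd] S3S3_norm[OF assms(4)] by simp
qed

lemma smooth_on_cdot:
  "open U \<Longrightarrow> smooth_on U x \<Longrightarrow> smooth_on U y \<Longrightarrow> smooth_on U (\<lambda>u. cdot (x u) (y u))"
  by (rule smooth_on_bilinear[OF _ bounded_bilinear_cdot])

text \<open>A chart together with a complex frame vector of \<open>D1\<close> in the trivialization.
  The real transversal \<open>v\<close> of the overview is not part of the data: it is taken as
  \<open>dF u \<eta>\<close> for a constant \<open>\<eta>\<close>, a coordinate field and thus
  automatically smooth and tangent.\<close>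

locale isotropic_chart =
  fixes W :: "(real^3) set" and F :: "real^3 \<Rightarrow> quat2" and e :: "real^3 \<Rightarrow> complex^3"
  assumes open_W: "open W"
    and smooth_F: "smooth_on W F"
    and F_in: "u \<in> W \<Longrightarrow> F u \<in> S3S3"
    and inj_F: "u \<in> W \<Longrightarrow> inj (frechet_derivative F (at u))"
    and smooth_e: "smooth_on W e"
    and e_nonzero: "u \<in> W \<Longrightarrow> e u \<noteq> 0"
    and e_tangent: "u \<in> W \<Longrightarrow> untriv (F u) (c *s e u) \<in> range (frechet_derivative F (at u))"
    and isotropic: "u \<in> W \<Longrightarrow> cdot (e u) (e u) = 0"
begin

definition dF :: "real^3 \<Rightarrow> real^3 \<Rightarrow> complex^3" where
  "dF u \<xi> = triv (F u) (frechet_derivative F (at u) \<xi>)"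

lemma untriv_dF: "u \<in> W \<Longrightarrow> untriv (F u) (dF u \<xi>) = frechet_derivative F (at u) \<xi>"
  unfolding dF_def by (intro untriv_triv F_in tangent_to_S3S3[OF open_W _ smooth_F F_in])

lemma range_dF_iff:
  assumes "u \<in> W"
  shows "x \<in> range (dF u) \<longleftrightarrow> untriv (F u) x \<in> range (frechet_derivative F (at u))"
  by (auto simp: untriv_dF[OF assms, symmetric]) (metis triv_untriv F_in[OF assms] rangeI)

lemma linear_dF: "u \<in> W \<Longrightarrow> linear (dF u)"
proof -
  assume u: "u \<in> W"
  have "linear (frechet_derivative F (at u))"
    using smooth_on_has_derivative[OF smooth_F u] has_derivative_linear by blast
  then show ?thesis
    unfolding dF_def by (simp add: linear_iff triv.add_right triv.scaleR_right)
qed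

lemma inj_dF: "u \<in> W \<Longrightarrow> inj (dF u)"
  using inj_F untriv_dF by (metis injD injI)

lemma subspace_dF: "u \<in> W \<Longrightarrow> subspace (range (dF u))"
  using linear_dF linear_subspace_image subspace_UNIV by blast

lemma smooth_dF: "smooth_on W (\<lambda>u. dF u \<xi>)"
  unfolding dF_def
  by (intro smooth_on_triv open_W smooth_F smooth_on_frechet_derivative)

lemma e_in_dF: "u \<in> W \<Longrightarrow> c *s e u \<in> range (dF u)"
  by (simp add: range_dF_iff e_tangent)

definition chart_coord :: "real^3 \<Rightarrow> complex^3 \<Rightarrow> real^3" where
  "chart_coord u x = inv (dF u) x"

lemma dF_chart_coord: "x \<in> range (dF u) \<Longrightarrow> dF u (chart_coord u x) = x"
  unfolding chart_coord_def by (simp add: f_inv_into_f)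

lemma continuous_on_chart_coord:
  assumes "continuous_on W x" "\<And>u. u \<in> W \<Longrightarrow> x u \<in> range (dF u)"
  shows "continuous_on W (\<lambda>u. chart_coord u (x u))"
proof (rule continuous_at_imp_continuous_on, clarify)
  fix u assume u: "u \<in> W"
  have lim: "((\<lambda>w. dF w \<xi>) \<longlongrightarrow> dF u \<xi>) (at u)" for \<xi>
    using smooth_on_continuous[OF smooth_dF] u open_W
    by (simp add: continuous_on_eq_continuous_at isCont_def)
  have x: "(x \<longlongrightarrow> x u) (at u)"
    using assms(1) u open_W by (simp add: continuous_on_eq_continuous_at isCont_def)
  have evW: "\<forall>\<^sub>F w in at u. w \<in> W"
    using open_W u by (simp add: eventually_at_topological) blast
  have 1: "\<forall>\<^sub>F w in at u. linear (dF w)" using evW by eventually_elim (rule linear_dF)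
  have 2: "\<forall>\<^sub>F w in at u. x w = dF w (chart_coord w (x w))"
    using evW by eventually_elim (simp add: dF_chart_coord assms(2))
  obtain \<zeta> where \<zeta>: "dF u \<zeta> = x u" "((\<lambda>w. chart_coord w (x w)) \<longlongrightarrow> \<zeta>) (at u)"
    using tendsto_preimage[OF _ 1 linear_dF[OF u] inj_dF[OF u] lim 2 x] by auto
  have "\<zeta> = chart_coord u (x u)"
    using \<zeta>(1) inj_dF[OF u] by (metis chart_coord_def inv_f_f)
  then show "isCont (\<lambda>u. chart_coord u (x u)) u" using \<zeta>(2) by (simp add: isCont_def)
qed

section \<open>Brackets of tangent fields in a chart\<close>

lemma untriv_derivative:
  assumes u: "u \<in> W" and y: "smooth_on W y"
  shows "frechet_derivative (\<lambda>w. untriv (F w) (y w)) (at u) \<xi>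
    = untriv (F u) (frechet_derivative y (at u) \<xi>) + untriv (untriv (F u) (dF u \<xi>)) (y u)"
  using frechet_derivative_eq[OF untriv.FDERIV[OF smooth_on_has_derivative[OF smooth_F u]
      smooth_on_has_derivative[OF y u]]]
  by (simp add: untriv_dF[OF u])

lemma bracket_untriv:
  assumes u: "u \<in> W" and x: "smooth_on W x" and y: "smooth_on W y"
    and "dF u \<xi> = x u" "dF u \<eta> = y u"
  shows "frechet_derivative (\<lambda>w. untriv (F w) (y w)) (at u) \<xi>
      - frechet_derivative (\<lambda>w. untriv (F w) (x w)) (at u) \<eta>
    = untriv (F u) (frechet_derivative y (at u) \<xi> - frechet_derivative x (at u) \<eta> + lie (x u) (y u))"
  by (simp add: untriv_derivative[OF u x] untriv_derivative[OF u y] assms(4,5) untriv.add_right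
      untriv.diff_right untriv_untriv[symmetric])

lemma bracket_in_dF:
  assumes u: "u \<in> W" and x: "smooth_on W x" "\<And>w. w \<in> W \<Longrightarrow> x w \<in> range (dF w)"
    and y: "smooth_on W y" "\<And>w. w \<in> W \<Longrightarrow> y w \<in> range (dF w)"
    and "dF u \<xi> = x u" "dF u \<eta> = y u"
  shows "frechet_derivative y (at u) \<xi> - frechet_derivative x (at u) \<eta> + lie (x u) (y u) \<in> range (dF u)"
  unfolding range_dF_iff[OF u] bracket_untriv[OF u x(1) y(1) assms(6,7), symmetric]
proof (rule bracket_in_range[OF open_W u smooth_F inj_F[OF u]])
  show "untriv (F w) (x w) \<in> range (frechet_derivative F (at w))"
    "untriv (F w) (y w) \<in> range (frechet_derivative F (at w))" if "w \<in> W" for w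
    using x(2) y(2) range_dF_iff that by blast+
qed (use x y assms(6,7) u in \<open>auto intro!: smooth_on_untriv open_W smooth_F simp: untriv_dF[symmetric]\<close>)

text \<open>The Lie bracket of the vector fields given by \<open>e\<close> and \<open>\<i> *s e\<close>.\<close>

definition frame_bracket :: "real^3 \<Rightarrow> complex^3" where
  "frame_bracket u = \<i> *s frechet_derivative e (at u) (chart_coord u (e u))
    - frechet_derivative e (at u) (chart_coord u (\<i> *s e u)) + lie (e u) (\<i> *s e u)"

lemma e_self_in_dF: "u \<in> W \<Longrightarrow> e u \<in> range (dF u)"
  using e_in_dF[of u 1] by simp

lemma smooth_ie: "smooth_on W (\<lambda>u. \<i> *s e u)"
  by (intro smooth_on_smult open_W smooth_e smooth_on_const)

lemma derivative_ie: "u \<in> W \<Longrightarrow> frechet_derivative (\<lambda>u. \<i> *s e u) (at u) \<xi> = \<i> *s frechet_derivative e (at u) \<xi>"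
  using frechet_derivative_eq[OF bounded_linear.has_derivative[OF
      bounded_bilinear.bounded_linear_right[OF bounded_bilinear_smult]
      smooth_on_has_derivative[OF smooth_e]], of u \<i>] by simp

lemma frame_bracket_eq:
  assumes "u \<in> W"
  shows "frame_bracket u = frechet_derivative (\<lambda>u. \<i> *s e u) (at u) (chart_coord u (e u))
    - frechet_derivative e (at u) (chart_coord u (\<i> *s e u)) + lie (e u) (\<i> *s e u)"
  by (simp add: frame_bracket_def derivative_ie[OF assms])

lemma frame_bracket_in_dF: "u \<in> W \<Longrightarrow> frame_bracket u \<in> range (dF u)"
  unfolding frame_bracket_eq
  by (rule bracket_in_dF) (auto intro!: smooth_e smooth_ie dF_chart_coord intro: e_in_dF e_self_in_dF)

lemma continuous_on_frame_bracket: "continuous_on W frame_bracket"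
proof -
  \<comment> \<open>Continuity of the derivative of \<open>e\<close> in \<open>u\<close> is
    available for fixed directions only, and the directions in the bracket move with
    \<open>u\<close>.\<close>
  have D: "frechet_derivative e (at u) \<xi> = (\<Sum>b\<in>Basis. (\<xi> \<bullet> b) *\<^sub>R frechet_derivative e (at u) b)"
    if "u \<in> W" for u \<xi>
  proof -
    interpret linear "frechet_derivative e (at u)"
      using smooth_on_has_derivative[OF smooth_e that] has_derivative_linear by blast
    show ?thesis by (subst (1) euclidean_representation[of \<xi>, symmetric]) (simp add: sum scaleR)
  qed
  have c: "continuous_on W e" "continuous_on W (\<lambda>u. \<i> *s e u)" "continuous_on W (\<lambda>u. frechet_derivative e (at u) b)" for b
    by (intro smooth_on_continuous smooth_e smooth_ie smooth_on_frechet_derivative)+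
  have l: "continuous_on W (\<lambda>u. lie (e u) (\<i> *s e u))"
    unfolding lie_def
    by (intro bounded_bilinear.continuous_on[OF bounded_bilinear_smult] continuous_intros
        bounded_bilinear.continuous_on[OF bounded_bilinear_ccross]
        bounded_linear.continuous_on[OF bounded_linear_vcnj] c)
  have "continuous_on W (\<lambda>u. \<i> *s (\<Sum>b\<in>Basis. (chart_coord u (e u) \<bullet> b) *\<^sub>R frechet_derivative e (at u) b)
    - (\<Sum>b\<in>Basis. (chart_coord u (\<i> *s e u) \<bullet> b) *\<^sub>R frechet_derivative e (at u) b) + lie (e u) (\<i> *s e u))"
    by (intro bounded_bilinear.continuous_on[OF bounded_bilinear_smult] continuous_intros c l
        continuous_on_chart_coord e_in_dF e_self_in_dF)
  then show ?thesis
    by (rule continuous_on_eq) (simp add: frame_bracket_def D[symmetric])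
qed

lemma derivative_cdot_0:
  assumes U: "open U" "U \<subseteq> W" "u \<in> U" and x: "smooth_on W x" and "\<And>w. w \<in> U \<Longrightarrow> cdot (e w) (x w) = 0"
  shows "cdot (e u) (frechet_derivative x (at u) \<xi>) + cdot (frechet_derivative e (at u) \<xi>) (x u) = 0"
proof -
  have u: "u \<in> W" using U by blast
  have "((\<lambda>w. cdot (e w) (x w)) has_derivative
      (\<lambda>\<xi>. cdot (e u) (frechet_derivative x (at u) \<xi>) + cdot (frechet_derivative e (at u) \<xi>) (x u))) (at u)"
    by (intro bounded_bilinear.FDERIV[OF bounded_bilinear_cdot] smooth_on_has_derivative[OF _ u] smooth_e x)
  then have "((\<lambda>w. 0) has_derivative
      (\<lambda>\<xi>. cdot (e u) (frechet_derivative x (at u) \<xi>) + cdot (frechet_derivative e (at u) \<xi>) (x u))) (at u)"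
    by (rule has_derivative_transform_within_open[OF _ U(1,3)]) (simp add: assms(5))
  from fun_cong[OF has_derivative_unique[OF this has_derivative_const], of \<xi>] show ?thesis .
qed

lemma cdot_derivative_e: "u \<in> W \<Longrightarrow> cdot (e u) (frechet_derivative e (at u) \<xi>) = 0"
  using derivative_cdot_0[OF open_W order_refl _ smooth_e isotropic, of u \<xi>] by (simp add: cdot_commute)

text \<open>Differentiating the isotropy equation makes all derivatives of \<open>e\<close>
  orthogonal to \<open>e\<close>, also after multiplication by \<i>; the zeroth-order term is a
  multiple of the cross product of \<open>vcnj e\<close> and \<open>e\<close>, hence orthogonal
  too.\<close>

lemma cdot_frame_bracket: "u \<in> W \<Longrightarrow> cdot (e u) (frame_bracket u) = 0"
  by (simp add: frame_bracket_def cdot_linear cdot_derivative_e cdot_lie_i)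

lemma dim_dF: "u \<in> W \<Longrightarrow> dim (range (dF u)) = 3"
  using dim_image_eq[OF linear_dF inj_on_subset[OF inj_dF]] by simp

lemma transversal_exists:
  assumes u: "u \<in> W"
  obtains \<eta> where "ccross (e u) (dF u \<eta>) \<noteq> 0"
proof -
  have "\<not> range (dF u) \<subseteq> range (\<lambda>c. c *s e u)"
  proof
    assume "range (dF u) \<subseteq> range (\<lambda>c. c *s e u)"
    from dim_subset[OF this] show False using dim_dF[OF u] dim_complex_line[OF e_nonzero[OF u]] by simp
  qed
  then show ?thesis using that ccross_eq_0D e_nonzero[OF u] by blast
qed

lemma tangent_decomposition:
  assumes u: "u \<in> W" and \<eta>: "ccross (e u) (dF u \<eta>) \<noteq> 0" and z: "z \<in> range (dF u)"
  obtains c r where "z = c *s e u + r *\<^sub>R dF u \<eta>"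
proof -
  let ?v = "dF u \<eta>"
  have v: "?v \<notin> range (\<lambda>c. c *s e u)" using \<eta> by auto
  have sub: "span (insert ?v {e u, \<i> *s e u}) \<subseteq> range (dF u)"
    by (rule span_minimal) (use e_in_dF[OF u] e_self_in_dF[OF u] subspace_dF[OF u] in auto)
  have "dim {e u, \<i> *s e u} = 2"
    using dim_complex_line[OF e_nonzero[OF u]] dim_span[of "{e u, \<i> *s e u}"]
    by (simp only: span_complex_line)
  then have "dim (insert ?v {e u, \<i> *s e u}) = 3"
    unfolding dim_insert using v by (simp add: span_complex_line)
  then have "span (insert ?v {e u, \<i> *s e u}) = range (dF u)"
    by (intro subspace_dim_equal sub subspace_dF u) (simp_all add: dim_dF[OF u])
  then obtain r where "z - r *\<^sub>R ?v \<in> span {e u, \<i> *s e u}"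
    using z span_breakdown_eq by blast
  then obtain c where "z - r *\<^sub>R ?v = c *s e u" unfolding span_complex_line by blast
  then have "z = c *s e u + r *\<^sub>R ?v" by (simp add: algebra_simps)
  then show ?thesis by (rule that)
qed

section \<open>Orthogonality and the transversal part of the bracket\<close>

text \<open>Nonvanishing of \<open>ccross (e u) (frame_bracket u)\<close> says that the bracket
  leaves the complex line, that is, \<rho> \<noteq> 0, without a choice of a transversal
  vector.\<close>

lemma noninvolutive_imp_orthogonal:
  assumes u: "u \<in> W" and R: "ccross (e u) (frame_bracket u) \<noteq> 0"
  shows "cdot (e u) (dF u \<xi>) = 0"
proof -
  obtain \<eta> where \<eta>: "ccross (e u) (dF u \<eta>) \<noteq> 0" using transversal_exists[OF u] .
  obtain c r where cr: "frame_bracket u = c *s e u + r *\<^sub>R dF u \<eta>"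
    using tangent_decomposition[OF u \<eta> frame_bracket_in_dF[OF u]] .
  have "r \<noteq> 0" using R by (auto simp: cr)
  then have v: "cdot (e u) (dF u \<eta>) = 0"
    using cdot_frame_bracket[OF u] by (simp add: cr scaleR_c3 cdot_linear isotropic[OF u])
  obtain c' r' where "dF u \<xi> = c' *s e u + r' *\<^sub>R dF u \<eta>"
    using tangent_decomposition[OF u \<eta>, of "dF u \<xi>"] by blast
  then show ?thesis by (simp add: scaleR_c3 cdot_linear isotropic[OF u] v)
qed

text \<open>Orthogonality is assumed on an open set because it is differentiated along
  \<open>e\<close> and \<open>\<i> *s e\<close>. The second ingredient is that the brackets of these
  two fields with \<open>dF w \<eta>\<close> are tangent, hence again orthogonal to
  \<open>e u\<close>.\<close>

lemma frame_bracket_transversal: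
  assumes U: "open U" "U \<subseteq> W" "u \<in> U" and \<eta>: "ccross (e u) (dF u \<eta>) \<noteq> 0"
    and orth: "\<And>w. w \<in> U \<Longrightarrow> cdot (e w) (dF w \<eta>) = 0"
  shows "cdot (frame_bracket u) (dF u \<eta>) + 4/3 * \<i> * cdot (e u) (vcnj (ccross (e u) (dF u \<eta>))) = 0"
proof -
  have u: "u \<in> W" using U by blast
  let ?v = "dF u \<eta>" and ?De = "frechet_derivative e (at u)" and ?Dv = "frechet_derivative (\<lambda>w. dF w \<eta>) (at u)"
  define \<xi>1 \<xi>2 where "\<xi>1 = chart_coord u (e u)" and "\<xi>2 = chart_coord u (\<i> *s e u)"
  have \<xi>: "dF u \<xi>1 = e u" "dF u \<xi>2 = \<i> *s e u"
    using dF_chart_coord e_in_dF[OF u] e_self_in_dF[OF u] by (auto simp: \<xi>1_def \<xi>2_def)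
  have orth_dF: "cdot (e u) z = 0" if "z \<in> range (dF u)" for z
  proof -
    note z = that
    obtain c r where "z = c *s e u + r *\<^sub>R ?v" using tangent_decomposition[OF u \<eta> z] .
    then show ?thesis by (simp add: scaleR_c3 cdot_linear isotropic[OF u] orth[OF U(3)])
  qed
  have b1: "cdot (e u) (?Dv \<xi>1 - ?De \<eta> + lie (e u) ?v) = 0"
    by (rule orth_dF, rule bracket_in_dF[OF u]) (auto intro: smooth_e smooth_dF e_self_in_dF \<xi>)
  have "?Dv \<xi>2 - \<i> *s ?De \<eta> + lie (\<i> *s e u) ?v \<in> range (dF u)"
    using bracket_in_dF[OF u smooth_ie _ smooth_dF _ \<xi>(2) refl] e_in_dF by (simp add: derivative_ie[OF u])
  then have b2: "cdot (e u) (?Dv \<xi>2 - \<i> *s ?De \<eta> + lie (\<i> *s e u) ?v) = 0" by (rule orth_dF)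
  have d: "cdot (e u) (?Dv \<xi>) + cdot (?De \<xi>) ?v = 0" for \<xi>
    by (rule derivative_cdot_0[OF U smooth_dF orth])
  have "cdot (frame_bracket u) ?v = \<i> * cdot (?De \<xi>1) ?v - cdot (?De \<xi>2) ?v + cdot (lie (e u) (\<i> *s e u)) ?v"
    by (simp add: frame_bracket_def \<xi>1_def \<xi>2_def cdot_linear)
  also have "\<dots> = \<i> * cdot (e u) (lie (e u) ?v) - cdot (e u) (lie (\<i> *s e u) ?v) + cdot (lie (e u) (\<i> *s e u)) ?v"
  proof -
    \<comment> \<open>By \<open>d\<close> the derivative moves from \<open>e\<close> to the
      transversal field, where \<open>b1\<close> and \<open>b2\<close> evaluate it; the derivative
      of \<open>e\<close> along \<open>\<eta>\<close> disappears by isotropy.\<close>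
    have "cdot (?De \<xi>1) ?v = cdot (e u) (lie (e u) ?v)" "cdot (?De \<xi>2) ?v = cdot (e u) (lie (\<i> *s e u) ?v)"
      using b1 b2 d[of \<xi>1] d[of \<xi>2]
      by (simp_all add: cdot_linear cdot_derivative_e[OF u]) (metis add.commute add_left_cancel)+
    then show ?thesis by simp
  qed
  finally show ?thesis by (simp add: cdot_lie_identity)
qed

lemma transversal_imp_noninvolutive:
  assumes u: "u \<in> W" and "cdot (e u) (dF u \<eta>) = 0" "ccross (e u) (dF u \<eta>) \<noteq> 0"
    and "cdot (frame_bracket u) (dF u \<eta>) + 4/3 * \<i> * cdot (e u) (vcnj (ccross (e u) (dF u \<eta>))) = 0"
  shows "ccross (e u) (frame_bracket u) \<noteq> 0"
proof
  assume "ccross (e u) (frame_bracket u) = 0"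
  then obtain c where "frame_bracket u = c *s e u" using ccross_eq_0D e_nonzero[OF u] by blast
  then have "cdot (frame_bracket u) (dF u \<eta>) = 0" using assms(2) by (simp add: cdot_linear)
  then show False using assms(4) cdot_vcnj_ccross_nonzero[OF isotropic[OF u] assms(2,3)] by simp
qed

lemma orthogonal_imp_noninvolutive:
  assumes "\<And>w \<xi>. w \<in> W \<Longrightarrow> cdot (e w) (dF w \<xi>) = 0" "u \<in> W"
  shows "ccross (e u) (frame_bracket u) \<noteq> 0"
proof -
  obtain \<eta> where \<eta>: "ccross (e u) (dF u \<eta>) \<noteq> 0" using transversal_exists[OF assms(2)] .
  show ?thesis
    using frame_bracket_transversal[OF open_W order_refl assms(2) \<eta>] assms
    by (intro transversal_imp_noninvolutive[OF assms(2) _ \<eta>]) auto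
qed

lemma continuous_ccross: "continuous_on W x \<Longrightarrow> continuous_on W (\<lambda>u. ccross (e u) (x u))"
  by (intro bounded_bilinear.continuous_on[OF bounded_bilinear_ccross] smooth_on_continuous[OF smooth_e])

lemma open_noninvolutive: "open {u \<in> W. ccross (e u) (frame_bracket u) \<noteq> 0}"
proof -
  have "open (W \<inter> (\<lambda>u. ccross (e u) (frame_bracket u)) -` (- {0}))"
    by (intro continuous_open_preimage continuous_ccross continuous_on_frame_bracket open_W) auto
  moreover have "W \<inter> (\<lambda>u. ccross (e u) (frame_bracket u)) -` (- {0}) = {u \<in> W. ccross (e u) (frame_bracket u) \<noteq> 0}"
    by auto
  ultimately show ?thesis by simp
qed

text \<open>On the set where the bracket is transversal two further equations hold. Being closed conditions, they
  persist at its boundary points, where they force the bracket to be transversal again.\<close>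

lemma involutive_nbhd:
  assumes u: "u \<in> W" and R: "ccross (e u) (frame_bracket u) = 0"
  obtains U where "open U" "u \<in> U" "U \<subseteq> W" "\<And>w. w \<in> U \<Longrightarrow> ccross (e w) (frame_bracket w) = 0"
proof -
  obtain \<eta> where \<eta>: "ccross (e u) (dF u \<eta>) \<noteq> 0" using transversal_exists[OF u] .
  let ?v = "\<lambda>w. dF w \<eta>"
  let ?K = "\<lambda>w. cdot (frame_bracket w) (?v w) + 4/3 * \<i> * cdot (e w) (vcnj (ccross (e w) (?v w)))"
  have cont: "continuous_on W ?v" "continuous_on W e"
    by (intro smooth_on_continuous smooth_dF smooth_e)+
  \<comment> \<open>Transversality of \<open>\<eta>\<close>, chosen at \<open>u\<close>, persists
    nearby, so one constant direction serves for all of \<open>W'\<close>.\<close>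
  define W' where "W' = W \<inter> (\<lambda>w. ccross (e w) (?v w)) -` (- {0})"
  have W': "open W'" "u \<in> W'" "W' \<subseteq> W"
    unfolding W'_def using u \<eta>
    by (auto intro!: continuous_open_preimage continuous_ccross cont open_W)
  define N where "N = W' \<inter> {w \<in> W. ccross (e w) (frame_bracket w) \<noteq> 0}"
  have N: "open N" "N \<subseteq> W'" unfolding N_def by (auto intro!: open_Int W' open_noninvolutive)
  have u_closure: False if "u \<in> closure N"
  proof -
    have 1: "cdot (e w) (?v w) = 0" if "w \<in> N" for w
      using that noninvolutive_imp_orthogonal by (auto simp: N_def)
    have 2: "?K w = 0" if "w \<in> N" for w
      by (rule frame_bracket_transversal[OF N(1) _ that _ 1]) (use that in \<open>auto simp: N_def W'_def\<close>)
    \<comment> \<open>The zero set of \<open>h\<close> is closed in \<open>W\<close>, which lets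
      both equations, valid on \<open>N\<close>, reach the boundary point \<open>u\<close>.\<close>
    have lim: "h u = 0" if h: "continuous_on W h" "\<And>w. w \<in> N \<Longrightarrow> h w = 0" for h :: "real^3 \<Rightarrow> complex"
    proof -
      have "closedin (top_of_set W) (W \<inter> h -` {0})"
        by (rule continuous_closedin_preimage[OF h(1)]) simp
      then obtain C where C: "closed C" "W \<inter> h -` {0} = W \<inter> C" by (auto simp: closedin_closed)
      have "N \<subseteq> C" using C(2) h(2) N(2) W'(3) by blast
      then have "u \<in> C" using C(1) closure_minimal \<open>u \<in> closure N\<close> by blast
      then show ?thesis using C(2) u by blast
    qed
    have "cdot (e u) (?v u) = 0"
      by (rule lim[OF _ 1]) (intro bounded_bilinear.continuous_on[OF bounded_bilinear_cdot] cont)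
    moreover have "?K u = 0"
      by (rule lim[OF _ 2])
        (intro continuous_intros bounded_bilinear.continuous_on[OF bounded_bilinear_cdot]
          bounded_linear.continuous_on[OF bounded_linear_vcnj] continuous_ccross cont continuous_on_frame_bracket)
    ultimately show False using transversal_imp_noninvolutive[OF u _ \<eta>] R by blast
  qed
  show ?thesis
  proof (rule that[of "W' - closure N"])
    show "ccross (e w) (frame_bracket w) = 0" if "w \<in> W' - closure N" for w
      using that W'(3) closure_subset[of N] by (auto simp: N_def)
  qed (use W' u_closure in auto)
qed

end

section \<open>CR submanifolds with isotropic \<open>D1\<close>\<close>

lemma smooth_on_vcnj: "open U \<Longrightarrow> smooth_on U x \<Longrightarrow> smooth_on U (\<lambda>u. vcnj (x u))"
  by (rule smooth_on_bounded_linear[OF _ bounded_linear_vcnj])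

text \<open>The coefficient of the Hermitian projection of \<open>x\<close> onto the complex line of
  \<open>e\<close>; as a formula in all \<open>x\<close> it depends smoothly on both arguments while
  \<open>e\<close> is nonzero.\<close>

definition line_coeff :: "complex^3 \<Rightarrow> complex^3 \<Rightarrow> complex" where
  "line_coeff x e = cdot x (vcnj e) / cdot e (vcnj e)"

lemma line_coeff_smult [simp]: "e \<noteq> 0 \<Longrightarrow> line_coeff (c *s e) e = c"
  by (simp add: line_coeff_def cdot_linear)

lemma line_coeff_scale:
  assumes "a \<noteq> 0"
  shows "line_coeff x (a *s e) *s (a *s e) = line_coeff x e *s e"
  using assms by (simp add: line_coeff_def cdot_linear vec_eq_iff field_simps)

lemma smooth_on_line_coeff:
  assumes "open U" "smooth_on U x" "smooth_on U e" "\<And>u. u \<in> U \<Longrightarrow> e u \<noteq> 0"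
  shows "smooth_on U (\<lambda>u. line_coeff (x u) (e u))"
  unfolding line_coeff_def divide_inverse
  using assms
  by (intro smooth_on_bilinear[OF _ bounded_bilinear_mult] smooth_on_inverse smooth_on_cdot smooth_on_vcnj) auto

text \<open>On the real plane spanned by \<open>e\<close> and \<open>\<i> *s e\<close>, an
  alternating real bilinear map is the determinant of the coefficients times its value on the
  basis.\<close>

lemma lie_line:
  "lie (h *s e) (k *s e) = of_real (Re h * Im k - Im h * Re k) *s lie e (\<i> *s e)"
  by (simp add: c3_simps complex_eq_iff) (simp add: field_simps)

context isotropic_chart
begin

text \<open>Modulo the complex line the bracket is tensorial: derivatives of the coefficients only
  produce multiples of \<open>e u\<close>, which vanish under the cross product, and the determinant
  of the coefficients remains.\<close>

lemma frame_bracket_multiple: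
  assumes u: "u \<in> W" and h: "smooth_on W h" and k: "smooth_on W k"
    and \<xi>: "dF u \<xi> = h u *s e u" and \<eta>: "dF u \<eta> = k u *s e u"
  shows "ccross (e u) (frechet_derivative (\<lambda>w. k w *s e w) (at u) \<xi>
      - frechet_derivative (\<lambda>w. h w *s e w) (at u) \<eta> + lie (h u *s e u) (k u *s e u))
    = of_real (Re (h u) * Im (k u) - Im (h u) * Re (k u)) *s ccross (e u) (frame_bracket u)"
proof -
  let ?De = "frechet_derivative e (at u)"
  define d1 d2 where "d1 = ?De (chart_coord u (e u))" and "d2 = ?De (chart_coord u (\<i> *s e u))"
  have lin: "linear (dF u)" "linear ?De"
    using linear_dF[OF u] smooth_on_has_derivative[OF smooth_e u] has_derivative_linear by blast+
  have De: "?De \<zeta> = Re c *\<^sub>R d1 + Im c *\<^sub>R d2" if "dF u \<zeta> = c *s e u" for c \<zeta>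
  proof -
    have "dF u (Re c *\<^sub>R chart_coord u (e u) + Im c *\<^sub>R chart_coord u (\<i> *s e u)) = Re c *\<^sub>R e u + Im c *\<^sub>R (\<i> *s e u)"
      by (simp add: linear_add[OF lin(1)] linear_cmul[OF lin(1)] dF_chart_coord e_in_dF[OF u] e_self_in_dF[OF u])
    also have "\<dots> = c *s e u" by (simp add: vec_eq_iff complex_eq_iff)
    finally have "\<zeta> = Re c *\<^sub>R chart_coord u (e u) + Im c *\<^sub>R chart_coord u (\<i> *s e u)"
      using that inj_dF[OF u] by (metis injD)
    then show ?thesis by (simp add: d1_def d2_def linear_add[OF lin(2)] linear_cmul[OF lin(2)])
  qed
  have D: "frechet_derivative (\<lambda>w. c w *s e w) (at u) \<zeta> = c u *s ?De \<zeta> + frechet_derivative c (at u) \<zeta> *s e u"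
    if "smooth_on W c" for c \<zeta>
    using frechet_derivative_eq[OF bounded_bilinear.FDERIV[OF bounded_bilinear_smult
        smooth_on_has_derivative[OF that u] smooth_on_has_derivative[OF smooth_e u]]] by simp
  show ?thesis
    unfolding D[OF h] D[OF k] De[OF \<xi>] De[OF \<eta>] lie_line frame_bracket_def d1_def[symmetric] d2_def[symmetric]
    by (simp add: vec_eq_iff forall_3 complex_eq_iff) (simp add: algebra_simps)
qed

end

locale CR_isotropic =
  fixes M :: "(real^3, 'm) manifold" and f :: "'m \<Rightarrow> quat2" and D1 :: "'m \<Rightarrow> quat2 set"
  assumes CR: "proper_CR_submanifold M f D1"
    and PS_orthogonal: "x \<in> points M \<Longrightarrow> v \<in> D1 x \<Longrightarrow> w \<in> D1 x \<Longrightarrow> gS (f x) (PS (f x) v) w = 0"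
begin

lemma immersed: "immersed_submanifold M f"
  using CR unfolding proper_CR_submanifold_def by blast

lemma CR_D1:
  "smooth_distribution M f D1" "\<not> almost_complex M f" "\<not> totally_real M f"
  "x \<in> points M \<Longrightarrow> JS (f x) ` D1 x = D1 x"
  "x \<in> points M \<Longrightarrow> JS (f x) ` complement_in_tan M f D1 x \<subseteq> norM M f x"
  using CR unfolding proper_CR_submanifold_def by blast+

lemmas smooth_M = immersed_submanifoldD(1)[OF immersed]
lemmas f_in = immersed_submanifoldD(3)[OF immersed]

lemma chart_immersion:
  assumes "(V, \<phi>) \<in> atlas M"
  shows "smooth_on V (f \<circ> \<phi>)" "u \<in> V \<Longrightarrow> (f \<circ> \<phi>) u \<in> S3S3"
    "u \<in> V \<Longrightarrow> frechet_derivative (f \<circ> \<phi>) (at u) \<xi> \<in> tanS (f (\<phi> u))"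
proof -
  show s: "smooth_on V (f \<circ> \<phi>)"
    by (rule smooth_map_smooth_on[OF immersed_submanifoldD(2)[OF immersed] assms])
  show i: "(f \<circ> \<phi>) u \<in> S3S3" if "u \<in> V" for u
    using f_in smooth_manifold_chart(6)[OF smooth_M assms that] by simp
  show "frechet_derivative (f \<circ> \<phi>) (at u) \<xi> \<in> tanS (f (\<phi> u))" if "u \<in> V"
  proof -
    have "frechet_derivative (f \<circ> \<phi>) (at u) \<xi> \<in> tanS ((f \<circ> \<phi>) u)"
      by (rule tangent_to_S3S3[OF smooth_manifold_chart(1)[OF smooth_M assms] that s i])
    then show ?thesis by (simp only: comp_apply)
  qed
qed

lemma tanM_subset: "x \<in> points M \<Longrightarrow> tanM M f x \<subseteq> tanS (f x)"
proof -
  assume "x \<in> points M"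
  then obtain V \<phi> u where V: "(V, \<phi>) \<in> atlas M" "u \<in> V" "\<phi> u = x"
    by (rule smooth_manifold_cover[OF smooth_M])
  show ?thesis
    using tanM_chart[OF immersed V(1,2)] chart_immersion(3)[OF V(1,2)] by (auto simp: V(3))
qed

lemma dim_tanM: "x \<in> points M \<Longrightarrow> subspace (tanM M f x) \<and> dim (tanM M f x) = 3"
proof -
  assume "x \<in> points M"
  then obtain V \<phi> u where V: "(V, \<phi>) \<in> atlas M" "u \<in> V" "\<phi> u = x"
    by (rule smooth_manifold_cover[OF smooth_M])
  have lin: "linear (frechet_derivative (f \<circ> \<phi>) (at u))"
    using smooth_on_has_derivative[OF chart_immersion(1)[OF V(1)] V(2)] has_derivative_linear by blast
  have "dim (range (frechet_derivative (f \<circ> \<phi>) (at u))) = dim (UNIV :: (real^3) set)"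
    by (rule dim_image_eq[OF lin]) (simp add: immersed_submanifoldD(4)[OF immersed V(1,2)])
  then show ?thesis
    using tanM_chart[OF immersed V(1,2)] linear_subspace_image[OF lin subspace_UNIV] by (simp add: V(3))
qed

lemma D1_subset: "x \<in> points M \<Longrightarrow> subspace (D1 x) \<and> D1 x \<subseteq> tanM M f x"
  using CR_D1(1)[unfolded smooth_distribution_def, THEN conjunct1] by blast

lemmas JS_D1 = CR_D1(4)

lemma D1_complex:
  assumes x: "x \<in> points M" and d: "d \<in> D1 x"
  shows "untriv (f x) (c *s triv (f x) d) \<in> D1 x"
proof -
  have dT: "d \<in> tanS (f x)" using d D1_subset[OF x] tanM_subset[OF x] by blast
  have "JS (f x) d = untriv (f x) (\<i> *s triv (f x) d)"
    using JS_untriv[OF f_in[OF x], of "triv (f x) d"] dT f_in[OF x] by simp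
  then have "Re c *\<^sub>R d + Im c *\<^sub>R untriv (f x) (\<i> *s triv (f x) d) \<in> D1 x"
    using D1_subset[OF x] JS_D1[OF x] d by (metis imageI subspace_add subspace_scale)
  moreover have "Re c *\<^sub>R d + Im c *\<^sub>R untriv (f x) (\<i> *s triv (f x) d)
      = untriv (f x) (Re c *\<^sub>R triv (f x) d + Im c *\<^sub>R (\<i> *s triv (f x) d))"
    using dT f_in[OF x] by (simp add: untriv.add_right untriv.scaleR_right)
  moreover have "Re c *\<^sub>R triv (f x) d + Im c *\<^sub>R (\<i> *s triv (f x) d) = c *s triv (f x) d"
    by (simp add: vec_eq_iff complex_eq_iff)
  ultimately show ?thesis by simp
qed

lemma dim_untriv_line:
  assumes "p \<in> S3S3" "z \<noteq> 0"
  shows "subspace (range (\<lambda>c. untriv p (c *s z)))" "dim (range (\<lambda>c. untriv p (c *s z))) = 2"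
proof -
  have lin: "linear (untriv p)" using untriv.bounded_linear_right bounded_linear.linear by blast
  have inj: "inj (untriv p)" using assms(1) by (metis injI triv_untriv)
  have eq: "range (\<lambda>c. untriv p (c *s z)) = untriv p ` range (\<lambda>c. c *s z)" by auto
  have "subspace (range (\<lambda>c. c *s z))" unfolding span_complex_line[symmetric] by simp
  then show "subspace (range (\<lambda>c. untriv p (c *s z)))"
    unfolding eq by (rule linear_subspace_image[OF lin])
  show "dim (range (\<lambda>c. untriv p (c *s z))) = 2"
    unfolding eq using dim_image_eq[OF lin inj_on_subset[OF inj]] dim_complex_line[OF assms(2)] by simp
qed

section \<open>The rank of \<open>D1\<close> and its local complex frames\<close>

lemma D1_rank:
  "\<exists>r. \<forall>x\<in>points M. dim (D1 x) = r \<and>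
    (\<exists>(V, \<phi>) \<in> atlas M. \<exists>W E. open W \<and> W \<subseteq> V \<and> x \<in> \<phi> ` W \<and>
      (\<forall>i<r. smooth_on W (E i)) \<and>
      (\<forall>u\<in>W. span ((\<lambda>i::nat. E i u) ` {..<r}) = D1 (\<phi> u)))"
  using CR_D1(1)[unfolded smooth_distribution_def, THEN conjunct2] .

lemma dim_D1_ge_2:
  assumes x: "x \<in> points M" and "dim (D1 x) \<noteq> 0"
  shows "2 \<le> dim (D1 x)"
proof -
  have "\<not> D1 x \<subseteq> {0}" using assms(2) by simp
  then obtain d where d: "d \<in> D1 x" "d \<noteq> 0" by auto
  have "untriv (f x) (triv (f x) d) = d"
    using D1_subset[OF x] tanM_subset[OF x] d f_in[OF x] by (intro untriv_triv) auto
  then have nz: "triv (f x) d \<noteq> 0" using d(2) untriv.zero_right by metis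
  have "range (\<lambda>c. untriv (f x) (c *s triv (f x) d)) \<subseteq> D1 x"
    using D1_complex[OF x d(1)] by blast
  from dim_subset[OF this] show ?thesis using dim_untriv_line(2)[OF f_in[OF x] nz] by simp
qed

text \<open>A nonzero vector of \<open>D1\<close> brings its whole complex line, so rank 1 is
  impossible. Rank 0 would make \<open>M\<close> totally real and rank 3 almost complex; both
  notions are global, and constancy of the rank is what excludes them at each point.\<close>

lemma dim_D1:
  assumes x: "x \<in> points M"
  shows "dim (D1 x) = 2"
proof -
  obtain r where r: "\<And>x. x \<in> points M \<Longrightarrow> dim (D1 x) = r"
    using D1_rank by (elim exE) simp
  have "r \<noteq> 0"
  proof
    assume r0: "r = 0"
    have "JS (f y) ` tanM M f y \<subseteq> norM M f y" if y: "y \<in> points M" for y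
    proof -
      have D0: "D1 y \<subseteq> {0}" using r[OF y] r0 dim_eq_0 by metis
      have "gS (f y) v 0 = 0" if "v \<in> tanM M f y" for v
      proof -
        have "gS (f y) (untriv (f y) (triv (f y) v)) (untriv (f y) 0) = 0"
          using gS_untriv[OF f_in[OF y], of "triv (f y) v" 0] by simp
        moreover have "untriv (f y) (triv (f y) v) = v"
          using that tanM_subset[OF y] f_in[OF y] by (intro untriv_triv) auto
        ultimately show ?thesis by (simp only: untriv.zero_right)
      qed
      then have "complement_in_tan M f D1 y = tanM M f y"
        unfolding complement_in_tan_def using D0 by blast
      then show ?thesis using CR_D1(5)[OF y] by simp
    qed
    then show False using CR_D1(3) unfolding totally_real_def by blast
  qed
  moreover have "r \<noteq> 3"
  proof
    assume r3: "r = 3"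
    have "D1 y = tanM M f y" if y: "y \<in> points M" for y
      using subspace_dim_equal[of "D1 y" "tanM M f y"] D1_subset[OF y] dim_tanM[OF y] r[OF y] r3 by simp
    then show False
      using CR_D1(2) JS_D1 unfolding almost_complex_def by simp
  qed
  moreover have "r \<le> 3"
    using dim_subset[of "D1 x" "tanM M f x"] D1_subset[OF x] dim_tanM[OF x] r[OF x] by simp
  ultimately show ?thesis using dim_D1_ge_2[OF x] r[OF x] by linarith
qed

lemma D1_line:
  assumes x: "x \<in> points M" and d: "d \<in> D1 x" "d \<noteq> 0"
  shows "triv (f x) d \<noteq> 0" "D1 x = range (\<lambda>c. untriv (f x) (c *s triv (f x) d))"
proof -
  have "untriv (f x) (triv (f x) d) = d"
    using D1_subset[OF x] tanM_subset[OF x] d f_in[OF x] by (intro untriv_triv) auto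
  then show nz: "triv (f x) d \<noteq> 0" using d(2) untriv.zero_right by metis
  have "range (\<lambda>c. untriv (f x) (c *s triv (f x) d)) \<subseteq> D1 x"
    using D1_complex[OF x d(1)] by blast
  from subspace_dim_equal[OF dim_untriv_line(1)[OF f_in[OF x] nz] _ this]
  show "D1 x = range (\<lambda>c. untriv (f x) (c *s triv (f x) d))"
    using D1_subset[OF x] dim_D1[OF x] dim_untriv_line(2)[OF f_in[OF x] nz] by simp
qed

text \<open>The metric sees only a real part, but \<open>D1\<close> contains all complex multiples
  of the vector; testing with \<open>c = 1\<close> and \<open>c = \<i>\<close> gives both the real
  and the imaginary part.\<close>

lemma D1_isotropic:
  assumes x: "x \<in> points M" and D: "\<And>c. untriv (f x) (c *s z) \<in> D1 x"
  shows "cdot z z = 0"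
proof -
  have "vcnj z \<bullet> (c *s z) = 0" for c
    using PS_orthogonal[OF x D[of 1] D[of c]] f_in[OF x] by simp
  then have "Re (cnj c * cnj (cdot z z)) = 0" for c
    by (simp add: inner_c3 cdot_linear cdot_vcnj)
  from this[of 1] this[of \<i>] show ?thesis by (simp add: complex_eq_iff)
qed

definition local_frame where
  "local_frame V \<phi> W e \<longleftrightarrow> (V, \<phi>) \<in> atlas M \<and> W \<subseteq> V \<and> isotropic_chart W (f \<circ> \<phi>) e \<and>
    (\<forall>w\<in>W. D1 (\<phi> w) = range (\<lambda>c. untriv (f (\<phi> w)) (c *s e w)))"

text \<open>Of the two frame vectors the first one already generates: it cannot vanish, since the
  other alone spans at most one dimension, and its complex multiples fill \<open>D1\<close>.\<close>

lemma local_frame_exists: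
  assumes x: "x \<in> points M"
  obtains V \<phi> W e u where "local_frame V \<phi> W e" "u \<in> W" "\<phi> u = x"
proof -
  obtain r where r: "\<forall>x\<in>points M. dim (D1 x) = r \<and>
    (\<exists>(V, \<phi>) \<in> atlas M. \<exists>W E. open W \<and> W \<subseteq> V \<and> x \<in> \<phi> ` W \<and>
      (\<forall>i<r. smooth_on W (E i)) \<and>
      (\<forall>u\<in>W. span ((\<lambda>i::nat. E i u) ` {..<r}) = D1 (\<phi> u)))"
    using D1_rank ..
  note rx = r[THEN bspec, OF x]
  have r2: "r = 2" using rx[THEN conjunct1] dim_D1[OF x] by simp
  obtain V \<phi> W E where V: "(V, \<phi>) \<in> atlas M" "open W" "W \<subseteq> V" "x \<in> \<phi> ` W"
      "\<And>i. i < r \<Longrightarrow> smooth_on W (E i)"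
      "\<And>u. u \<in> W \<Longrightarrow> span ((\<lambda>i::nat. E i u) ` {..<r}) = D1 (\<phi> u)"
    using rx[THEN conjunct2] by blast
  have pts: "\<phi> w \<in> points M" if "w \<in> W" for w
    using smooth_manifold_chart(6)[OF smooth_M V(1)] V(3) that by blast
  define e where "e w = triv (f (\<phi> w)) (E 0 w)" for w
  have E0: "E 0 w \<in> D1 (\<phi> w)" "E 0 w \<noteq> 0" if "w \<in> W" for w
  proof -
    have sp: "span {E 0 w, E 1 w} = D1 (\<phi> w)"
      using V(6)[OF that] by (simp add: r2 numeral_2_eq_2 lessThan_Suc insert_commute)
    then show "E 0 w \<in> D1 (\<phi> w)" by (metis insertI1 span_base)
    show "E 0 w \<noteq> 0"
    proof
      assume "E 0 w = 0"
      then have "dim (span {E 1 w}) = 2"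
        using sp dim_D1[OF pts[OF that]] by (simp add: span_insert_0)
      moreover have "dim {E 1 w} \<le> card {E 1 w}" by (rule dim_le_card') simp
      ultimately show False by simp
    qed
  qed
  note line = D1_line[OF pts E0, folded e_def]
  have chart: "isotropic_chart W (f \<circ> \<phi>) e"
  proof
    show "open W" by (rule V(2))
    show "smooth_on W (f \<circ> \<phi>)" by (rule smooth_on_subset[OF chart_immersion(1)[OF V(1)] V(3)])
    have "smooth_on W (E 0)" by (rule V(5)) (simp add: r2)
    from smooth_on_triv[OF V(2) smooth_on_subset[OF chart_immersion(1)[OF V(1)] V(3)] this]
    show "smooth_on W e" by (simp add: e_def[abs_def])
    fix u assume u: "u \<in> W"
    then have uV: "u \<in> V" using V(3) by blast
    show "(f \<circ> \<phi>) u \<in> S3S3" by (rule chart_immersion(2)[OF V(1) uV])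
    show "inj (frechet_derivative (f \<circ> \<phi>) (at u))" by (rule immersed_submanifoldD(4)[OF immersed V(1) uV])
    show "e u \<noteq> 0" by (rule line(1)[OF u u u])
    show "untriv ((f \<circ> \<phi>) u) (c *s e u) \<in> range (frechet_derivative (f \<circ> \<phi>) (at u))" for c
    proof -
      have "untriv (f (\<phi> u)) (c *s e u) \<in> D1 (\<phi> u)" unfolding line(2)[OF u u u] by (rule rangeI)
      then show ?thesis
        using D1_subset[OF pts[OF u]] tanM_chart[OF immersed V(1) uV] by (simp only: comp_apply) blast
    qed
    show "cdot (e u) (e u) = 0"
      by (rule D1_isotropic[OF pts[OF u]], unfold line(2)[OF u u u]) (rule rangeI)
  qed
  obtain u where "u \<in> W" "\<phi> u = x" using V(4) by blast
  moreover have "local_frame V \<phi> W e"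
    unfolding local_frame_def using V(1,3) chart line(2) by blast
  ultimately show ?thesis using that by blast
qed

end

context CR_isotropic
begin

lemma local_frameD:
  assumes "local_frame V \<phi> W e"
  shows "(V, \<phi>) \<in> atlas M" "W \<subseteq> V" "isotropic_chart W (f \<circ> \<phi>) e"
    "w \<in> W \<Longrightarrow> D1 (\<phi> w) = range (\<lambda>c. untriv (f (\<phi> w)) (c *s e w))"
    "w \<in> W \<Longrightarrow> w \<in> V" "w \<in> W \<Longrightarrow> \<phi> w \<in> points M" "w \<in> W \<Longrightarrow> f (\<phi> w) \<in> S3S3"
proof -
  show V: "(V, \<phi>) \<in> atlas M" "W \<subseteq> V" "isotropic_chart W (f \<circ> \<phi>) e"
    "w \<in> W \<Longrightarrow> D1 (\<phi> w) = range (\<lambda>c. untriv (f (\<phi> w)) (c *s e w))"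
    using assms unfolding local_frame_def by blast+
  show "w \<in> W \<Longrightarrow> w \<in> V" using V(2) by blast
  then show p: "w \<in> W \<Longrightarrow> \<phi> w \<in> points M"
    using smooth_manifold_chart(6)[OF smooth_M V(1)] by blast
  then show "w \<in> W \<Longrightarrow> f (\<phi> w) \<in> S3S3" using f_in by blast
qed

lemma tanM_local_frame:
  assumes "local_frame V \<phi> W e" "w \<in> W"
  shows "tanM M f (\<phi> w) = untriv (f (\<phi> w)) ` range (isotropic_chart.dF (f \<circ> \<phi>) w)"
proof -
  interpret isotropic_chart W "f \<circ> \<phi>" e by (rule local_frameD(3)[OF assms(1)])
  have "untriv (f (\<phi> w)) (dF w \<xi>) = frechet_derivative (f \<circ> \<phi>) (at w) \<xi>" for \<xi>
    using untriv_dF[OF assms(2), of \<xi>] by simp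
  then show ?thesis
    unfolding tanM_chart[OF immersed local_frameD(1)[OF assms(1)] local_frameD(5)[OF assms]]
    by (simp add: image_image)
qed

text \<open>The projection of a left-invariant vector field onto \<open>D1\<close>, which provides global sections without
  bump functions. It does not depend on the choice of the vector.\<close>

definition D1_section :: "complex^3 \<Rightarrow> 'm \<Rightarrow> quat2" where
  "D1_section c x = (let e = triv (f x) (SOME d. d \<in> D1 x \<and> d \<noteq> 0) in untriv (f x) (line_coeff c e *s e))"

text \<open>Any vector that the choice may return is a nonzero complex multiple of
  \<open>e w\<close>, and the projection onto a line does not depend on its generator.\<close>

lemma D1_section_local_frame:
  assumes F: "local_frame V \<phi> W e" and w: "w \<in> W"
  shows "D1_section c (\<phi> w) = untriv (f (\<phi> w)) (line_coeff c (e w) *s e w)"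
proof -
  interpret isotropic_chart W "f \<circ> \<phi>" e by (rule local_frameD(3)[OF F])
  let ?p = "f (\<phi> w)"
  have p: "?p \<in> S3S3" by (rule local_frameD(7)[OF F w])
  define d where "d = (SOME d. d \<in> D1 (\<phi> w) \<and> d \<noteq> 0)"
  have "untriv ?p (1 *s e w) \<in> D1 (\<phi> w)" unfolding local_frameD(4)[OF F w] by (rule rangeI)
  moreover have "untriv ?p (1 *s e w) \<noteq> 0"
    using triv_untriv[OF p, of "e w"] e_nonzero[OF w] triv.zero_right by (metis vector_smult_lid)
  ultimately have d: "d \<in> D1 (\<phi> w)" "d \<noteq> 0"
    unfolding d_def by (metis (mono_tags, lifting) someI_ex)+
  then obtain a where a: "d = untriv ?p (a *s e w)" using local_frameD(4)[OF F w] by auto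
  have nz: "a \<noteq> 0" using d(2) a untriv.zero_right by (metis vector_smult_lzero)
  have "triv ?p d = a *s e w" using p by (simp add: a)
  then show ?thesis
    by (simp only: D1_section_def d_def[symmetric] Let_def line_coeff_scale[OF nz])
qed

lemma smooth_D1_section: "smooth_map M (D1_section c)"
proof (rule smooth_map_local[OF smooth_M])
  fix x assume "x \<in> points M"
  then obtain V \<phi> W e u where F: "local_frame V \<phi> W e" and u: "u \<in> W" "\<phi> u = x"
    using local_frame_exists by metis
  interpret isotropic_chart W "f \<circ> \<phi>" e by (rule local_frameD(3)[OF F])
  have "smooth_on W (\<lambda>w. untriv ((f \<circ> \<phi>) w) (line_coeff c (e w) *s e w))"
    by (intro smooth_on_untriv smooth_on_smult smooth_on_line_coeff open_W smooth_F smooth_e smooth_on_const e_nonzero)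
  then have "smooth_on W (D1_section c \<circ> \<phi>)"
    by (rule smooth_on_cong[OF open_W, rotated]) (simp add: D1_section_local_frame[OF F])
  then show "\<exists>V \<phi> W. (V, \<phi>) \<in> atlas M \<and> open W \<and> W \<subseteq> V \<and> x \<in> \<phi> ` W \<and> smooth_on W (D1_section c \<circ> \<phi>)"
    using local_frameD(1,2)[OF F] u open_W by blast
qed

lemma D1_section_in_D1: "x \<in> points M \<Longrightarrow> D1_section c x \<in> D1 x"
proof -
  assume "x \<in> points M"
  then obtain V \<phi> W e u where F: "local_frame V \<phi> W e" and u: "u \<in> W" "\<phi> u = x"
    using local_frame_exists by metis
  show "D1_section c x \<in> D1 x"
    using D1_section_local_frame[OF F u(1), of c] local_frameD(4)[OF F u(1)] by (simp add: u(2))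
qed

section \<open>Points where \<open>D1\<close> is not involutive\<close>

text \<open>The pointwise form of nonintegrability. Nonintegrability itself asks for a single such
  point, while the equality with \<open>D3\<close> concerns all points; connectedness closes this
  gap.\<close>

definition noninvolutive :: "'m set" where
  "noninvolutive = {x \<in> points M. \<exists>X Y. smooth_map M X \<and> smooth_map M Y \<and>
    (\<forall>x\<in>points M. X x \<in> D1 x) \<and> (\<forall>x\<in>points M. Y x \<in> D1 x) \<and> bracketM M f X Y x \<notin> D1 x}"

lemma integrable_iff: "integrable_distribution M f D1 \<longleftrightarrow> noninvolutive = {}"
  unfolding integrable_distribution_def noninvolutive_def by blast

lemma bracketM_local_frame:
  assumes F: "local_frame V \<phi> W e" and u: "u \<in> W"
    and X: "smooth_map M X" "\<And>x. x \<in> points M \<Longrightarrow> X x \<in> D1 x"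
    and Y: "smooth_map M Y" "\<And>x. x \<in> points M \<Longrightarrow> Y x \<in> D1 x"
    and h: "X (\<phi> u) = untriv (f (\<phi> u)) (h *s e u)" and k: "Y (\<phi> u) = untriv (f (\<phi> u)) (k *s e u)"
  shows "bracketM M f X Y (\<phi> u) \<in> D1 (\<phi> u) \<longleftrightarrow>
    (Re h * Im k - Im h * Re k) = 0 \<or> ccross (e u) (isotropic_chart.frame_bracket (f \<circ> \<phi>) e u) = 0"
proof -
  interpret isotropic_chart W "f \<circ> \<phi>" e by (rule local_frameD(3)[OF F])
  let ?c = "\<lambda>X w. line_coeff (triv ((f \<circ> \<phi>) w) ((X \<circ> \<phi>) w)) (e w)"
  have p: "f (\<phi> u) \<in> S3S3" by (rule local_frameD(7)[OF F u])
  have sm: "smooth_on W (X \<circ> \<phi>)" "smooth_on W (?c X)" if "smooth_map M X" for X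
  proof -
    show s: "smooth_on W (X \<circ> \<phi>)"
      by (rule smooth_on_subset[OF smooth_map_smooth_on[OF that local_frameD(1)[OF F]] local_frameD(2)[OF F]])
    show "smooth_on W (?c X)"
      by (intro smooth_on_line_coeff smooth_on_triv open_W smooth_F smooth_e e_nonzero s)
  qed
  have eq: "(X \<circ> \<phi>) w = untriv ((f \<circ> \<phi>) w) (?c X w *s e w)"
    if "w \<in> W" "\<And>x. x \<in> points M \<Longrightarrow> X x \<in> D1 x" for w X
  proof -
    have "X (\<phi> w) \<in> D1 (\<phi> w)" using that local_frameD(6)[OF F] by blast
    then have "X (\<phi> w) \<in> range (\<lambda>c. untriv (f (\<phi> w)) (c *s e w))"
      by (simp only: local_frameD(4)[OF F that(1)])
    then show ?thesis using local_frameD(7)[OF F that(1)] e_nonzero[OF that(1)] by auto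
  qed
  have hk: "?c X u = h" "?c Y u = k" using p e_nonzero[OF u] by (simp_all add: h k)
  define \<xi> \<eta> where "\<xi> = chart_coord u (h *s e u)" and "\<eta> = chart_coord u (k *s e u)"
  have \<xi>: "dF u \<xi> = ?c X u *s e u" "dF u \<eta> = ?c Y u *s e u"
    by (simp_all only: \<xi>_def \<eta>_def hk dF_chart_coord[OF e_in_dF[OF u]])
  have XF: "X (\<phi> u) = frechet_derivative (f \<circ> \<phi>) (at u) \<xi>" "Y (\<phi> u) = frechet_derivative (f \<circ> \<phi>) (at u) \<eta>"
    using untriv_dF[OF u, of \<xi>] untriv_dF[OF u, of \<eta>] h k \<xi>[unfolded hk] by (simp_all only: comp_apply)
  have fd: "frechet_derivative (X \<circ> \<phi>) (at u) = frechet_derivative (\<lambda>w. untriv ((f \<circ> \<phi>) w) (?c X w *s e w)) (at u)"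
    if "smooth_map M X" "\<And>x. x \<in> points M \<Longrightarrow> X x \<in> D1 x" for X
    by (rule frechet_derivative_transform_within_open[OF _ open_W u eq[OF _ that(2)]])
      (use differentiableI[OF smooth_on_has_derivative[OF sm(1)[OF that(1)] u]] in blast)
  have sme: "smooth_on W (\<lambda>w. ?c X w *s e w)" if "smooth_map M X" for X
    by (intro smooth_on_smult open_W smooth_e sm that)
  define B where "B = frechet_derivative (\<lambda>w. ?c Y w *s e w) (at u) \<xi>
    - frechet_derivative (\<lambda>w. ?c X w *s e w) (at u) \<eta> + lie (?c X u *s e u) (?c Y u *s e u)"
  have "bracketM M f X Y (\<phi> u) = untriv (f (\<phi> u)) B"
    using bracket_untriv[OF u sme[OF X(1)] sme[OF Y(1)] \<xi>]
      bracketM_chart[OF immersed local_frameD(1)[OF F] local_frameD(5)[OF F u] X(1) Y(1) XF]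
    by (simp add: fd[OF X] fd[OF Y] B_def)
  then have "bracketM M f X Y (\<phi> u) \<in> D1 (\<phi> u) \<longleftrightarrow> B \<in> range (\<lambda>c. c *s e u)"
    unfolding local_frameD(4)[OF F u] using triv_untriv[OF p] by (auto simp: image_iff) metis
  also have "\<dots> \<longleftrightarrow> ccross (e u) B = 0"
    using ccross_eq_0D[OF _ e_nonzero[OF u], of B] ccross_self(2)[of "e u"] by blast
  also have "ccross (e u) B = of_real (Re h * Im k - Im h * Re k) *s ccross (e u) (frame_bracket u)"
    unfolding B_def using frame_bracket_multiple[OF u sm(2)[OF X(1)] sm(2)[OF Y(1)] \<xi>] by (simp only: hk)
  finally show ?thesis by (simp only: vector_mul_eq_0 of_real_eq_0_iff)
qed

text \<open>Integrability quantifies over global sections. Projecting the constants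
  \<open>e u\<close> and \<open>\<i> *s e u\<close> onto \<open>D1\<close> yields global sections
  whose coefficient determinant at \<open>u\<close> is 1, so the transversal part of the frame
  bracket is realized.\<close>

lemma noninvolutive_local_frame:
  assumes F: "local_frame V \<phi> W e" and u: "u \<in> W"
  shows "\<phi> u \<in> noninvolutive \<longleftrightarrow> ccross (e u) (isotropic_chart.frame_bracket (f \<circ> \<phi>) e u) \<noteq> 0"
proof -
  interpret isotropic_chart W "f \<circ> \<phi>" e by (rule local_frameD(3)[OF F])
  show ?thesis
  proof
    assume "\<phi> u \<in> noninvolutive"
    then obtain X Y where XY: "smooth_map M X" "smooth_map M Y" "\<And>x. x \<in> points M \<Longrightarrow> X x \<in> D1 x"
      "\<And>x. x \<in> points M \<Longrightarrow> Y x \<in> D1 x" "bracketM M f X Y (\<phi> u) \<notin> D1 (\<phi> u)"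
      unfolding noninvolutive_def by blast
    obtain h k where "X (\<phi> u) = untriv (f (\<phi> u)) (h *s e u)" "Y (\<phi> u) = untriv (f (\<phi> u)) (k *s e u)"
      using XY(3,4)[OF local_frameD(6)[OF F u]] unfolding local_frameD(4)[OF F u] by blast
    from bracketM_local_frame[OF F u XY(1,3,2,4) this] XY(5)
    show "ccross (e u) (frame_bracket u) \<noteq> 0" by blast
  next
    assume R: "ccross (e u) (frame_bracket u) \<noteq> 0"
    have X: "D1_section (c *s e u) (\<phi> u) = untriv (f (\<phi> u)) (c *s e u)" for c
      by (simp add: D1_section_local_frame[OF F u] e_nonzero[OF u])
    have "bracketM M f (D1_section (1 *s e u)) (D1_section (\<i> *s e u)) (\<phi> u) \<notin> D1 (\<phi> u)"
      using bracketM_local_frame[OF F u smooth_D1_section D1_section_in_D1 smooth_D1_section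
          D1_section_in_D1 X[of 1] X[of \<i>]] R by simp
    then show "\<phi> u \<in> noninvolutive"
      unfolding noninvolutive_def
      using local_frameD(6)[OF F u] smooth_D1_section D1_section_in_D1 by blast
  qed
qed

lemma noninvolutive_clopen:
  assumes "connected_space (topology_of M)"
  shows "noninvolutive = {} \<or> noninvolutive = points M"
proof -
  have sub: "noninvolutive \<subseteq> points M" unfolding noninvolutive_def by blast
  have "openin (topology_of M) noninvolutive"
  proof (subst openin_subopen, intro ballI)
    fix x assume x: "x \<in> noninvolutive"
    then obtain V \<phi> W e u where F: "local_frame V \<phi> W e" and u: "u \<in> W" "\<phi> u = x"
      using local_frame_exists sub by (metis subsetD)
    interpret isotropic_chart W "f \<circ> \<phi>" e by (rule local_frameD(3)[OF F])
    let ?U = "{w \<in> W. ccross (e w) (frame_bracket w) \<noteq> 0}"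
    have "openin (topology_of M) (\<phi> ` ?U)"
      by (rule smooth_manifold_chart(5)[OF smooth_M local_frameD(1)[OF F] open_noninvolutive])
        (use local_frameD(2)[OF F] in blast)
    moreover have "x \<in> \<phi> ` ?U"
      using x u noninvolutive_local_frame[OF F u(1)] by blast
    moreover have "\<phi> ` ?U \<subseteq> noninvolutive"
      using noninvolutive_local_frame[OF F] by blast
    ultimately show "\<exists>T. openin (topology_of M) T \<and> x \<in> T \<and> T \<subseteq> noninvolutive" by blast
  qed
  \<comment> \<open>That the transversal part vanishes on a closed set is continuity; that this set
    is open as well is the content of \<open>involutive_nbhd\<close>.\<close>
  moreover have "openin (topology_of M) (points M - noninvolutive)"
  proof (subst openin_subopen, intro ballI)
    fix x assume x: "x \<in> points M - noninvolutive"
    then obtain V \<phi> W e u where F: "local_frame V \<phi> W e" and u: "u \<in> W" "\<phi> u = x"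
      using local_frame_exists by (metis DiffD1)
    interpret isotropic_chart W "f \<circ> \<phi>" e by (rule local_frameD(3)[OF F])
    have "ccross (e u) (frame_bracket u) = 0"
      using noninvolutive_local_frame[OF F u(1)] x u(2) by blast
    then obtain U where U: "open U" "u \<in> U" "U \<subseteq> W" "\<And>w. w \<in> U \<Longrightarrow> ccross (e w) (frame_bracket w) = 0"
      using involutive_nbhd[OF u(1)] by metis
    have "openin (topology_of M) (\<phi> ` U)"
      by (rule smooth_manifold_chart(5)[OF smooth_M local_frameD(1)[OF F] U(1)])
        (use U(3) local_frameD(2)[OF F] in blast)
    moreover have "\<phi> ` U \<subseteq> points M - noninvolutive"
      using noninvolutive_local_frame[OF F] U(3,4) local_frameD(6)[OF F] by blast
    ultimately show "\<exists>T. openin (topology_of M) T \<and> x \<in> T \<and> T \<subseteq> points M - noninvolutive"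
      using U(2) u(2) by blast
  qed
  ultimately show ?thesis
    using assms sub unfolding connected_space_clopen_in closedin_def by blast
qed

section \<open>\<open>D3\<close> and the image of \<open>D1\<close> under \<open>PS\<close> in a
  local frame\<close>

text \<open>Real orthogonality to a complex line is orthogonality for the Hermitian product, by
  testing with the multiples 1 and \<i>.\<close>

lemma complement_local_frame:
  assumes F: "local_frame V \<phi> W e" and u: "u \<in> W"
  shows "complement_in_tan M f D1 (\<phi> u)
    = untriv (f (\<phi> u)) ` {t \<in> range (isotropic_chart.dF (f \<circ> \<phi>) u). cdot t (vcnj (e u)) = 0}"
proof -
  have orth: "(\<forall>c. t \<bullet> (c *s e u) = 0) \<longleftrightarrow> cdot t (vcnj (e u)) = 0" for t
  proof
    assume "\<forall>c. t \<bullet> (c *s e u) = 0"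
    then have "Re (cnj c * cdot t (vcnj (e u))) = 0" for c
      by (simp add: inner_c3 cdot_linear)
    from this[of 1] this[of \<i>] show "cdot t (vcnj (e u)) = 0" by (simp add: complex_eq_iff)
  qed (simp add: inner_c3 cdot_linear)
  have "(\<forall>w\<in>D1 (\<phi> u). gS (f (\<phi> u)) (untriv (f (\<phi> u)) t) w = 0) \<longleftrightarrow> cdot t (vcnj (e u)) = 0" for t
    unfolding local_frameD(4)[OF F u] orth[symmetric]
    by (simp add: gS_untriv[OF local_frameD(7)[OF F u]])
  then show ?thesis
    unfolding complement_in_tan_def tanM_local_frame[OF F u] by blast
qed

text \<open>\<open>Gtens\<close> is conjugate linear in both arguments and annihilates pairs from
  one complex line. A tangent vector thus enters only through its real coefficient along
  \<open>dF u \<eta>\<close>; the complement and its image under \<open>JS\<close> together supply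
  the complex coefficients.\<close>

lemma D3_local_frame:
  assumes LC: "Levi_Civita nabla" and F: "local_frame V \<phi> W e" and u: "u \<in> W"
    and \<eta>: "ccross (e u) (isotropic_chart.dF (f \<circ> \<phi>) u \<eta>) \<noteq> 0"
  shows "D3 nabla M f D1 (\<phi> u)
    = range (\<lambda>c. untriv (f (\<phi> u)) (c *s vcnj (ccross (e u) (isotropic_chart.dF (f \<circ> \<phi>) u \<eta>))))"
proof -
  interpret isotropic_chart W "f \<circ> \<phi>" e by (rule local_frameD(3)[OF F])
  let ?p = "f (\<phi> u)" and ?n = "vcnj (ccross (e u) (dF u \<eta>))"
  have p: "?p \<in> S3S3" by (rule local_frameD(7)[OF F u])
  let ?T = "{t \<in> range (dF u). cdot t (vcnj (e u)) = 0}"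
  have n: "\<exists>r. ccross (e u) t = of_real r *s ccross (e u) (dF u \<eta>)" if t: "t \<in> range (dF u)" for t
  proof -
    obtain c r where "t = c *s e u + r *\<^sub>R dF u \<eta>" using tangent_decomposition[OF u \<eta> t] .
    then show ?thesis by (auto simp: ccross_linear scaleR_c3)
  qed
  \<comment> \<open>The transversal vector minus its Hermitian projection onto the line of
    \<open>e u\<close>: it lies in the complement and keeps the cross product with
    \<open>e u\<close>.\<close>
  define t0 where "t0 = dF u \<eta> - line_coeff (dF u \<eta>) (e u) *s e u"
  have t0: "t0 \<in> ?T"
    using e_nonzero[OF u] subspace_diff[OF subspace_dF[OF u] _ e_in_dF[OF u]]
    by (simp add: t0_def cdot_linear line_coeff_def)
  have n0: "ccross (e u) t0 = ccross (e u) (dF u \<eta>)"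
    by (simp add: t0_def c3_simps algebra_simps)
  have D2: "untriv ?p t0 \<in> D2 M f D1 (\<phi> u)"
  proof -
    have "untriv ?p 0 \<in> complement_in_tan M f D1 (\<phi> u)"
      unfolding complement_local_frame[OF F u] using subspace_0[OF subspace_dF[OF u]]
      by (intro imageI) (simp add: cdot_linear)
    moreover have "untriv ?p t0 \<in> complement_in_tan M f D1 (\<phi> u)"
      unfolding complement_local_frame[OF F u] using t0 by (rule imageI)
    moreover have "untriv ?p t0 = untriv ?p t0 + JS ?p (untriv ?p 0)"
      by (simp only: JS_untriv[OF p]) (simp add: untriv.zero_right)
    ultimately show ?thesis unfolding D2_def by blast
  qed
  let ?G = "{GS nabla X Y ?p | X Y. vector_fieldS X \<and> vector_fieldS Y \<and>
    X ?p \<in> D1 (\<phi> u) \<and> Y ?p \<in> D2 M f D1 (\<phi> u)}"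
  have "?G = range (\<lambda>c. untriv ?p (c *s ?n))"
  proof (intro equalityI subsetI)
    fix z assume "z \<in> ?G"
    then obtain X Y where z: "z = GS nabla X Y ?p" "vector_fieldS X" "vector_fieldS Y"
      "X ?p \<in> D1 (\<phi> u)" "Y ?p \<in> D2 M f D1 (\<phi> u)" by blast
    obtain c where "X ?p = untriv ?p (c *s e u)"
      using z(4) unfolding local_frameD(4)[OF F u] by blast
    then have c: "coords X ?p = c *s e u" by (simp add: coords_def p)
    obtain t s where ts: "t \<in> ?T" "s \<in> ?T" "Y ?p = untriv ?p t + JS ?p (untriv ?p s)"
      using z(5) unfolding D2_def complement_local_frame[OF F u] by blast
    then have Y: "coords Y ?p = t + \<i> *s s" by (simp add: coords_def p untriv.add_right[symmetric])
    obtain r where r: "ccross (e u) t = of_real r *s ccross (e u) (dF u \<eta>)" using n ts(1) by blast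
    obtain r' where r': "ccross (e u) s = of_real r' *s ccross (e u) (dF u \<eta>)" using n ts(2) by blast
    have "Gtens (c *s e u) (t + \<i> *s s) = ((2/3 * \<i>) * cnj (c * (of_real r + \<i> * of_real r'))) *s ?n"
      by (simp add: Gtens_def ccross_linear r r' vec_eq_iff algebra_simps)
    then have "z = untriv ?p (((2/3 * \<i>) * cnj (c * (of_real r + \<i> * of_real r'))) *s ?n)"
      by (simp only: z(1) GS_eq[OF LC z(2,3) p] c Y)
    then show "z \<in> range (\<lambda>c. untriv ?p (c *s ?n))" by (rule range_eqI)
  next
    fix z assume "z \<in> range (\<lambda>c. untriv ?p (c *s ?n))"
    then obtain d where z: "z = untriv ?p (d *s ?n)" by blast
    \<comment> \<open>Solves \<open>2/3 * \<i> * cnj c = d\<close>, as \<open>Gtens\<close> is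
      conjugate linear in its first argument.\<close>
    define c where "c = cnj (d / (2/3 * \<i>))"
    have "coords (\<lambda>q. untriv q x) ?p = x" for x by (simp add: coords_def p)
    moreover have "Gtens (c *s e u) t0 = d *s ?n"
      by (simp add: Gtens_def ccross_linear n0 c_def vec_eq_iff)
    ultimately have "z = GS nabla (\<lambda>q. untriv q (c *s e u)) (\<lambda>q. untriv q t0) ?p"
      by (simp add: GS_eq[OF LC vector_fieldS_left_invariant vector_fieldS_left_invariant p] z)
    moreover have "untriv ?p (c *s e u) \<in> D1 (\<phi> u)"
      unfolding local_frameD(4)[OF F u] by (rule rangeI)
    ultimately show "z \<in> ?G" using D2 vector_fieldS_left_invariant by blast
  qed
  \<comment> \<open>The values already form a real subspace, so the span in \<open>D3\<close> adds
    nothing.\<close>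
  moreover have "subspace (range (\<lambda>c. untriv ?p (c *s ?n)))"
    by (rule dim_untriv_line(1)[OF p]) (use \<eta> in \<open>metis vcnj_linear(4,5)\<close>)
  ultimately show ?thesis unfolding D3_def by (simp only: span_eq_iff)
qed

text \<open>Conjugation turns the equality into one between the complex lines of \<open>e u\<close>
  and of its cross product with the transversal vector. That product is orthogonal to the
  transversal vector, so coincidence of the lines yields orthogonality for \<open>e u\<close>; the
  converse is \<open>ccross_isotropic\<close>.\<close>

lemma PS_D1_eq_D3_iff:
  assumes LC: "Levi_Civita nabla" and F: "local_frame V \<phi> W e" and u: "u \<in> W"
  shows "PS (f (\<phi> u)) ` D1 (\<phi> u) = D3 nabla M f D1 (\<phi> u) \<longleftrightarrow>
    (\<forall>\<xi>. cdot (e u) (isotropic_chart.dF (f \<circ> \<phi>) u \<xi>) = 0)"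
proof -
  interpret isotropic_chart W "f \<circ> \<phi>" e by (rule local_frameD(3)[OF F])
  obtain \<eta> where \<eta>: "ccross (e u) (dF u \<eta>) \<noteq> 0" using transversal_exists[OF u] .
  let ?p = "f (\<phi> u)" and ?n = "ccross (e u) (dF u \<eta>)"
  have p: "?p \<in> S3S3" by (rule local_frameD(7)[OF F u])
  have PD: "PS ?p ` D1 (\<phi> u) = untriv ?p ` vcnj ` range (\<lambda>c. c *s e u)"
    unfolding local_frameD(4)[OF F u] image_image PS_untriv[OF p] ..
  have "range (\<lambda>c. untriv ?p (c *s vcnj ?n)) = untriv ?p ` vcnj ` range (\<lambda>c. c *s ?n)"
  proof -
    have "c *s vcnj ?n = vcnj (cnj c *s ?n)" for c by simp
    then have "range (\<lambda>c. untriv ?p (c *s vcnj ?n)) = (\<lambda>c. untriv ?p (vcnj (c *s ?n))) ` range cnj"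
      by (simp only: image_image)
    moreover have "range cnj = UNIV" by (metis complex_cnj_cnj surjI)
    ultimately show ?thesis by (simp only: image_image)
  qed
  then have D3: "D3 nabla M f D1 (\<phi> u) = untriv ?p ` vcnj ` range (\<lambda>c. c *s ?n)"
    using D3_local_frame[OF LC F u \<eta>] by simp
  have inj: "inj (untriv ?p)" "inj vcnj" using p by (metis injI triv_untriv) (metis injI vcnj_linear(4))
  have "PS ?p ` D1 (\<phi> u) = D3 nabla M f D1 (\<phi> u) \<longleftrightarrow> range (\<lambda>c. c *s e u) = range (\<lambda>c. c *s ?n)"
    unfolding PD D3 by (simp add: inj_image_eq_iff inj)
  also have "\<dots> \<longleftrightarrow> (\<forall>\<xi>. cdot (e u) (dF u \<xi>) = 0)"
  proof
    assume "range (\<lambda>c. c *s e u) = range (\<lambda>c. c *s ?n)"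
    then have "1 *s ?n \<in> range (\<lambda>c. c *s e u)" by (metis rangeI)
    then obtain a where a: "?n = a *s e u" by auto
    then have "a \<noteq> 0" using \<eta> by auto
    moreover have "a * cdot (e u) (dF u \<eta>) = 0"
      using a cdot_ccross(2)[of "dF u \<eta>" "e u"] by (simp add: cdot_linear cdot_commute)
    ultimately have v: "cdot (e u) (dF u \<eta>) = 0" by simp
    show "\<forall>\<xi>. cdot (e u) (dF u \<xi>) = 0"
    proof
      fix \<xi>
      obtain c r where "dF u \<xi> = c *s e u + r *\<^sub>R dF u \<eta>"
        using tangent_decomposition[OF u \<eta>, of "dF u \<xi>"] by blast
      then show "cdot (e u) (dF u \<xi>) = 0" by (simp add: scaleR_c3 cdot_linear isotropic[OF u] v)
    qed
  next
    assume "\<forall>\<xi>. cdot (e u) (dF u \<xi>) = 0"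
    then obtain a where a: "?n = a *s e u"
      using ccross_isotropic[OF e_nonzero[OF u] isotropic[OF u]] by blast
    then have "a \<noteq> 0" using \<eta> by auto
    then have "c *s e u = (c / a) *s ?n" "c *s ?n = (c * a) *s e u" for c
      by (simp_all add: a)
    then show "range (\<lambda>c. c *s e u) = range (\<lambda>c. c *s ?n)" by (metis (no_types, lifting) image_subset_iff rangeI subset_antisym)
  qed
  finally show ?thesis .
qed

text \<open>For the forward direction, one bracket leaving \<open>D1\<close> spreads over the
  connected \<open>M\<close>, after which orthogonality is pointwise. Backwards, orthogonality holds
  on whole charts, so it may be differentiated, and any single point exhibits
  nonintegrability.\<close>

lemma nonintegrable_iff:
  assumes LC: "Levi_Civita nabla" and conn: "connected_space (topology_of M)"
  shows "\<not> integrable_distribution M f D1 \<longleftrightarrow> (\<forall>x\<in>points M. PS (f x) ` D1 x = D3 nabla M f D1 x)"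
proof
  assume "\<not> integrable_distribution M f D1"
  then have N: "noninvolutive = points M" using noninvolutive_clopen[OF conn] integrable_iff by blast
  show "\<forall>x\<in>points M. PS (f x) ` D1 x = D3 nabla M f D1 x"
  proof
    fix x assume x: "x \<in> points M"
    then obtain V \<phi> W e u where F: "local_frame V \<phi> W e" and u: "u \<in> W" "\<phi> u = x"
      using local_frame_exists by metis
    interpret isotropic_chart W "f \<circ> \<phi>" e by (rule local_frameD(3)[OF F])
    have "ccross (e u) (frame_bracket u) \<noteq> 0"
      using noninvolutive_local_frame[OF F u(1)] x N u(2) by blast
    then show "PS (f x) ` D1 x = D3 nabla M f D1 x"
      using PS_D1_eq_D3_iff[OF LC F u(1)] noninvolutive_imp_orthogonal[OF u(1)] u(2) by blast
  qed
next
  assume eq: "\<forall>x\<in>points M. PS (f x) ` D1 x = D3 nabla M f D1 x"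
  \<comment> \<open>\<open>M\<close> is nonempty, since an empty manifold would be almost
    complex.\<close>
  obtain x where x: "x \<in> points M" using CR_D1(2) unfolding almost_complex_def by blast
  then obtain V \<phi> W e u where F: "local_frame V \<phi> W e" and u: "u \<in> W" "\<phi> u = x"
    using local_frame_exists by metis
  interpret isotropic_chart W "f \<circ> \<phi>" e by (rule local_frameD(3)[OF F])
  have "cdot (e w) (dF w \<xi>) = 0" if "w \<in> W" for w \<xi>
    using PS_D1_eq_D3_iff[OF LC F that] eq local_frameD(6)[OF F that] by blast
  then have "ccross (e u) (frame_bracket u) \<noteq> 0"
    by (rule orthogonal_imp_noninvolutive[OF _ u(1)])
  then show "\<not> integrable_distribution M f D1"
    using noninvolutive_local_frame[OF F u(1)] integrable_iff by blast
qed

end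

theorem theorem3:
  fixes M :: "(real^3, 'm) manifold"
    and f :: "'m \<Rightarrow> quat2"
    and D1 :: "'m \<Rightarrow> quat2 set"
    and nabla :: "(quat2 \<Rightarrow> quat2) \<Rightarrow> (quat2 \<Rightarrow> quat2) \<Rightarrow> quat2 \<Rightarrow> quat2"
  assumes "Levi_Civita nabla"
    and "connected_space (topology_of M)"
    and "proper_CR_submanifold M f D1"
    and "\<forall>x\<in>points M. \<forall>v\<in>D1 x. \<forall>w\<in>D1 x. gS (f x) (PS (f x) v) w = 0"
  shows "\<not> integrable_distribution M f D1 \<longleftrightarrow>
         (\<forall>x\<in>points M. PS (f x) ` D1 x = D3 nabla M f D1 x)"
proof -
  interpret CR_isotropic M f D1 by unfold_locales (use assms(3,4) in blast)+
  show ?thesis by (rule nonintegrable_iff[OF assms(1,2)])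
qed

end
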